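(* Let $X$ be a finite simplicial complex, let $f$ be a discrete Morse function on $X$ with induced Morse system $\Sigma$, and let $C=\mathrm{Flo}_\Sigma[X]$ be the discrete flow category of $f$. Then for all objects $w$ and $z$ of $C$, the poset $\mathrm{Hom}_C(w,z)^{\mathrm{op}}$ is (isomorphic to) the face poset of some regular CW complex.
   Context: A regular CW complex is a CW complex in which every attaching map is a homeomorphism onto its image; a simplicial complex is viewed as a regular CW complex whose cells are its simplices. For cells write $y<x$ (or $x>y$) if $y\neq x$ and $y$ is contained in the closure of $x$. The face poset of a regular CW complex is the set of its cells, ordered by $x\ge y$ iff $y$ is contained in the closure of $x$ (no least element is added). The opposite poset $P^{\mathrm{op}}$ has the reversed order. Discrete Morse functions. A discrete Morse function on a regular CW complex $X$ assigns a real number $f(x)$ to each cell such that for each $k$-cell $x$ there is at most one $(k+1)$-cell $y>x$ with $f(x)\ge f(y)$ and at most one $(k-1)$-cell $y<x$ with $f(y)\ge f(x)$. A regular pair is a pair $\{x,y\}$ with $x$ a $k$-cell, $y$ a $(k+1)$-cell, $x<y$ and $f(x)\ge f(y)$. Regular pairs are pairwise disjoint. A cell is critical if it lies in no regular pair. A p-category is a category whose Hom sets are posets (order written $\Rightarrow$) such that composition is monotone. Entrance path category $\mathrm{Ent}[X]$: objects are the cells of $X$; morphisms $x\to y$ are strictly descending sequences of cells $(x=x_0>x_1>\dots>x_k=y)$, with $\mathrm{id}_x=(x)$; composition is concatenation of sequences (merging the common cell); $g\Rightarrow g'$ iff $g$ is a (not necessarily contiguous) subsequence of $g'$. Morse system: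 $\Sigma$ is the set of morphisms $(y>x)\colon y\to x$ with $\{x,y\}$ a regular pair ($x<y$); $\Sigma^+$ is $\Sigma$ together with all identities. Localization $\mathrm{Loc}_\Sigma[X]$: objects are the cells of $X$. Morphisms $w\to z$ are equivalence classes of zigzags $$w=x_0\xrightarrow{g_0}y_0\xleftarrow{f_0}x_1\xrightarrow{g_1}y_1\xleftarrow{f_1}\cdots\xleftarrow{f_{k-1}}x_k\xrightarrow{g_k}y_k=z$$ with $k\ge 0$, $g_i$ arbitrary morphisms of $\mathrm{Ent}[X]$ and $f_i\colon x_{i+1}\to y_i$ in $\Sigma^+$. The equivalence relation is generated by: (horizontal) inserting or deleting intermediate identity maps, i.e. exchanging $x_i\xrightarrow{g_i}y_i\xleftarrow{\mathrm{id}}y_i\xrightarrow{g_{i+1}}y_{i+1}$ with $x_i\xrightarrow{g_{i+1}\circ g_i}y_{i+1}$; (vertical) identifying zigzags $(x_i,y_i,g_i,f_i)$ and $(x_i',y_i',g_i',f_i')$ of the same length when there are $u_i\colon y_i\to y_i'$ and $v_i\colon x_i\to x_i'$ in $\Sigma^+$ with $v_0=\mathrm{id}_w$, $u_k=\mathrm{id}_z$, $u_i\circ g_i=g_i'\circ v_i$ and $u_i\circ f_i=f_i'\circ v_{i+1}$. The order: $[\gamma']\Rightarrow[\gamma]$ iff there are representatives $(x_i',y_i',g_i',f_i')$ of $[\gamma']$ and $(x_i,y_i,g_i,f_i)$ of $[\gamma]$ of the same length and $u_i\colon y_i\to y_i'$, $v_i\colon x_i\to x_i'$ in $\Sigma^+$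 with $v_0=\mathrm{id}_w$, $u_k=\mathrm{id}_z$, $g_i'\circ v_i\Rightarrow u_i\circ g_i$ and $f_i'\circ v_{i+1}\Rightarrow u_i\circ f_i$. Composition is concatenation of zigzags (composing the two adjacent right-pointing arrows). The discrete flow category $\mathrm{Flo}_\Sigma[X]$ is the full sub-p-category of $\mathrm{Loc}_\Sigma[X]$ on the critical cells of $f$. *)

theory Defs
  imports "HOL-Analysis.Analysis" "HOL-Library.Sublist"
begin

definition disk :: "nat \<Rightarrow> (nat \<Rightarrow> real) set"
  where "disk n = {x \<in> topspace (Euclidean_space n). (\<Sum>i<n. (x i)\<^sup>2) \<le> 1}"

definition open_disk :: "nat \<Rightarrow> (nat \<Rightarrow> real) set"
  where "open_disk n = {x \<in> topspace (Euclidean_space n). (\<Sum>i<n. (x i)\<^sup>2) < 1}"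

definition disk_boundary :: "nat \<Rightarrow> (nat \<Rightarrow> real) set"
  where "disk_boundary n = {x \<in> topspace (Euclidean_space n). (\<Sum>i<n. (x i)\<^sup>2) = 1}"

text \<open>
  A space decomposed into open cells, each with a dimension. The dimension of a set that is not
  a cell is irrelevant.
\<close>

record 'a cw =
  cw_space :: "'a topology"
  cells :: "'a set set"
  cdim :: "'a set \<Rightarrow> nat"

text \<open>
  \<open>\<Phi> e\<close> is the characteristic map of the cell \<open>e\<close>; its restriction to the boundary sphere is the
  attaching map. The last two conjuncts are closure-finiteness and the weak topology.
\<close>

definition cw_complex :: "'a cw \<Rightarrow> ('a set \<Rightarrow> (nat \<Rightarrow> real) \<Rightarrow> 'a) \<Rightarrow> bool"
  where "cw_complex X \<Phi> \<longleftrightarrow>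
    Hausdorff_space (cw_space X) \<and>
    \<Union>(cells X) = topspace (cw_space X) \<and>
    disjoint (cells X) \<and>
    (\<forall>e \<in> cells X.
       continuous_map (subtopology (Euclidean_space (cdim X e)) (disk (cdim X e)))
         (cw_space X) (\<Phi> e) \<and>
       homeomorphic_map (subtopology (Euclidean_space (cdim X e)) (open_disk (cdim X e)))
         (subtopology (cw_space X) e) (\<Phi> e)) \<and>
    (\<forall>e \<in> cells X. \<exists>F. finite F \<and> F \<subseteq> {d \<in> cells X. cdim X d < cdim X e} \<and>
       \<Phi> e ` disk_boundary (cdim X e) \<subseteq> \<Union>F) \<and>
    (\<forall>A. A \<subseteq> topspace (cw_space X) \<longrightarrow>
       (\<forall>e \<in> cells X. closedin (cw_space X) (A \<inter> cw_space X closure_of e)) \<longrightarrow>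
       closedin (cw_space X) A)"

definition regular_cw_complex :: "'a cw \<Rightarrow> bool"
  where "regular_cw_complex X \<longleftrightarrow>
    (\<exists>\<Phi>. cw_complex X \<Phi> \<and>
       (\<forall>e \<in> cells X.
          embedding_map (subtopology (Euclidean_space (cdim X e)) (disk_boundary (cdim X e)))
            (cw_space X) (\<Phi> e)))"

definition cell_le :: "'a cw \<Rightarrow> 'a set \<Rightarrow> 'a set \<Rightarrow> bool"
  where "cell_le X y x \<longleftrightarrow> y \<subseteq> cw_space X closure_of x"

definition cell_less :: "'a cw \<Rightarrow> 'a set \<Rightarrow> 'a set \<Rightarrow> bool"
  where "cell_less X y x \<longleftrightarrow> y \<noteq> x \<and> cell_le X y x"

text \<open>
  The set \<open>P\<close> ordered by \<open>le\<close> is isomorphic to the face poset of some regular CW complex. The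
  points of the complex are taken from the type \<^typ>\<open>'p \<Rightarrow> real\<close> (with an arbitrary topology),
  which is no restriction: a regular CW complex is homeomorphic to the geometric realization of
  the order complex of its face poset, and the points of that realization are functions from
  the poset to the reals.
\<close>

definition is_face_poset :: "'p set \<Rightarrow> ('p \<Rightarrow> 'p \<Rightarrow> bool) \<Rightarrow> bool"
  where "is_face_poset P le \<longleftrightarrow>
    (\<exists>(Y :: ('p \<Rightarrow> real) cw) \<phi>. regular_cw_complex Y \<and> bij_betw \<phi> P (cells Y) \<and>
       (\<forall>a \<in> P. \<forall>b \<in> P. le a b \<longleftrightarrow> cell_le Y (\<phi> a) (\<phi> b)))"

text \<open>
  A (finite, geometric) simplicial complex as a regular CW complex. The library's simplicial
  complexes contain the empty simplex, which is not a cell.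
\<close>

definition simplicial_cw :: "'a::euclidean_space set set \<Rightarrow> 'a cw"
  where "simplicial_cw K =
    \<lparr>cw_space = top_of_set (\<Union>K), cells = rel_interior ` (K - {{}}), cdim = (\<lambda>e. nat (aff_dim e))\<rparr>"

definition discrete_morse :: "'a cw \<Rightarrow> ('a set \<Rightarrow> real) \<Rightarrow> bool"
  where "discrete_morse X f \<longleftrightarrow>
    (\<forall>x \<in> cells X.
       (\<exists>\<^sub>\<le>\<^sub>1 y. y \<in> cells X \<and> cdim X y = cdim X x + 1 \<and> cell_less X x y \<and> f x \<ge> f y) \<and>
       (\<exists>\<^sub>\<le>\<^sub>1 y. y \<in> cells X \<and> cdim X x = cdim X y + 1 \<and> cell_less X y x \<and> f y \<ge> f x))"

definition regular_pair :: "'a cw \<Rightarrow> ('a set \<Rightarrow> real) \<Rightarrow> 'a set \<Rightarrow> 'a set \<Rightarrow> bool"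
  where "regular_pair X f x y \<longleftrightarrow>
    x \<in> cells X \<and> y \<in> cells X \<and> cdim X y = cdim X x + 1 \<and> cell_less X x y \<and> f x \<ge> f y"

definition critical :: "'a cw \<Rightarrow> ('a set \<Rightarrow> real) \<Rightarrow> 'a set \<Rightarrow> bool"
  where "critical X f x \<longleftrightarrow>
    x \<in> cells X \<and> (\<forall>y. \<not> regular_pair X f x y \<and> \<not> regular_pair X f y x)"

text \<open>
  The data of a p-category. \<open>Comp C h g\<close> is \<open>h \<circ> g\<close>, and \<open>Le C g g'\<close> is \<open>g \<Rightarrow> g'\<close>, with \<open>\<Rightarrow>\<close>
  read as \<open>\<le>\<close>; both are only meaningful on composable, respectively parallel, morphisms.
\<close>

record ('o, 'm) pcat =
  Ob :: "'o set"
  Hom :: "'o \<Rightarrow> 'o \<Rightarrow> 'm set"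
  Ident :: "'o \<Rightarrow> 'm"
  Comp :: "'m \<Rightarrow> 'm \<Rightarrow> 'm"
  Le :: "'m \<Rightarrow> 'm \<Rightarrow> bool"

definition full_sub_pcat :: "('o, 'm) pcat \<Rightarrow> 'o set \<Rightarrow> ('o, 'm) pcat"
  where "full_sub_pcat C A =
    C\<lparr>Ob := Ob C \<inter> A, Hom := (\<lambda>w z. if w \<in> A \<and> z \<in> A then Hom C w z else {})\<rparr>"

definition Ent :: "'a cw \<Rightarrow> ('a set, 'a set list) pcat"
  where "Ent X =
    \<lparr>Ob = cells X,
     Hom = (\<lambda>x y. {p. p \<noteq> [] \<and> set p \<subseteq> cells X \<and> hd p = x \<and> last p = y \<and>
                      successively (\<lambda>a b. cell_less X b a) p}),
     Ident = (\<lambda>x. [x]),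
     Comp = (\<lambda>h g. g @ tl h),
     Le = subseq\<rparr>"

definition morse_system :: "'a cw \<Rightarrow> ('a set \<Rightarrow> real) \<Rightarrow> 'a set list set"
  where "morse_system X f = {[y, x] | x y. regular_pair X f x y}"

definition sys_plus :: "('o, 'm) pcat \<Rightarrow> 'm set \<Rightarrow> 'o \<Rightarrow> 'o \<Rightarrow> 'm set"
  where "sys_plus C S x y = {g \<in> Hom C x y. g \<in> S \<or> (x = y \<and> g = Ident C x)}"

text \<open>
  A zigzag \<open>x\<^sub>0 \<rightarrow> y\<^sub>0 \<leftarrow> x\<^sub>1 \<rightarrow> \<dots> \<leftarrow> x\<^sub>k \<rightarrow> y\<^sub>k\<close> consists of the objects \<open>x\<^sub>i\<close> and \<open>y\<^sub>i\<close>, the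
  right-pointing arrows \<open>g\<^sub>i\<close> from \<open>x\<^sub>i\<close> to \<open>y\<^sub>i\<close> and the left-pointing arrows \<open>f\<^sub>i\<close> from
  \<open>x\<^sub>i\<^sub>+\<^sub>1\<close> to \<open>y\<^sub>i\<close>.
\<close>

datatype ('o, 'm) zigzag =
  Zigzag (zx: "'o list") (zy: "'o list") (zg: "'m list") (zf: "'m list")

definition zigzags :: "('o, 'm) pcat \<Rightarrow> 'm set \<Rightarrow> 'o \<Rightarrow> 'o \<Rightarrow> ('o, 'm) zigzag set"
  where "zigzags C S w z =
    {Z. length (zg Z) = Suc (length (zf Z)) \<and>
        length (zx Z) = length (zg Z) \<and> length (zy Z) = length (zg Z) \<and>
        hd (zx Z) = w \<and> last (zy Z) = z \<and>
        (\<forall>i < length (zg Z). zg Z ! i \<in> Hom C (zx Z ! i) (zy Z ! i)) \<and>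
        (\<forall>i < length (zf Z). zf Z ! i \<in> sys_plus C S (zx Z ! Suc i) (zy Z ! i))}"

inductive zz_horizontal ::
  "('o, 'm) pcat \<Rightarrow> ('o, 'm) zigzag \<Rightarrow> ('o, 'm) zigzag \<Rightarrow> bool" for C
  where
    "\<lbrakk>length xs = length gs; length ys = length gs; length fs = length gs\<rbrakk> \<Longrightarrow>
     zz_horizontal C
       (Zigzag (xs @ [x, y] @ xs') (ys @ [y, y'] @ ys') (gs @ [g, g'] @ gs') (fs @ [Ident C y] @ fs'))
       (Zigzag (xs @ [x] @ xs') (ys @ [y'] @ ys') (gs @ [Comp C g' g] @ gs') (fs @ fs'))"

text \<open>
  Families \<open>u\<^sub>i : y\<^sub>i \<rightarrow> y'\<^sub>i\<close> and \<open>v\<^sub>i : x\<^sub>i \<rightarrow> x'\<^sub>i\<close> from the unprimed zigzag \<open>Z\<close> to the primed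
  zigzag \<open>Z'\<close>, with \<open>R (g'\<^sub>i \<circ> v\<^sub>i) (u\<^sub>i \<circ> g\<^sub>i)\<close> and \<open>R (f'\<^sub>i \<circ> v\<^sub>i\<^sub>+\<^sub>1) (u\<^sub>i \<circ> f\<^sub>i)\<close>. Equality as \<open>R\<close>
  gives the vertical relation, and \<open>\<Rightarrow>\<close> as \<open>R\<close> gives the order.
\<close>

definition zz_map :: "('o, 'm) pcat \<Rightarrow> 'm set \<Rightarrow> ('m \<Rightarrow> 'm \<Rightarrow> bool) \<Rightarrow>
    ('o, 'm) zigzag \<Rightarrow> ('o, 'm) zigzag \<Rightarrow> bool"
  where "zz_map C S R Z Z' \<longleftrightarrow>
    length (zf Z) = length (zf Z') \<and>
    (\<exists>u v. (\<forall>i \<le> length (zf Z).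
              u i \<in> sys_plus C S (zy Z ! i) (zy Z' ! i) \<and>
              v i \<in> sys_plus C S (zx Z ! i) (zx Z' ! i) \<and>
              R (Comp C (zg Z' ! i) (v i)) (Comp C (u i) (zg Z ! i))) \<and>
           (\<forall>i < length (zf Z).
              R (Comp C (zf Z' ! i) (v (Suc i))) (Comp C (u i) (zf Z ! i))) \<and>
           v 0 = Ident C (hd (zx Z)) \<and>
           u (length (zf Z)) = Ident C (last (zy Z)))"

definition zz_step ::
    "('o, 'm) pcat \<Rightarrow> 'm set \<Rightarrow> ('o, 'm) zigzag \<Rightarrow> ('o, 'm) zigzag \<Rightarrow> bool"
  where "zz_step C S Z Z' \<longleftrightarrow>
    (\<exists>w z. Z \<in> zigzags C S w z \<and> Z' \<in> zigzags C S w z) \<and>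
    (zz_horizontal C Z Z' \<or> zz_map C S (=) Z Z')"

definition zz_equiv ::
    "('o, 'm) pcat \<Rightarrow> 'm set \<Rightarrow> (('o, 'm) zigzag \<times> ('o, 'm) zigzag) set"
  where "zz_equiv C S = {(Z, Z'). equivclp (zz_step C S) Z Z'}"

fun zz_concat :: "('o, 'm) pcat \<Rightarrow> ('o, 'm) zigzag \<Rightarrow> ('o, 'm) zigzag \<Rightarrow> ('o, 'm) zigzag"
  where "zz_concat C (Zigzag xs ys gs fs) (Zigzag xs' ys' gs' fs') =
    Zigzag (xs @ tl xs') (butlast ys @ ys')
      (butlast gs @ [Comp C (hd gs') (last gs)] @ tl gs') (fs @ fs')"

definition Loc :: "('o, 'm) pcat \<Rightarrow> 'm set \<Rightarrow> ('o, ('o, 'm) zigzag set) pcat"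
  where "Loc C S =
    \<lparr>Ob = Ob C,
     Hom = (\<lambda>w z. zigzags C S w z // zz_equiv C S),
     Ident = (\<lambda>w. zz_equiv C S `` {Zigzag [w] [w] [Ident C w] []}),
     Comp = (\<lambda>B A. \<Union>Z \<in> A. \<Union>Z' \<in> B. zz_equiv C S `` {zz_concat C Z Z'}),
     Le = (\<lambda>A' A. \<exists>Z' \<in> A'. \<exists>Z \<in> A. zz_map C S (Le C) Z Z')\<rparr>"

definition Flo :: "'a cw \<Rightarrow> ('a set \<Rightarrow> real) \<Rightarrow>
    ('a set, ('a set, 'a set list) zigzag set) pcat"
  where "Flo X f = full_sub_pcat (Loc (Ent X) (morse_system X f)) {x. critical X f x}"

end

theory Submission
  imports Defs
begin

text \<open>
  Since $\mathrm{Ent}[X]$ is the free category on the strict face relation, its localization is the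
  free category with the regular pairs inverted: a morphism is a unique reduced word of cells whose
  steps go down to a face or up along a regular pair. Passing to a larger morphism means inserting
  cells into the down steps of the word and reducing. As regular pairs are disjoint, no word has two
  consecutive up steps, so distinct ways of inserting cells give distinct reduced words. The words
  above a fixed word are thus the ways to choose one chain in the open face interval of each of its
  down steps. These intervals are Boolean, so such choices are the cones of a product of braid fans,
  that is, of a complete simplicial fan. It follows that in the order complex of
  $\mathrm{Hom}(w,z)^{\mathrm{op}}$ the points below a given element form a ball whose boundary sphere
  consists of the points strictly below it, so these balls are the closed cells of a regular CW
  complex. There are finitely many words because the pair (dimension, value of $f$) drops
  lexicographically along them.
\<close>

section \<open>Layer decompositions\<close>

text \<open>The order on morphisms only asks for some pair of representing zigzags, so the
  difficulty is to decide it on reduced words. Refinement \<open>ref\<close> is therefore defined on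
  all paths and carried through free reduction in both directions: a refinement of a path induces
  one of its reduction, and a refinement of the reduction lifts back. The geometry uses fans instead
  of joins of spheres or products of balls. The open interval of a down step of codimension n is the
  lattice of subsets of an n-element set without its bounds; its chains span the cones of the braid
  fan in n - 1 dimensions, and several steps merely put their coordinates side by side. A complete
  simplicial fan maps the order complex of its poset of cones to a disk by a formula: the direction
  comes from the rays, the radius from the barycentric coordinate of the zero cone. In the opposite
  order the unrefined word is the greatest element and corresponds to the zero cone, so it is the
  centre of its ball, and the sphere consists of the points that avoid it.\<close>

lemma finite_chain_has_top:
  fixes \<sigma> :: "'k \<Rightarrow> 'd set"
  assumes "finite S" "S \<noteq> {}"
    and "\<And>k k'. k \<in> S \<Longrightarrow> k' \<in> S \<Longrightarrow> \<sigma> k \<subseteq> \<sigma> k' \<or> \<sigma> k' \<subseteq> \<sigma> k"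
  obtains m where "m \<in> S" "\<And>k. k \<in> S \<Longrightarrow> \<sigma> k \<subseteq> \<sigma> m"
proof -
  have "finite (\<sigma> ` S)" "\<sigma> ` S \<noteq> {}"
    using assms(1,2) by simp_all
  from finite_has_maximal[OF this] obtain u
    where u: "u \<in> \<sigma> ` S" "\<And>b. b \<in> \<sigma> ` S \<Longrightarrow> u \<subseteq> b \<Longrightarrow> u = b"
    by metis
  obtain m where m: "m \<in> S" "u = \<sigma> m"
    using u(1) by (rule imageE)
  have "\<sigma> k \<subseteq> \<sigma> m" if "k \<in> S" for k
    using assms(3)[OF that m(1)] u(2)[OF imageI[OF that]] m(2) by metis
  then show ?thesis
    using that m(1) by metis
qed

text \<open>
  A nonnegative function is uniquely a positive combination of indicators of a chain of nonempty
  sets, namely of its superlevel sets.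
\<close>

lemma layer_unique:
  fixes c c' :: "'k \<Rightarrow> real" and \<sigma> :: "'k \<Rightarrow> 'd set"
  assumes "finite N" "inj_on \<sigma> N" "\<And>k. k \<in> N \<Longrightarrow> \<sigma> k \<noteq> {}"
    and "\<And>k. k \<in> N \<Longrightarrow> 0 \<le> c k" "\<And>k. k \<in> N \<Longrightarrow> 0 \<le> c' k"
    and "\<And>k k'. k \<in> N \<Longrightarrow> k' \<in> N \<Longrightarrow> c k \<noteq> 0 \<Longrightarrow> c k' \<noteq> 0 \<Longrightarrow> \<sigma> k \<subseteq> \<sigma> k' \<or> \<sigma> k' \<subseteq> \<sigma> k"
    and "\<And>k k'. k \<in> N \<Longrightarrow> k' \<in> N \<Longrightarrow> c' k \<noteq> 0 \<Longrightarrow> c' k' \<noteq> 0 \<Longrightarrow> \<sigma> k \<subseteq> \<sigma> k' \<or> \<sigma> k' \<subseteq> \<sigma> k"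
    and "\<And>v. sum c {k \<in> N. v \<in> \<sigma> k} = sum c' {k \<in> N. v \<in> \<sigma> k}"
    and "k \<in> N"
  shows "c k = c' k"
  using assms(4-9)
proof (induction "card {k \<in> N. c k \<noteq> 0} + card {k \<in> N. c' k \<noteq> 0}" arbitrary: c c' k
    rule: less_induct)
  case less
  define S where "S c = {k \<in> N. c k \<noteq> 0}" for c :: "'k \<Rightarrow> real"
  have finS: "finite (S c)" for c
    using assms(1) by (simp add: S_def)
  have pos: "sum b {k \<in> N. v \<in> \<sigma> k} > 0 \<longleftrightarrow> (\<exists>k\<in>S b. v \<in> \<sigma> k)"
    if "\<And>k. k \<in> N \<Longrightarrow> 0 \<le> b k" for b v
  proof -
    have "sum b {k \<in> N. v \<in> \<sigma> k} \<ge> 0"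
      using that by (auto intro: sum_nonneg)
    moreover have "sum b {k \<in> N. v \<in> \<sigma> k} = 0 \<longleftrightarrow> (\<forall>k\<in>{k \<in> N. v \<in> \<sigma> k}. b k = 0)"
      using that assms(1) by (intro sum_nonneg_eq_0_iff) auto
    ultimately have "sum b {k \<in> N. v \<in> \<sigma> k} > 0 \<longleftrightarrow> \<not> (\<forall>k\<in>{k \<in> N. v \<in> \<sigma> k}. b k = 0)"
      by linarith
    then show ?thesis
      by (simp add: S_def) metis
  qed
  have posc: "(\<exists>k\<in>S c. v \<in> \<sigma> k) \<longleftrightarrow> (\<exists>k\<in>S c'. v \<in> \<sigma> k)" for v
    using pos[of c v] pos[of c' v] less.prems(1,2,5) by simp
  have SN: "k \<in> S b \<Longrightarrow> k \<in> N" for k b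
    by (simp add: S_def)
  have ne: "S b = {} \<longleftrightarrow> (\<forall>v. \<not> (\<exists>k\<in>S b. v \<in> \<sigma> k))" for b
    using assms(3)[OF SN, of _ b] by blast
  show ?case
  proof (cases "S c = {}")
    case True
    then have "S c' = {}"
      using posc ne[of c] ne[of c'] by simp
    then show ?thesis
      using True less.prems(6) by (auto simp: S_def)
  next
    case False
    then have "S c' \<noteq> {}"
      using posc ne[of c] ne[of c'] by simp
    obtain m where m: "m \<in> S c" "\<And>k. k \<in> S c \<Longrightarrow> \<sigma> k \<subseteq> \<sigma> m"
      using finite_chain_has_top[OF finS False, of \<sigma>] less.prems(3) unfolding S_def by blast
    obtain m' where m': "m' \<in> S c'" "\<And>k. k \<in> S c' \<Longrightarrow> \<sigma> k \<subseteq> \<sigma> m'"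
      using finite_chain_has_top[OF finS \<open>S c' \<noteq> {}\<close>, of \<sigma>] less.prems(4) unfolding S_def by blast
    \<comment> \<open>The largest set of either chain is the positivity set of the common sum, so
      the two chains have the same top.\<close>
    have "\<sigma> m = \<sigma> m'"
      using m m' posc by blast
    then have mm: "m' = m"
      using m(1) m'(1) assms(2) by (auto simp: S_def dest: inj_onD)
    \<comment> \<open>Subtracting the smaller coefficient of the common top keeps both combinations
      nonnegative and removes the top from at least one of them, so the total support
      shrinks.\<close>
    define s where "s = min (c m) (c' m)"
    define b where "b = (\<lambda>k. if k = m then c k - s else c k)"
    define b' where "b' = (\<lambda>k. if k = m then c' k - s else c' k)"
    have mN: "m \<in> N" and cm: "c m \<noteq> 0" "c' m \<noteq> 0"
      using m(1) m'(1) mm by (auto simp: S_def)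
    have s0: "s > 0"
      using cm less.prems(1,2)[OF mN] by (auto simp: s_def)
    have sub: "S b \<subseteq> S c" "S b' \<subseteq> S c'"
      using cm by (auto simp: S_def b_def b'_def split: if_splits)
    have "b m = 0 \<or> b' m = 0"
      by (auto simp: b_def b'_def s_def)
    then have "S b \<subset> S c \<or> S b' \<subset> S c'"
      using sub m(1) m'(1) mm by (auto simp: S_def)
    then have card: "card (S b) + card (S b') < card (S c) + card (S c')"
      using sub finS by (meson add_le_less_mono add_less_le_mono card_mono psubset_card_mono)
    have sm: "sum (\<lambda>k. if k = m then h k - s else h k) {k \<in> N. v \<in> \<sigma> k}
        = sum h {k \<in> N. v \<in> \<sigma> k} - (if v \<in> \<sigma> m then s else 0)" for v and h :: "'k \<Rightarrow> real"
    proof -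
      have "sum (\<lambda>k. if k = m then h k - s else h k) {k \<in> N. v \<in> \<sigma> k}
          = sum (\<lambda>k. h k - (if m = k then s else 0)) {k \<in> N. v \<in> \<sigma> k}"
        by (rule sum.cong) auto
      then show ?thesis
        using assms(1) mN by (simp add: sum_subtractf sum.delta')
    qed
    have "b k = b' k"
    proof (rule less.hyps)
      show "card {k \<in> N. b k \<noteq> 0} + card {k \<in> N. b' k \<noteq> 0}
        < card {k \<in> N. c k \<noteq> 0} + card {k \<in> N. c' k \<noteq> 0}"
        using card by (simp add: S_def)
      show "0 \<le> b k" if "k \<in> N" for k
        using less.prems(1) that by (auto simp: b_def s_def)
      show "0 \<le> b' k" if "k \<in> N" for k
        using less.prems(2) that by (auto simp: b'_def s_def)
      show "\<sigma> k \<subseteq> \<sigma> k' \<or> \<sigma> k' \<subseteq> \<sigma> k"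
        if "k \<in> N" "k' \<in> N" "b k \<noteq> 0" "b k' \<noteq> 0" for k k'
        using less.prems(3)[OF that(1,2)] sub(1) that by (auto simp: S_def)
      show "\<sigma> k \<subseteq> \<sigma> k' \<or> \<sigma> k' \<subseteq> \<sigma> k"
        if "k \<in> N" "k' \<in> N" "b' k \<noteq> 0" "b' k' \<noteq> 0" for k k'
        using less.prems(4)[OF that(1,2)] sub(2) that by (auto simp: S_def)
      show "sum b {k \<in> N. v \<in> \<sigma> k} = sum b' {k \<in> N. v \<in> \<sigma> k}" for v
        unfolding b_def b'_def sm using less.prems(5) by simp
    qed (use less.prems in auto)
    then show ?thesis
      by (auto simp: b_def b'_def split: if_splits)
  qed
qed

text \<open>Peels off the lowest level: the minimal positive value times the indicator of the whole
  support is removed, and what remains has smaller support. The last assumption provides an index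
  for every set that can occur as a layer.\<close>

lemma layer_exists:
  fixes a :: "'d \<Rightarrow> real" and \<sigma> :: "'k \<Rightarrow> 'd set"
  assumes "finite N" "finite {v. a v \<noteq> 0}" "\<And>v. 0 \<le> a v"
    and "\<And>T. T \<subseteq> {v. a v \<noteq> 0} \<Longrightarrow> T \<noteq> {} \<Longrightarrow> T \<in> \<sigma> ` N"
  obtains c where "\<And>k. 0 \<le> c k" "\<And>k. k \<notin> N \<Longrightarrow> c k = 0"
    "\<And>k. c k \<noteq> 0 \<Longrightarrow> \<sigma> k \<subseteq> {v. a v \<noteq> 0}"
    "\<And>k k'. c k \<noteq> 0 \<Longrightarrow> c k' \<noteq> 0 \<Longrightarrow> \<sigma> k \<subseteq> \<sigma> k' \<or> \<sigma> k' \<subseteq> \<sigma> k"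
    "\<And>v. a v = sum c {k \<in> N. v \<in> \<sigma> k}"
proof -
  let ?Q = "\<lambda>a c. (\<forall>k. 0 \<le> c k) \<and> (\<forall>k. k \<notin> N \<longrightarrow> c k = 0) \<and>
      (\<forall>k. c k \<noteq> 0 \<longrightarrow> \<sigma> k \<subseteq> {v. a v \<noteq> 0}) \<and>
      (\<forall>k k'. c k \<noteq> 0 \<longrightarrow> c k' \<noteq> 0 \<longrightarrow> \<sigma> k \<subseteq> \<sigma> k' \<or> \<sigma> k' \<subseteq> \<sigma> k) \<and>
      (\<forall>v. a v = sum c {k \<in> N. v \<in> \<sigma> k})"
  have "\<exists>c. ?Q a c"
    using assms(2-4)
  proof (induction "card {v. a v \<noteq> 0}" arbitrary: a rule: less_induct)
    case less
    let ?S = "{v. a v \<noteq> 0}"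
    show ?case
    proof (cases "?S = {}")
      case True
      then show ?thesis
        by (intro exI[of _ "\<lambda>_. 0"]) auto
    next
      case False
      define s where "s = Min (a ` ?S)"
      have sle: "s \<le> a v" if "v \<in> ?S" for v
        using that less.prems(1) by (auto simp: s_def)
      have "s \<in> a ` ?S"
        unfolding s_def using False less.prems(1) by (intro Min_in) auto
      then obtain u where u: "u \<in> ?S" "a u = s" by auto
      then have s0: "s > 0" using less.prems(2)[of u] by auto
      define b where "b = (\<lambda>v. if a v \<noteq> 0 then a v - s else 0)"
      have "{v. b v \<noteq> 0} \<subseteq> ?S" "u \<in> ?S" "u \<notin> {v. b v \<noteq> 0}"
        using u by (simp_all add: b_def Collect_mono_iff)
      then have bS: "{v. b v \<noteq> 0} \<subset> ?S"
        by (metis psubsetI)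
      have sub0: "T \<in> \<sigma> ` N" if "T \<subseteq> {v. b v \<noteq> 0}" "T \<noteq> {}" for T
        using less.prems(3)[of T] that bS by (metis order.trans psubset_imp_subset)
      have b0: "0 \<le> b v" for v
        using sle by (auto simp: b_def)
      have "\<exists>c. ?Q b c"
        using psubset_card_mono[OF less.prems(1) bS]
          finite_subset[OF psubset_imp_subset[OF bS] less.prems(1)] b0 sub0
        by (rule less.hyps)
      then obtain c where c: "\<forall>k. 0 \<le> c k" "\<forall>k. k \<notin> N \<longrightarrow> c k = 0"
        "\<forall>k. c k \<noteq> 0 \<longrightarrow> \<sigma> k \<subseteq> {v. b v \<noteq> 0}"
        "\<forall>k k'. c k \<noteq> 0 \<longrightarrow> c k' \<noteq> 0 \<longrightarrow> \<sigma> k \<subseteq> \<sigma> k' \<or> \<sigma> k' \<subseteq> \<sigma> k"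
        "\<forall>v. b v = sum c {k \<in> N. v \<in> \<sigma> k}"
        by (elim exE conjE)
      obtain m where m: "m \<in> N" "\<sigma> m = ?S"
        using less.prems(3)[of ?S] False by auto
      have cm: "c m = 0"
        using c(3) m(2) bS by auto
      have sub: "\<sigma> k \<subseteq> ?S" if "c k \<noteq> 0" for k
        using that c(3) bS by blast
      \<comment> \<open>The index \<open>m\<close> of the full support was free so far, because all
        layers of \<open>b\<close> lie in a strictly smaller set.\<close>
      define c' where "c' = (\<lambda>k. c k + (if m = k then s else 0))"
      have "a v = sum c' {k \<in> N. v \<in> \<sigma> k}" for v
      proof -
        have "sum c' {k \<in> N. v \<in> \<sigma> k} = b v + (if v \<in> \<sigma> m then s else 0)"
          unfolding c'_def using assms(1) m(1) c(5) by (simp add: sum.distrib sum.delta')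
        then show ?thesis
          unfolding m(2) b_def by simp
      qed
      moreover have "\<sigma> k \<subseteq> \<sigma> k' \<or> \<sigma> k' \<subseteq> \<sigma> k" if "c' k \<noteq> 0" "c' k' \<noteq> 0" for k k'
        using that c(4) sub m(2) by (auto simp: c'_def split: if_splits)
      ultimately show ?thesis
        using c(1,2) s0 m sub by (intro exI[of _ c']) (auto simp: c'_def)
    qed
  qed
  then show ?thesis
    using that by blast
qed

section \<open>Order complexes of posets with fan-like lower sets\<close>

text \<open>
  The rays \<open>r v\<close> for \<open>v \<in> D\<close> and the cones spanned by the members of \<open>J\<close> form a complete
  simplicial fan in the space of functions \<open>E \<rightarrow> \<real>\<close>.
\<close>

definition complete_fan :: "'d set \<Rightarrow> 'd set set \<Rightarrow> 'e set \<Rightarrow> ('d \<Rightarrow> 'e \<Rightarrow> real) \<Rightarrow> bool"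
  where "complete_fan D J E r \<longleftrightarrow>
    finite D \<and> finite E \<and> J \<subseteq> Pow D \<and> {} \<in> J \<and> (\<forall>S\<in>J. \<forall>T. T \<subseteq> S \<longrightarrow> T \<in> J) \<and>
    (\<forall>x. \<exists>a. (\<forall>v. 0 \<le> a v) \<and> {v. a v \<noteq> 0} \<in> J \<and> (\<forall>e\<in>E. x e = (\<Sum>v\<in>D. a v * r v e))) \<and>
    (\<forall>a a'. (\<forall>v. 0 \<le> a v) \<longrightarrow> (\<forall>v. 0 \<le> a' v) \<longrightarrow> {v. a v \<noteq> 0} \<in> J \<longrightarrow> {v. a' v \<noteq> 0} \<in> J \<longrightarrow>
       (\<forall>e\<in>E. (\<Sum>v\<in>D. a v * r v e) = (\<Sum>v\<in>D. a' v * r v e)) \<longrightarrow> a = a')"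

text \<open>Geometric realization of the order complex in barycentric coordinates: the last clause
  says that the support of \<open>t\<close> is a chain.\<close>

definition order_realization :: "'p set \<Rightarrow> ('p \<Rightarrow> 'p \<Rightarrow> bool) \<Rightarrow> ('p \<Rightarrow> real) set"
  where "order_realization P le =
    {t. (\<forall>A. 0 \<le> t A) \<and> (\<forall>A. A \<notin> P \<longrightarrow> t A = 0) \<and> sum t P = 1 \<and>
        (\<forall>A\<in>P. \<forall>A'\<in>P. le A A' \<or> le A' A \<or> t A = 0 \<or> t A' = 0)}"

text \<open>All conditions are closed and the coordinates lie in [0, 1], so this is a closed subset
  of a Tychonoff cube. Compactness later turns a continuous bijection onto a Hausdorff space into a
  homeomorphism.\<close>

lemma compact_order_realization:
  assumes "finite P"
  shows "compact (order_realization P le)"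
proof -
  let ?I = "\<Pi>\<^sub>E A\<in>UNIV. {0..1::real}"
  have "compactin (product_topology (\<lambda>_. euclidean) UNIV) ?I"
    by (subst compactin_PiE) (auto simp: compact_space_def)
  then have cI: "compact ?I"
    by (simp add: euclidean_product_topology)
  have c1: "closed {t :: 'a \<Rightarrow> real. 0 \<le> t A}" for A
    by (intro closed_Collect_le continuous_on_const continuous_on_product_coordinates)
  have c2: "closed {t :: 'a \<Rightarrow> real. t A = 0}" for A
    by (intro closed_Collect_eq continuous_on_const continuous_on_product_coordinates)
  have c3: "closed {t :: 'a \<Rightarrow> real. sum t P = 1}"
    by (intro closed_Collect_eq continuous_on_const continuous_on_sum
        continuous_on_product_coordinates)
  have "order_realization P le =
      (\<Inter>A. {t. 0 \<le> t A}) \<inter> (\<Inter>A\<in>-P. {t. t A = 0}) \<inter> {t. sum t P = 1} \<inter>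
      (\<Inter>A\<in>P. \<Inter>A'\<in>P. if le A A' \<or> le A' A then UNIV else {t. t A = 0} \<union> {t. t A' = 0})"
    by (auto simp: order_realization_def split: if_splits)
  also have "closed \<dots>"
    using c1 c2 c3 by (intro closed_Int closed_INT) (auto intro!: closed_Un)
  finally have "closed (order_realization P le)" .
  moreover have "order_realization P le \<subseteq> ?I"
  proof
    fix t assume t: "t \<in> order_realization P le"
    have "t A \<le> 1" for A
    proof (cases "A \<in> P")
      case True
      then have "t A \<le> sum t P"
        using t assms by (intro member_le_sum) (auto simp: order_realization_def)
      then show ?thesis
        using t by (simp add: order_realization_def)
    qed (use t in \<open>auto simp: order_realization_def\<close>)
    then show "t \<in> ?I"
      using t by (auto simp: order_realization_def)
  qed
  ultimately show ?thesis
    using compact_Int_closed[OF cI] by (metis inf.absorb_iff2)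
qed

lemma Euclidean_space_eq_top_of_set: "Euclidean_space n = top_of_set {x. \<forall>i\<ge>n. x i = 0}"
  by (simp add: Euclidean_space_def euclidean_product_topology)

lemma Hausdorff_space_top_of_set_fun:
  "Hausdorff_space (top_of_set (S :: ('a \<Rightarrow> real) set))"
  by (metis Hausdorff_space_euclidean Hausdorff_space_product_topology Hausdorff_space_subtopology
      euclidean_product_topology)

text \<open>The intended \<open>L\<close> is a principal lower set. \<open>\<sigma>\<close> matches
  it with the cones of the fan with inclusion reversed, so \<open>top\<close> is the zero cone, and
  a point of the realization is a flag of cones with barycentric coordinates.\<close>

locale fan_poset =
  fixes L :: "'p set" and le :: "'p \<Rightarrow> 'p \<Rightarrow> bool" and top :: 'p
    and D :: "'d set" and J :: "'d set set" and E :: "'e set" and r :: "'d \<Rightarrow> 'e \<Rightarrow> real"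
    and \<sigma> :: "'p \<Rightarrow> 'd set"
  assumes fan: "complete_fan D J E r"
    and finite_L: "finite L"
    and \<sigma>: "bij_betw \<sigma> L J"
    and le_iff: "\<And>A A'. A \<in> L \<Longrightarrow> A' \<in> L \<Longrightarrow> le A A' \<longleftrightarrow> \<sigma> A' \<subseteq> \<sigma> A"
    and top: "top \<in> L" "\<And>A. A \<in> L \<Longrightarrow> le A top"
begin

lemma finite_D: "finite D" and finite_E: "finite E" and J_sub: "S \<in> J \<Longrightarrow> S \<subseteq> D"
  and empty_J: "{} \<in> J" and J_down: "S \<in> J \<Longrightarrow> T \<subseteq> S \<Longrightarrow> T \<in> J"
  using fan by (auto simp: complete_fan_def)

lemma fan_ex:
  obtains a where "\<And>v. 0 \<le> a v" "{v. a v \<noteq> 0} \<in> J" "\<And>e. e \<in> E \<Longrightarrow> x e = (\<Sum>v\<in>D. a v * r v e)"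
  using fan unfolding complete_fan_def by meson

lemma fan_unique:
  assumes "\<And>v. 0 \<le> a v" "\<And>v. 0 \<le> a' v" "{v. a v \<noteq> 0} \<in> J" "{v. a' v \<noteq> 0} \<in> J"
    "\<And>e. e \<in> E \<Longrightarrow> (\<Sum>v\<in>D. a v * r v e) = (\<Sum>v\<in>D. a' v * r v e)"
  shows "a = a'"
  using fan assms unfolding complete_fan_def by meson

lemma \<sigma>_top: "\<sigma> top = {}"
proof -
  obtain A where "A \<in> L" "\<sigma> A = {}"
    using \<sigma> empty_J by (metis bij_betw_iff_bijections)
  then show ?thesis
    using le_iff[of A top] top by simp
qed

lemma \<sigma>_empty_iff: "A \<in> L \<Longrightarrow> \<sigma> A = {} \<longleftrightarrow> A = top"
  using \<sigma> \<sigma>_top top by (metis bij_betw_iff_bijections)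

definition K where "K = order_realization L le"

text \<open>Sending a cone to the sum of its rays, a barycentre up to scale, and extending linearly
  over flags gives \<open>vec\<close>; this is the coefficient of the ray \<open>v\<close> in the
  image.\<close>

definition weight :: "('p \<Rightarrow> real) \<Rightarrow> 'd \<Rightarrow> real"
  where "weight t v = sum t {A \<in> L - {top}. v \<in> \<sigma> A}"

lemma KD:
  assumes "t \<in> K"
  shows "0 \<le> t A" "A \<notin> L \<Longrightarrow> t A = 0" "sum t L = 1"
    "A \<in> L \<Longrightarrow> A' \<in> L \<Longrightarrow> t A \<noteq> 0 \<Longrightarrow> t A' \<noteq> 0 \<Longrightarrow> \<sigma> A \<subseteq> \<sigma> A' \<or> \<sigma> A' \<subseteq> \<sigma> A"
  using assms le_iff unfolding K_def order_realization_def by blast+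

lemma sum_nontop: "t \<in> K \<Longrightarrow> sum t (L - {top}) = 1 - t top"
  using KD(3)[of t] finite_L top(1) by (simp add: sum_diff1)

lemma weight_nonneg: "t \<in> K \<Longrightarrow> 0 \<le> weight t v"
  unfolding weight_def by (intro sum_nonneg) (simp add: KD)

text \<open>The cones that contribute form a chain, so their rays all lie in its largest member.
  Uniqueness in the fan speaks about such combinations only.\<close>

lemma weight_supp:
  assumes "t \<in> K"
  shows "{v. weight t v \<noteq> 0} \<in> J"
proof -
  let ?S = "{A \<in> L. t A \<noteq> 0}"
  have "?S \<noteq> {}"
    using KD(3)[OF assms] by force
  moreover have "finite ?S"
    using finite_L by simp
  ultimately obtain m where m: "m \<in> ?S" "\<And>A. A \<in> ?S \<Longrightarrow> \<sigma> A \<subseteq> \<sigma> m"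
    using finite_chain_has_top[of ?S \<sigma>] KD(4)[OF assms] by blast
  have "v \<in> \<sigma> m" if wv: "weight t v \<noteq> 0" for v
  proof -
    obtain A where "A \<in> L" "v \<in> \<sigma> A" "t A \<noteq> 0"
      by (rule sum.not_neutral_contains_not_neutral[OF wv[unfolded weight_def]]) auto
    then show ?thesis
      using m(2)[of A] by auto
  qed
  then have "{v. weight t v \<noteq> 0} \<subseteq> \<sigma> m"
    by auto
  moreover have "\<sigma> m \<in> J"
    using m(1) \<sigma> by (auto simp: bij_betw_def)
  ultimately show ?thesis
    using J_down by blast
qed

text \<open>The weights are a layer decomposition whose layers are the sets
  \<open>\<sigma> A\<close>, so they determine the barycentric coordinates: a cone is subdivided by
  its flags of faces. The factor \<open>l\<close> serves to compare points on the same ray.\<close>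

lemma weight_unique:
  assumes t: "t \<in> K" "t' \<in> K" and l: "0 \<le> l" and eq: "\<And>v. weight t v = l * weight t' v"
    and A: "A \<in> L" "A \<noteq> top"
  shows "t A = l * t' A"
proof (rule layer_unique[of "L - {top}" \<sigma>])
  show "inj_on \<sigma> (L - {top})"
    using \<sigma> by (auto simp: bij_betw_def intro: inj_on_subset)
  show "sum t {k \<in> L - {top}. v \<in> \<sigma> k} = (\<Sum>k | k \<in> L - {top} \<and> v \<in> \<sigma> k. l * t' k)" for v
    using eq[of v] by (simp add: weight_def sum_distrib_left)
qed (use finite_L l KD[OF t(1)] KD[OF t(2)] A \<sigma>_empty_iff in auto)

text \<open>Disks consist of functions on the natural numbers, so the coordinates in
  \<open>E\<close> have to be numbered.\<close>

definition \<beta> :: "nat \<Rightarrow> 'e" where "\<beta> = (SOME b. bij_betw b {..<card E} E)"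

lemma \<beta>: "bij_betw \<beta> {..<card E} E"
  unfolding \<beta>_def using ex_bij_betw_nat_finite[OF finite_E]
  by (metis atLeast0LessThan someI_ex)

definition vec :: "('p \<Rightarrow> real) \<Rightarrow> nat \<Rightarrow> real"
  where "vec t i = (if i < card E
    then \<Sum>A\<in>L - {top}. t A * (\<Sum>v\<in>\<sigma> A. r v (\<beta> i)) else 0)"

lemma vec_weight:
  assumes "i < card E"
  shows "vec t i = (\<Sum>v\<in>D. weight t v * r v (\<beta> i))"
proof -
  have "(\<Sum>v\<in>D. weight t v * r v (\<beta> i))
      = (\<Sum>v\<in>D. \<Sum>A\<in>L - {top}. if v \<in> \<sigma> A then t A * r v (\<beta> i) else 0)"
  proof (intro sum.cong refl)
    fix v
    have "weight t v * r v (\<beta> i) = (\<Sum>A\<in>L - {top}. (if v \<in> \<sigma> A then t A else 0) * r v (\<beta> i))"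
      using finite_L by (simp only: weight_def sum.inter_filter finite_Diff sum_distrib_right)
    also have "\<dots> = (\<Sum>A\<in>L - {top}. if v \<in> \<sigma> A then t A * r v (\<beta> i) else 0)"
      by (intro sum.cong) auto
    finally show "weight t v * r v (\<beta> i)
      = (\<Sum>A\<in>L - {top}. if v \<in> \<sigma> A then t A * r v (\<beta> i) else 0)" .
  qed
  also have "\<dots> = (\<Sum>A\<in>L - {top}. \<Sum>v\<in>D. if v \<in> \<sigma> A then t A * r v (\<beta> i) else 0)"
    by (rule sum.swap)
  also have "\<dots> = (\<Sum>A\<in>L - {top}. t A * (\<Sum>v\<in>\<sigma> A. r v (\<beta> i)))"
  proof (intro sum.cong refl)
    fix A assume "A \<in> L - {top}"
    then have "\<sigma> A \<subseteq> D"
      using \<sigma> J_sub by (auto simp: bij_betw_def)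
    then have "{v \<in> D. v \<in> \<sigma> A} = \<sigma> A" by auto
    then show "(\<Sum>v\<in>D. if v \<in> \<sigma> A then t A * r v (\<beta> i) else 0) = t A * (\<Sum>v\<in>\<sigma> A. r v (\<beta> i))"
      using finite_D by (simp add: sum_distrib_left flip: sum.inter_filter)
  qed
  finally show ?thesis
    using assms by (simp add: vec_def)
qed

lemma vec_eq_imp_weight:
  assumes "t \<in> K" "t' \<in> K" "0 \<le> l" "\<And>i. i < card E \<Longrightarrow> vec t i = l * vec t' i"
  shows "weight t v = l * weight t' v"
proof -
  have "weight t = (\<lambda>v. l * weight t' v)"
  proof (rule fan_unique)
    show "{v. l * weight t' v \<noteq> 0} \<in> J"
      by (rule J_down[OF weight_supp[OF assms(2)]]) auto
    fix e assume "e \<in> E"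
    then obtain i where i: "i < card E" "e = \<beta> i"
      using \<beta> by (auto simp: bij_betw_def)
    then show "(\<Sum>v\<in>D. weight t v * r v e) = (\<Sum>v\<in>D. l * weight t' v * r v e)"
      using assms(4)[OF i(1)] by (simp add: vec_weight sum_distrib_left mult.assoc)
  qed (use assms weight_supp weight_nonneg in auto)
  then show ?thesis by simp
qed

definition vnorm :: "(nat \<Rightarrow> real) \<Rightarrow> real"
  where "vnorm x = sqrt (\<Sum>i<card E. (x i)\<^sup>2)"

lemma vnorm_eq_0: "vnorm x = 0 \<longleftrightarrow> (\<forall>i<card E. x i = 0)"
  by (auto simp: vnorm_def sum_nonneg_eq_0_iff)

lemma vnorm_nonneg: "0 \<le> vnorm x"
  by (simp add: vnorm_def sum_nonneg)

lemma abs_le_vnorm: "i < card E \<Longrightarrow> \<bar>x i\<bar> \<le> vnorm x"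
  unfolding vnorm_def real_sqrt_abs[symmetric]
  by (rule real_sqrt_le_mono, rule member_le_sum) auto

lemma vnorm_scale: "vnorm (\<lambda>i. l * x i) = \<bar>l\<bar> * vnorm x"
  by (simp add: vnorm_def power_mult_distrib real_sqrt_mult flip: sum_distrib_left)

lemma point_top: "(\<lambda>A. if A = top then 1 else 0) \<in> K"
  using finite_L top(1) top(2)[OF top(1)] by (auto simp: K_def order_realization_def)

lemma vec_eq_0:
  assumes "t \<in> K" "\<And>i. i < card E \<Longrightarrow> vec t i = 0"
  shows "t top = 1"
proof -
  have "weight t v = 0 * weight t v" for v
    by (rule vec_eq_imp_weight) (use assms in auto)
  then have "t A = 0 * t A" if "A \<in> L" "A \<noteq> top" for A
    using weight_unique[of t t 0 A] assms(1) that by auto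
  then have "sum t (L - {top}) = 0"
    by (intro sum.neutral) auto
  then show ?thesis
    using sum_nontop[OF assms(1)] by simp
qed

text \<open>
  The direction of \<open>vec t\<close> determines the weights of \<open>t\<close> up to scale, and the radius \<open>1 - t top\<close>
  their total. At the cone point \<open>t top = 1\<close> the quotient is \<open>0 / 0 = 0\<close>.
\<close>

definition to_disk :: "('p \<Rightarrow> real) \<Rightarrow> nat \<Rightarrow> real"
  where "to_disk t i = (1 - t top) * (vec t i / vnorm (vec t))"

lemma vnorm_vec_pos: "t \<in> K \<Longrightarrow> t top \<noteq> 1 \<Longrightarrow> vnorm (vec t) > 0"
  using vec_eq_0[of t] vnorm_eq_0[of "vec t"] vnorm_nonneg[of "vec t"] by fastforce

lemma top_le_1: "t \<in> K \<Longrightarrow> t top \<le> 1"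
  using sum_nontop[of t] KD(1) by (smt (verit) sum_nonneg)

lemma vnorm_to_disk:
  assumes "t \<in> K"
  shows "vnorm (to_disk t) = 1 - t top"
proof (cases "t top = 1")
  case True
  then show ?thesis
    by (simp add: to_disk_def vnorm_def)
next
  case False
  have "to_disk t = (\<lambda>i. ((1 - t top) / vnorm (vec t)) * vec t i)"
    by (auto simp: to_disk_def)
  then have "vnorm (to_disk t) = \<bar>(1 - t top) / vnorm (vec t)\<bar> * vnorm (vec t)"
    by (simp only: vnorm_scale)
  then show ?thesis
    using vnorm_vec_pos[OF assms False] top_le_1[OF assms] by simp
qed

lemma sum_to_disk: "t \<in> K \<Longrightarrow> (\<Sum>i<card E. (to_disk t i)\<^sup>2) = (1 - t top)\<^sup>2"
  using vnorm_to_disk[of t] by (metis real_sqrt_pow2 sum_nonneg vnorm_def zero_le_power2)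

lemma continuous_vec: "continuous_on S (\<lambda>t. vec t i)"
proof -
  have "continuous_on S (\<lambda>t :: 'p \<Rightarrow> real. t A)" for A
    by (rule continuous_on_subset[OF continuous_on_product_coordinates subset_UNIV])
  then show ?thesis
    by (cases "i < card E") (auto simp: vec_def intro!: continuous_intros)
qed

text \<open>Away from the cone point the formula is a quotient with nonzero denominator. At the cone
  point it is singular, but every coordinate is bounded by the radius \<open>1 - t top\<close>,
  which tends to 0.\<close>

lemma continuous_to_disk: "continuous_on K to_disk"
proof (rule continuous_on_coordinatewise_then_product)
  fix i
  have ct: "continuous_on K (\<lambda>t :: 'p \<Rightarrow> real. t A)" for A
    by (rule continuous_on_subset[OF continuous_on_product_coordinates subset_UNIV])
  have cn: "continuous_on K (\<lambda>t. vnorm (vec t))"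
    unfolding vnorm_def by (intro continuous_intros continuous_vec)
  show "continuous_on K (\<lambda>t. to_disk t i)"
    unfolding continuous_on_def
  proof
    fix t assume t: "t \<in> K"
    show "((\<lambda>t. to_disk t i) \<longlongrightarrow> to_disk t i) (at t within K)"
    proof (cases "t top = 1")
      case False
      have "((\<lambda>t. t top) \<longlongrightarrow> t top) (at t within K)"
        "((\<lambda>t. vnorm (vec t)) \<longlongrightarrow> vnorm (vec t)) (at t within K)"
        "((\<lambda>t. vec t i) \<longlongrightarrow> vec t i) (at t within K)"
        using ct cn continuous_vec[of K] t by (auto simp: continuous_on_def)
      then show ?thesis
        unfolding to_disk_def using vnorm_vec_pos[OF t False]
        by (intro tendsto_intros) auto
    next
      case True
      have "((\<lambda>s. 1 - s top) \<longlongrightarrow> 1 - t top) (at t within K)"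
        using ct t by (intro tendsto_intros) (auto simp: continuous_on_def)
      then have lim: "((\<lambda>s. 1 - s top) \<longlongrightarrow> 0) (at t within K)"
        using True by simp
      have "\<forall>\<^sub>F s in at t within K. norm (to_disk s i) \<le> 1 - s top"
        unfolding eventually_at_filter
      proof (intro always_eventually allI impI)
        fix s assume s: "s \<in> K"
        show "norm (to_disk s i) \<le> 1 - s top"
        proof (cases "i < card E")
          case True
          then show ?thesis
            using abs_le_vnorm[of i "to_disk s"] vnorm_to_disk[OF s] by simp
        next
          case False
          then show ?thesis
            using top_le_1[OF s] by (simp add: to_disk_def vec_def)
        qed
      qed
      then have "((\<lambda>s. to_disk s i) \<longlongrightarrow> 0) (at t within K)"
        using lim by (rule Lim_null_comparison)
      then show ?thesis
        using True by (simp add: to_disk_def)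
    qed
  qed
qed

lemma inj_to_disk: "inj_on to_disk K"
proof (rule inj_onI)
  fix t t' assume t: "t \<in> K" "t' \<in> K" and eq: "to_disk t = to_disk t'"
  have top_eq: "t top = t' top"
    using vnorm_to_disk[OF t(1)] vnorm_to_disk[OF t(2)] eq by simp
  have nontop: "t A = t' A" if "A \<in> L" "A \<noteq> top" for A
  proof (cases "t top = 1")
    case True
    have "t A = 0" if "t \<in> K" "t top = 1" for t
    proof -
      have "\<forall>A\<in>L - {top}. t A = 0"
        using sum_nontop[OF that(1)] that finite_L KD(1)[OF that(1)]
        by (subst sum_nonneg_eq_0_iff[symmetric]) auto
      then show ?thesis
        using \<open>A \<in> L\<close> \<open>A \<noteq> top\<close> by simp
    qed
    then show ?thesis
      using t True top_eq by metis
  next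
    case False
    \<comment> \<open>Equal directions make the coordinates other than \<open>top\<close>
      proportional with factor \<open>l\<close>; equal radii give them the same positive total, so
      \<open>l\<close> is 1.\<close>
    define l where "l = vnorm (vec t) / vnorm (vec t')"
    have p: "vnorm (vec t) > 0" "vnorm (vec t') > 0"
      using vnorm_vec_pos t False top_eq by auto
    then have l0: "l > 0" by (simp add: l_def)
    have "vec t i = l * vec t' i" for i
    proof -
      have "(1 - t top) * (vec t i / vnorm (vec t)) = (1 - t top) * (vec t' i / vnorm (vec t'))"
        using fun_cong[OF eq, of i] top_eq by (simp add: to_disk_def)
      then have "vec t i / vnorm (vec t) = vec t' i / vnorm (vec t')"
        using False by (metis eq_iff_diff_eq_0 mult_left_cancel)
      then show ?thesis
        using p by (simp add: l_def field_simps)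
    qed
    then have "weight t v = l * weight t' v" for v
      using vec_eq_imp_weight[OF t] l0 by auto
    then have tl: "t A = l * t' A" if "A \<in> L" "A \<noteq> top" for A
      using weight_unique[OF t, of l A] l0 that by auto
    then have "sum t (L - {top}) = l * sum t' (L - {top})"
      by (simp add: sum_distrib_left)
    then have "l = 1"
      using sum_nontop[OF t(1)] sum_nontop[OF t(2)] top_eq False by simp
    then show ?thesis
      using tl that by simp
  qed
  show "t = t'"
  proof
    fix A show "t A = t' A"
      using nontop top_eq KD(2)[OF t(1), of A] KD(2)[OF t(2), of A] by metis
  qed
qed

lemma to_disk_surj:
  assumes x: "\<And>i. i \<ge> card E \<Longrightarrow> x i = 0" "(\<Sum>i<card E. (x i)\<^sup>2) \<le> 1"
  shows "x \<in> to_disk ` K"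
proof (cases "vnorm x = 0")
  case True
  then have "x i = 0" for i
    using vnorm_eq_0 x(1) by (metis not_le)
  then have "x = to_disk (\<lambda>A. if A = top then 1 else 0)"
    by (auto simp: to_disk_def)
  then show ?thesis
    using point_top by blast
next
  case False
  define n where "n = vnorm x"
  have n: "0 < n" "n \<le> 1"
    using False vnorm_nonneg[of x] x(2) by (auto simp: n_def vnorm_def)
  obtain a where a: "\<And>v. 0 \<le> a v" "{v. a v \<noteq> 0} \<in> J"
    "\<And>e. e \<in> E \<Longrightarrow> x (the_inv_into {..<card E} \<beta> e) = (\<Sum>v\<in>D. a v * r v e)"
    by (rule fan_ex[of "\<lambda>e. x (the_inv_into {..<card E} \<beta> e)"]) (rule that)
  have xa: "x i = (\<Sum>v\<in>D. a v * r v (\<beta> i))" if "i < card E" for i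
    using a(3)[of "\<beta> i"] \<beta> that the_inv_into_f_f[of \<beta> "{..<card E}" i]
    by (auto simp: bij_betw_def)
  have fa: "finite {v. a v \<noteq> 0}"
    using a(2) J_sub finite_D finite_subset by blast
  have "T \<in> \<sigma> ` (L - {top})" if "T \<subseteq> {v. a v \<noteq> 0}" "T \<noteq> {}" for T
  proof -
    have "T \<in> J" using that(1) a(2) J_down by blast
    then obtain A where "A \<in> L" "T = \<sigma> A"
      using \<sigma> by (auto simp: bij_betw_def)
    then show ?thesis
      using that(2) \<sigma>_top by auto
  qed
  then obtain c where c: "\<And>k. 0 \<le> c k" "\<And>k. k \<notin> L - {top} \<Longrightarrow> c k = 0"
    "\<And>k k'. c k \<noteq> 0 \<Longrightarrow> c k' \<noteq> 0 \<Longrightarrow> \<sigma> k \<subseteq> \<sigma> k' \<or> \<sigma> k' \<subseteq> \<sigma> k"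
    "\<And>v. a v = sum c {k \<in> L - {top}. v \<in> \<sigma> k}"
    by (rule layer_exists[OF finite_Diff[OF finite_L] fa a(1), of \<sigma>]) (assumption | rule that)+
  define s where "s = sum c (L - {top})"
  have "s \<noteq> 0"
  proof
    assume "s = 0"
    then have "\<forall>k\<in>L - {top}. c k = 0"
      using finite_L c(1) unfolding s_def by (subst (asm) sum_nonneg_eq_0_iff) auto
    then have "a v = 0" for v
      unfolding c(4) by (intro sum.neutral) auto
    then show False
      using xa False vnorm_eq_0 by auto
  qed
  then have s: "s > 0"
    using sum_nonneg[of "L - {top}" c] c(1) by (simp add: s_def)
  \<comment> \<open>The layer coefficients are rescaled to total mass \<open>n\<close>, the norm of
    \<open>x\<close>; the remaining mass \<open>1 - n\<close> goes to the cone point, so the radius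
    comes out right.\<close>
  define t where "t = (\<lambda>A. if A = top then 1 - n else n / s * c A)"
  have t_sum: "sum t (L - {top}) = n"
  proof -
    have "sum t (L - {top}) = (\<Sum>A\<in>L - {top}. n / s * c A)"
      by (intro sum.cong) (auto simp: t_def)
    also have "\<dots> = n / s * s"
      by (simp only: s_def sum_distrib_left)
    finally show ?thesis using s by simp
  qed
  then have "sum t L = 1"
    using sum.remove[OF finite_L top(1), of t] by (simp add: t_def)
  moreover have "0 \<le> t A" for A
    using n s c(1)[of A] by (auto simp: t_def)
  moreover have "t A = 0" if "A \<notin> L" for A
    using that top(1) c(2)[of A] by (auto simp: t_def)
  moreover have "le A A' \<or> le A' A \<or> t A = 0 \<or> t A' = 0" if "A \<in> L" "A' \<in> L" for A A'
  proof (cases "A = top \<or> A' = top")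
    case True
    then show ?thesis using top(2) that by auto
  next
    case False
    then show ?thesis
      using c(3)[of A A'] le_iff that by (auto simp: t_def)
  qed
  ultimately have tK: "t \<in> K"
    unfolding K_def order_realization_def by blast
  have "weight t v = n / s * a v" for v
    unfolding weight_def c(4) sum_distrib_left by (intro sum.cong) (auto simp: t_def)
  then have w: "weight t = (\<lambda>v. n / s * a v)" by auto
  have "vec t i = n / s * x i" for i
  proof (cases "i < card E")
    case True
    then show ?thesis
      by (simp only: vec_weight w xa sum_distrib_left mult.assoc)
  next
    case False
    then show ?thesis
      using x(1)[of i] by (simp add: vec_def)
  qed
  then have vt: "vec t = (\<lambda>i. n / s * x i)" by auto
  have "vnorm (vec t) = \<bar>n / s\<bar> * vnorm x"
    by (simp only: vt vnorm_scale)
  then have "vnorm (vec t) = n / s * n"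
    using n s by (simp add: n_def)
  then have "to_disk t i = n * (n / s * x i / (n / s * n))" for i
    unfolding to_disk_def using fun_cong[OF vt, of i] by (simp add: t_def)
  then have "to_disk t i = x i" for i
    using n s by simp
  then have "x = to_disk t" by auto
  then show ?thesis
    using tK by blast
qed

lemma to_disk_image: "to_disk ` K = disk (card E)"
proof
  show "to_disk ` K \<subseteq> disk (card E)"
  proof
    fix x assume "x \<in> to_disk ` K"
    then obtain t where t: "t \<in> K" "x = to_disk t" by auto
    have "(1 - t top)\<^sup>2 \<le> 1"
      using top_le_1[OF t(1)] KD(1)[OF t(1), of top] by (intro power_le_one) auto
    moreover have "to_disk t i = 0" if "i \<ge> card E" for i
      using that by (simp add: to_disk_def vec_def)
    ultimately show "x \<in> disk (card E)"
      using t sum_to_disk[OF t(1)] by (simp add: disk_def topspace_Euclidean_space)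
  qed
  show "disk (card E) \<subseteq> to_disk ` K"
    using to_disk_surj by (auto simp: disk_def topspace_Euclidean_space)
qed

lemma homeomorphic_to_disk:
  "homeomorphic_map (top_of_set K) (subtopology (Euclidean_space (card E)) (disk (card E))) to_disk"
proof -
  have sub: "disk (card E) \<subseteq> topspace (Euclidean_space (card E))"
    by (auto simp: disk_def)
  then have eq: "subtopology (Euclidean_space (card E)) (disk (card E)) = top_of_set (disk (card E))"
    by (simp add: Euclidean_space_eq_top_of_set subtopology_subtopology inf.absorb2)
  show ?thesis
    unfolding eq
  proof (rule continuous_imp_homeomorphic_map)
    show "compact_space (top_of_set K)"
      using compact_order_realization[OF finite_L, of le]
      by (simp add: K_def compact_space_subtopology)
    show "Hausdorff_space (top_of_set (disk (card E)))"
      by (rule Hausdorff_space_top_of_set_fun)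
    show "continuous_map (top_of_set K) (top_of_set (disk (card E))) to_disk"
      using continuous_to_disk to_disk_image by (auto simp: continuous_map_in_subtopology)
    show "to_disk ` topspace (top_of_set K) = topspace (top_of_set (disk (card E)))"
      using to_disk_image by simp
    show "inj_on to_disk (topspace (top_of_set K))"
      using inj_to_disk by simp
  qed
qed

end

section \<open>Gluing the balls of the lower sets into a regular CW complex\<close>

locale locally_fan_poset =
  fixes P :: "'p set" and le :: "'p \<Rightarrow> 'p \<Rightarrow> bool" and dim :: "'p \<Rightarrow> nat"
    and h :: "'p \<Rightarrow> ('p \<Rightarrow> real) \<Rightarrow> nat \<Rightarrow> real"
  assumes finite_P: "finite P"
    and refl: "\<And>A. A \<in> P \<Longrightarrow> le A A"
    and trans: "\<And>A B C. A \<in> P \<Longrightarrow> B \<in> P \<Longrightarrow> C \<in> P \<Longrightarrow> le A B \<Longrightarrow> le B C \<Longrightarrow> le A C"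
    and dim_less: "\<And>A B. A \<in> P \<Longrightarrow> B \<in> P \<Longrightarrow> le A B \<Longrightarrow> A \<noteq> B \<Longrightarrow> dim A < dim B"
    and homeo: "\<And>B. B \<in> P \<Longrightarrow> homeomorphic_map
      (top_of_set (order_realization {A \<in> P. le A B} le))
      (subtopology (Euclidean_space (dim B)) (disk (dim B))) (h B)"
    and norm_h: "\<And>B t. B \<in> P \<Longrightarrow> t \<in> order_realization {A \<in> P. le A B} le \<Longrightarrow>
      (\<Sum>i<dim B. (h B t i)\<^sup>2) = (1 - t B)\<^sup>2"
begin

definition "R = order_realization P le"

definition "KB B = order_realization {A \<in> P. le A B} le"

lemma antisym: "A \<in> P \<Longrightarrow> B \<in> P \<Longrightarrow> le A B \<Longrightarrow> le B A \<Longrightarrow> A = B"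
  using dim_less[of A B] dim_less[of B A] by fastforce

text \<open>Viewing the realization of a lower set as the part of the full realization supported
  below \<open>B\<close> places all closed cells in one space, where gluing is automatic.\<close>

lemma KB_eq: "KB B = {t \<in> R. \<forall>A. t A \<noteq> 0 \<longrightarrow> le A B}"
proof -
  have "t \<in> KB B \<longleftrightarrow> t \<in> R \<and> (\<forall>A. t A \<noteq> 0 \<longrightarrow> le A B)" for t
  proof (cases "\<forall>A. t A \<noteq> 0 \<longrightarrow> le A B")
    case True
    then have "sum t {A \<in> P. le A B} = sum t P"
      using finite_P by (intro sum.mono_neutral_left) auto
    moreover have "(\<forall>A. A \<notin> {A \<in> P. le A B} \<longrightarrow> t A = 0) \<longleftrightarrow> (\<forall>A. A \<notin> P \<longrightarrow> t A = 0)"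
      using True by blast
    moreover have "(\<forall>A\<in>{A \<in> P. le A B}. \<forall>A'\<in>{A \<in> P. le A B}. le A A' \<or> le A' A \<or> t A = 0 \<or> t A' = 0)
        \<longleftrightarrow> (\<forall>A\<in>P. \<forall>A'\<in>P. le A A' \<or> le A' A \<or> t A = 0 \<or> t A' = 0)"
      using True by blast
    ultimately show ?thesis
      using True by (simp only: KB_def R_def order_realization_def mem_Collect_eq) blast
  next
    case False
    then show ?thesis
      unfolding KB_def order_realization_def by blast
  qed
  then show ?thesis by blast
qed

text \<open>Supports in \<open>KB B\<close> are chains below \<open>B\<close>, so the condition says
  that \<open>B\<close> is the largest element of the support.\<close>

definition cell :: "'p \<Rightarrow> ('p \<Rightarrow> real) set"
  where "cell B = {t \<in> KB B. t B \<noteq> 0}"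

definition point :: "'p \<Rightarrow> 'p \<Rightarrow> real"
  where "point B = (\<lambda>A. if A = B then 1 else 0)"

lemma point_in: "B \<in> P \<Longrightarrow> point B \<in> cell B"
  using finite_P refl by (auto simp: cell_def KB_eq R_def order_realization_def point_def)

lemma cell_sub: "cell B \<subseteq> R" "cell B \<subseteq> KB B" "KB B \<subseteq> R"
  by (auto simp: cell_def KB_eq)

lemma cell_disjoint:
  assumes "A \<in> P" "B \<in> P" "t \<in> cell A" "t \<in> cell B"
  shows "A = B"
  using assms antisym by (auto simp: cell_def KB_eq)

lemma cell_inj: "inj_on cell P"
  using cell_disjoint point_in by (metis inj_onI)

text \<open>In a chain the largest element is the one of largest dimension, as \<open>dim\<close> is
  strictly monotone.\<close>

lemma R_cover:
  assumes "t \<in> R"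
  obtains B where "B \<in> P" "t \<in> cell B"
proof -
  let ?S = "{A \<in> P. t A \<noteq> 0}"
  have "?S \<noteq> {}"
    using assms by (force simp: R_def order_realization_def)
  moreover have "finite ?S"
    using finite_P by simp
  ultimately have "Max (dim ` ?S) \<in> dim ` ?S"
    by (intro Max_in) simp_all
  then obtain B where B: "B \<in> ?S" "Max (dim ` ?S) = dim B"
    by (rule imageE)
  have le_Max: "dim A \<le> dim B" if "A \<in> ?S" for A
    unfolding B(2)[symmetric] using finite_P that by (intro Max_ge) simp_all
  have "le A B" if "A \<in> ?S" for A
  proof -
    have "le A B \<or> le B A"
      using assms that B(1) by (auto simp: R_def order_realization_def)
    then show ?thesis
      using dim_less[of B A] le_Max[OF that] B(1) that refl[of A] by (cases "A = B") auto
  qed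
  moreover have "t A \<noteq> 0 \<Longrightarrow> A \<in> P" for A
    using assms by (auto simp: R_def order_realization_def)
  ultimately have "t \<in> cell B"
    using assms B(1) by (auto simp: cell_def KB_eq)
  then show ?thesis
    using B(1) that by blast
qed

lemma KB_bounds: "B \<in> P \<Longrightarrow> t \<in> KB B \<Longrightarrow> 0 \<le> t B \<and> t B \<le> 1"
  using member_le_sum[of B "{A \<in> P. le A B}" t] finite_P refl[of B]
  by (auto simp: KB_def order_realization_def)

lemma closed_KB: "closed (KB B)"
proof -
  have "Hausdorff_space (euclidean :: ('p \<Rightarrow> real) topology)"
    using Hausdorff_space_top_of_set_fun[of UNIV] by (simp add: subtopology_UNIV)
  then have "closedin euclidean (KB B)"
    using compact_order_realization[of "{A \<in> P. le A B}" le] finite_P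
    by (intro compactin_imp_closedin) (auto simp: KB_def)
  then show ?thesis by simp
qed

lemma closure_of_cell:
  assumes "B \<in> P"
  shows "top_of_set R closure_of cell B = KB B"
proof
  show "top_of_set R closure_of cell B \<subseteq> KB B"
    by (intro closure_of_minimal closed_subset closed_KB cell_sub)
  show "KB B \<subseteq> top_of_set R closure_of cell B"
  proof
    fix t assume t: "t \<in> KB B"
    \<comment> \<open>Moves \<open>t\<close> slightly towards the vertex of \<open>B\<close>. As
      \<open>B\<close> is comparable to everything below it, the support stays a chain, now
      containing \<open>B\<close>, so the sequence lies in the open cell and tends to
      \<open>t\<close>.\<close>
    define u where "u = (\<lambda>n A. (1 - 1 / real (Suc n)) * t A + 1 / real (Suc n) * point B A)"
    have un: "u n \<in> cell B" for n
    proof -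
      let ?s = "1 / real (Suc n)"
      have s: "0 < ?s" "?s \<le> 1" by auto
      have t': "0 \<le> t A" "A \<notin> P \<Longrightarrow> t A = 0" "sum t P = 1" "t A \<noteq> 0 \<Longrightarrow> le A B"
        "A \<in> P \<Longrightarrow> A' \<in> P \<Longrightarrow> le A A' \<or> le A' A \<or> t A = 0 \<or> t A' = 0" for A A'
        using t unfolding KB_eq R_def order_realization_def by auto
      have "0 \<le> (1 - ?s) * t B"
        using t'(1)[of B] s(2) by (intro mult_nonneg_nonneg) simp_all
      moreover have "u n B = (1 - ?s) * t B + ?s"
        by (simp add: u_def point_def)
      ultimately have nz: "u n B \<noteq> 0"
        using s(1) by linarith
      have "sum (u n) P = (1 - ?s) * sum t P + ?s * sum (point B) P"
        unfolding u_def by (simp only: sum.distrib sum_distrib_left)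
      then have "sum (u n) P = 1"
        using t'(3) assms finite_P by (simp add: point_def)
      moreover have "0 \<le> u n A" "A \<notin> P \<Longrightarrow> u n A = 0" for A
        using t'(1,2)[of A] s assms by (auto simp: u_def point_def)
      moreover have leB: "le A B" if "u n A \<noteq> 0" for A
        using that t'(4)[of A] refl[OF assms] by (cases "A = B") (auto simp: u_def point_def)
      moreover have "le A A' \<or> le A' A \<or> u n A = 0 \<or> u n A' = 0" if "A \<in> P" "A' \<in> P" for A A'
      proof (cases "A = B \<or> A' = B")
        case True
        then show ?thesis using leB[of A] leB[of A'] by metis
      next
        case False
        then show ?thesis using t'(5)[OF that] by (auto simp: u_def point_def)
      qed
      moreover have "u n B \<noteq> 0"
        by (rule nz)
      ultimately show ?thesis
        by (auto simp: cell_def KB_eq R_def order_realization_def)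
    qed
    have "(\<lambda>n. u n A) \<longlonglongrightarrow> (1 - 0) * t A + 0 * point B A" for A
      unfolding u_def by (intro tendsto_intros LIMSEQ_Suc lim_1_over_n)
    then have lim: "limitin (product_topology (\<lambda>_. euclidean) UNIV) u t sequentially"
      by (auto simp: limitin_componentwise)
    then have lim: "limitin euclidean u t sequentially"
      by (simp add: euclidean_product_topology)
    then have "limitin (top_of_set R) u t sequentially"
      using subsetD[OF cell_sub(3) t] subsetD[OF cell_sub(1) un]
      by (simp add: limitin_subtopology)
    then show "t \<in> top_of_set R closure_of cell B"
      using un by (auto simp: in_closure_of limitin_def eventually_sequentially) blast
  qed
qed

definition char :: "'p \<Rightarrow> (nat \<Rightarrow> real) \<Rightarrow> 'p \<Rightarrow> real"
  where "char B = (SOME g. homeomorphic_maps (top_of_set (KB B))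
    (subtopology (Euclidean_space (dim B)) (disk (dim B))) (h B) g)"

lemma char:
  assumes "B \<in> P"
  shows "homeomorphic_maps (top_of_set (KB B))
    (subtopology (Euclidean_space (dim B)) (disk (dim B))) (h B) (char B)"
  unfolding char_def by (rule someI_ex[OF homeo[OF assms, unfolded homeomorphic_map_maps, folded KB_def]])

lemma disk_sub: "disk n \<subseteq> topspace (Euclidean_space n)" "open_disk n \<subseteq> disk n" "disk_boundary n \<subseteq> disk n"
  by (auto simp: disk_def open_disk_def disk_boundary_def)

lemma char_inv:
  assumes "B \<in> P"
  shows "t \<in> KB B \<Longrightarrow> h B t \<in> disk (dim B)" "x \<in> disk (dim B) \<Longrightarrow> char B x \<in> KB B"
    "t \<in> KB B \<Longrightarrow> char B (h B t) = t" "x \<in> disk (dim B) \<Longrightarrow> h B (char B x) = x"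
  using char[OF assms] disk_sub(1)[of "dim B"]
  by (auto simp: homeomorphic_maps_def continuous_map_def)

text \<open>The radius of \<open>h B t\<close> is \<open>1 - t B\<close> with \<open>t B\<close>
  between 0 and 1, so the interior of the disk corresponds to positive weight of \<open>B\<close>
  and the boundary sphere to its absence.\<close>

lemma char_image:
  assumes "B \<in> P"
  shows "char B ` open_disk (dim B) = cell B"
    and "char B ` disk_boundary (dim B) = {t \<in> KB B. t B = 0}"
proof -
  have eq: "(1 - t B)\<^sup>2 < 1 \<longleftrightarrow> t B \<noteq> 0" "(1 - t B)\<^sup>2 = 1 \<longleftrightarrow> t B = 0" if "t \<in> KB B" for t
  proof -
    have "0 \<le> 1 - t B" "1 - t B \<le> 1"
      using KB_bounds[OF assms that] by auto
    then show "(1 - t B)\<^sup>2 = 1 \<longleftrightarrow> t B = 0"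
      by (simp add: power2_eq_1_iff)
    then show "(1 - t B)\<^sup>2 < 1 \<longleftrightarrow> t B \<noteq> 0"
      using \<open>0 \<le> 1 - t B\<close> \<open>1 - t B \<le> 1\<close> power_le_one[of "1 - t B" 2] by linarith
  qed
  have o: "t B \<noteq> 0 \<longleftrightarrow> h B t \<in> open_disk (dim B)" "t B = 0 \<longleftrightarrow> h B t \<in> disk_boundary (dim B)"
    if "t \<in> KB B" for t
    using eq[OF that] norm_h[OF assms that[unfolded KB_def]] char_inv(1)[OF assms that]
    by (auto simp: open_disk_def disk_boundary_def disk_def)
  have im: "char B ` S = {t \<in> KB B. h B t \<in> S}" if "S \<subseteq> disk (dim B)" for S
  proof
    show "char B ` S \<subseteq> {t \<in> KB B. h B t \<in> S}"
      using that char_inv(2,4)[OF assms] by auto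
    show "{t \<in> KB B. h B t \<in> S} \<subseteq> char B ` S"
      using char_inv(3)[OF assms] by (metis (mono_tags, lifting) imageI mem_Collect_eq subsetI)
  qed
  show "char B ` open_disk (dim B) = cell B"
    unfolding im[OF disk_sub(2)] cell_def using o(1) by auto
  show "char B ` disk_boundary (dim B) = {t \<in> KB B. t B = 0}"
    unfolding im[OF disk_sub(3)] using o(2) by auto
qed

lemma char_homeo_sub:
  assumes "B \<in> P" "S \<subseteq> disk (dim B)"
  shows "homeomorphic_map (subtopology (Euclidean_space (dim B)) S) (top_of_set (char B ` S)) (char B)"
proof -
  have "homeomorphic_map (subtopology (subtopology (Euclidean_space (dim B)) (disk (dim B))) S)
      (subtopology (top_of_set (KB B)) (char B ` S)) (char B)"
  proof (rule homeomorphic_map_subtopologies)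
    show "homeomorphic_map (subtopology (Euclidean_space (dim B)) (disk (dim B))) (top_of_set (KB B)) (char B)"
      using char[OF assms(1)] homeomorphic_maps_sym homeomorphic_map_maps by blast
    show "char B ` (topspace (subtopology (Euclidean_space (dim B)) (disk (dim B))) \<inter> S)
        = topspace (top_of_set (KB B)) \<inter> char B ` S"
      using assms(2) disk_sub(1)[of "dim B"] char_inv(2)[OF assms(1)] by auto
  qed
  moreover have "char B ` S \<subseteq> KB B"
    using assms char_inv(2) by auto
  ultimately show ?thesis
    using assms(2) by (simp add: subtopology_subtopology inf.absorb2)
qed

definition Y :: "('p \<Rightarrow> real) cw"
  where "Y = \<lparr>cw_space = top_of_set R, cells = cell ` P, cdim = (\<lambda>e. dim (the_inv_into P cell e))\<rparr>"

lemma cdim_Y: "B \<in> P \<Longrightarrow> cdim Y (cell B) = dim B"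
  by (simp add: Y_def the_inv_into_f_f[OF cell_inj])

lemma cw_Y: "cw_complex Y (\<lambda>e. char (the_inv_into P cell e))"
  unfolding cw_complex_def
proof (intro conjI ballI)
  show "Hausdorff_space (cw_space Y)"
    by (simp add: Y_def Hausdorff_space_top_of_set_fun)
  show "\<Union> (cells Y) = topspace (cw_space Y)"
  proof
    show "topspace (cw_space Y) \<subseteq> \<Union> (cells Y)"
    proof
      fix t assume "t \<in> topspace (cw_space Y)"
      then have "t \<in> R" by (simp add: Y_def)
      then obtain B where "B \<in> P" "t \<in> cell B" by (rule R_cover)
      then show "t \<in> \<Union> (cells Y)" by (auto simp: Y_def)
    qed
  qed (use cell_sub(1) in \<open>auto simp: Y_def\<close>)
  show "disjoint (cells Y)"
    using cell_disjoint by (auto simp: Y_def disjoint_def pairwise_def disjnt_iff)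
next
  fix e assume "e \<in> cells Y"
  then obtain B where B: "B \<in> P" "e = cell B" by (auto simp: Y_def)
  have inv: "the_inv_into P cell e = B"
    using B by (simp add: the_inv_into_f_f[OF cell_inj])
  have d: "cdim Y e = dim B" using B cdim_Y by simp
  have "continuous_map (subtopology (Euclidean_space (dim B)) (disk (dim B))) (top_of_set (KB B)) (char B)"
    using char[OF B(1)] by (simp add: homeomorphic_maps_def)
  then show "continuous_map (subtopology (Euclidean_space (cdim Y e)) (disk (cdim Y e)))
      (cw_space Y) (char (the_inv_into P cell e))"
    unfolding inv d using cell_sub(3)[of B]
    by (auto simp: Y_def continuous_map_in_subtopology)
  show "homeomorphic_map (subtopology (Euclidean_space (cdim Y e)) (open_disk (cdim Y e)))
      (subtopology (cw_space Y) e) (char (the_inv_into P cell e))"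
    unfolding inv d using char_homeo_sub[OF B(1) disk_sub(2)] char_image(1)[OF B(1)] B(2) cell_sub(1)[of B]
    by (simp add: Y_def subtopology_subtopology inf.absorb2)
  \<comment> \<open>A boundary point gives \<open>B\<close> weight 0, so the largest element of its
    support lies strictly below \<open>B\<close> and has smaller dimension.\<close>
  let ?F = "cell ` {A \<in> P. le A B \<and> A \<noteq> B}"
  have "\<exists>A\<in>P. le A B \<and> A \<noteq> B \<and> t \<in> cell A" if t: "t \<in> KB B" "t B = 0" for t
  proof -
    obtain A where A: "A \<in> P" "t \<in> cell A"
      using R_cover[of t] t(1) cell_sub(3) by blast
    then show ?thesis
      using t by (auto simp: cell_def KB_eq)
  qed
  then have "char B ` disk_boundary (dim B) \<subseteq> \<Union> ?F"
    using char_image(2)[OF B(1)] by auto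
  moreover have "?F \<subseteq> {d \<in> cells Y. cdim Y d < dim B}"
    using cdim_Y dim_less[OF _ B(1)] by (auto simp: Y_def)
  moreover have "finite ?F" using finite_P by simp
  ultimately show "\<exists>F. finite F \<and> F \<subseteq> {d \<in> cells Y. cdim Y d < cdim Y e} \<and>
      char (the_inv_into P cell e) ` disk_boundary (cdim Y e) \<subseteq> \<Union> F"
    unfolding inv d by blast
next
  show "\<forall>A. A \<subseteq> topspace (cw_space Y) \<longrightarrow>
       (\<forall>e \<in> cells Y. closedin (cw_space Y) (A \<inter> cw_space Y closure_of e)) \<longrightarrow>
       closedin (cw_space Y) A"
  proof (intro allI impI)
    fix A assume A: "A \<subseteq> topspace (cw_space Y)"
      "\<forall>e \<in> cells Y. closedin (cw_space Y) (A \<inter> cw_space Y closure_of e)"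
    \<comment> \<open>The weak topology is automatic for finitely many cells: \<open>A\<close> is a
      finite union of closed pieces.\<close>
    have "A = (\<Union>e\<in>cells Y. A \<inter> cw_space Y closure_of e)"
    proof
      show "A \<subseteq> (\<Union>e\<in>cells Y. A \<inter> cw_space Y closure_of e)"
      proof
        fix t assume t: "t \<in> A"
        then have "t \<in> R" using A(1) by (auto simp: Y_def)
        then obtain B where "B \<in> P" "t \<in> cell B" by (rule R_cover)
        then show "t \<in> (\<Union>e\<in>cells Y. A \<inter> cw_space Y closure_of e)"
          using t closure_of_cell[of B] cell_sub(2)[of B] by (auto simp: Y_def)
      qed
    qed auto
    moreover have "closedin (cw_space Y) (\<Union>e\<in>cells Y. A \<inter> cw_space Y closure_of e)"
      using A(2) finite_P by (intro closedin_Union) (auto simp: Y_def)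
    ultimately show "closedin (cw_space Y) A" by simp
  qed
qed

lemma face_poset: "is_face_poset P le"
  unfolding is_face_poset_def
proof (intro exI conjI ballI)
  show "regular_cw_complex Y"
    unfolding regular_cw_complex_def
  proof (intro exI conjI ballI)
    show "cw_complex Y (\<lambda>e. char (the_inv_into P cell e))" by (rule cw_Y)
    fix e assume "e \<in> cells Y"
    then obtain B where B: "B \<in> P" "e = cell B" by (auto simp: Y_def)
    have inv: "the_inv_into P cell e = B"
      using B by (simp add: the_inv_into_f_f[OF cell_inj])
    have d: "cdim Y e = dim B" using B cdim_Y by simp
    have "char B ` disk_boundary (dim B) \<subseteq> R"
      using char_image(2)[OF B(1)] cell_sub(3)[of B] by auto
    moreover have "topspace (subtopology (Euclidean_space (dim B)) (disk_boundary (dim B)))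
        = disk_boundary (dim B)"
      using disk_sub[of "dim B"] by auto
    ultimately show "embedding_map (subtopology (Euclidean_space (cdim Y e)) (disk_boundary (cdim Y e)))
            (cw_space Y) (char (the_inv_into P cell e))"
      unfolding inv d embedding_map_def using char_homeo_sub[OF B(1) disk_sub(3)]
      by (simp add: Y_def subtopology_subtopology inf.absorb2)
  qed
  show "bij_betw cell P (cells Y)"
    using cell_inj by (simp add: Y_def bij_betw_def)
  fix A B assume A: "A \<in> P" and B: "B \<in> P"
  have "cell_le Y (cell A) (cell B) \<longleftrightarrow> cell A \<subseteq> KB B"
    using closure_of_cell[OF B] by (simp add: cell_le_def Y_def)
  also have "\<dots> \<longleftrightarrow> le A B"
  proof
    assume "cell A \<subseteq> KB B"
    then have "point A \<in> KB B" using point_in[OF A] by auto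
    then show "le A B" by (auto simp: KB_eq point_def split: if_splits)
  next
    assume "le A B"
    show "cell A \<subseteq> KB B"
    proof
      fix t assume t: "t \<in> cell A"
      have "le A' B" if "t A' \<noteq> 0" for A'
        using t that trans[OF _ A B _ \<open>le A B\<close>, of A']
        unfolding cell_def KB_eq R_def order_realization_def by blast
      then show "t \<in> KB B"
        using t unfolding cell_def KB_eq by blast
    qed
  qed
  finally show "le A B \<longleftrightarrow> cell_le Y (cell A) (cell B)" by simp
qed

end

text \<open>The interface between topology and combinatorics. The fans chosen at different elements
  need not be compatible, because the closed cells already sit inside one order complex and only
  their homeomorphism type matters.\<close>

theorem is_face_poset_if_fans:
  fixes P :: "'p set" and le :: "'p \<Rightarrow> 'p \<Rightarrow> bool" and dim :: "'p \<Rightarrow> nat"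
  assumes "finite P" "\<And>A. A \<in> P \<Longrightarrow> le A A"
    and "\<And>A B C. A \<in> P \<Longrightarrow> B \<in> P \<Longrightarrow> C \<in> P \<Longrightarrow> le A B \<Longrightarrow> le B C \<Longrightarrow> le A C"
    and "\<And>A B. A \<in> P \<Longrightarrow> B \<in> P \<Longrightarrow> le A B \<Longrightarrow> A \<noteq> B \<Longrightarrow> dim A < dim B"
    and ex: "\<And>B. B \<in> P \<Longrightarrow> \<exists>(D :: 'd set) J (E :: 'e set) r \<sigma>. complete_fan D J E r \<and> card E = dim B \<and>
      bij_betw \<sigma> {A \<in> P. le A B} J \<and>
      (\<forall>A A'. A \<in> P \<longrightarrow> A' \<in> P \<longrightarrow> le A B \<longrightarrow> le A' B \<longrightarrow> (le A A' \<longleftrightarrow> \<sigma> A' \<subseteq> \<sigma> A))"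
  shows "is_face_poset P le"
proof -
  let ?R = "\<lambda>B. order_realization {A \<in> P. le A B} le"
  let ?Q = "\<lambda>B h. homeomorphic_map (top_of_set (?R B))
      (subtopology (Euclidean_space (dim B)) (disk (dim B))) h \<and>
      (\<forall>t\<in>?R B. (\<Sum>i<dim B. (h t i)\<^sup>2) = (1 - t B)\<^sup>2)"
  have "\<exists>h. ?Q B h" if B: "B \<in> P" for B
  proof -
    obtain D :: "'d set" and J and E :: "'e set" and r \<sigma> where *: "complete_fan D J E r" "card E = dim B"
      "bij_betw \<sigma> {A \<in> P. le A B} J"
      "\<And>A A'. A \<in> P \<Longrightarrow> A' \<in> P \<Longrightarrow> le A B \<Longrightarrow> le A' B \<Longrightarrow> (le A A' \<longleftrightarrow> \<sigma> A' \<subseteq> \<sigma> A)"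
      using ex[OF B] by (elim exE conjE) (rule that, simp_all)
    interpret fan_poset "{A \<in> P. le A B}" le B D J E r \<sigma>
    proof
      show "le A A' \<longleftrightarrow> \<sigma> A' \<subseteq> \<sigma> A" if "A \<in> {A \<in> P. le A B}" "A' \<in> {A \<in> P. le A B}" for A A'
        using that by (intro *(4)) (simp_all only: mem_Collect_eq)
      show "finite {A \<in> P. le A B}" "B \<in> {A \<in> P. le A B}"
        using assms(1,2) B by simp_all
    qed (use *(1,3) in \<open>simp_all only: mem_Collect_eq\<close>)
    show ?thesis
      by (intro exI[of _ to_disk] conjI ballI)
        (fact homeomorphic_to_disk[unfolded K_def *(2)], erule sum_to_disk[unfolded K_def *(2)])
  qed
  then have "\<forall>B\<in>P. \<exists>h. ?Q B h"
    by (rule ballI)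
  from bchoice[OF this] obtain h where h: "\<forall>B\<in>P. ?Q B (h B)"
    by (rule exE)
  interpret locally_fan_poset P le dim h
  proof (unfold_locales, goal_cases)
    case 1 show ?case by (rule assms(1))
  next
    case 2 then show ?case by (rule assms(2))
  next
    case (3 A B C) then show ?case by (rule assms(3)[of A B C])
  next
    case 4 then show ?case by (rule assms(4))
  next
    case 5 then show ?case using h by blast
  next
    case 6 then show ?case using h by blast
  qed
  show ?thesis by (rule face_poset)
qed

section \<open>Free reduction of paths\<close>

text \<open>Prepends a cell to an already reduced word, cancelling a step against its reverse. Only
  cells are compared; \<open>step_back\<close> shows that on paths nothing but inverse pairs gets
  cancelled.\<close>

fun rc :: "'c \<Rightarrow> 'c list \<Rightarrow> 'c list"
  where
    "rc x (y # z # p) = (if x = z then z # p else x # y # z # p)"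
  | "rc x p = x # p"

fun red :: "'c list \<Rightarrow> 'c list"
  where
    "red [] = []"
  | "red (x # p) = rc x (red p)"

fun reduced :: "'c list \<Rightarrow> bool"
  where
    "reduced (x # y # z # p) \<longleftrightarrow> x \<noteq> z \<and> reduced (y # z # p)"
  | "reduced _ \<longleftrightarrow> True"

lemma reduced_tl: "reduced (x # p) \<Longrightarrow> reduced p"
  by (cases p rule: reduced.cases) auto

lemma reduced_rc: "reduced p \<Longrightarrow> reduced (rc x p)"
  by (cases "(x, p)" rule: rc.cases) (auto dest: reduced_tl)

lemma reduced_red: "reduced (red p)"
  by (induction p) (auto intro: reduced_rc)

lemma rc_reduced: "reduced (x # p) \<Longrightarrow> rc x p = x # p"
  by (cases "(x, p)" rule: rc.cases) auto

lemma red_reduced: "reduced p \<Longrightarrow> red p = p"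
proof (induction p)
  case (Cons x p)
  then show ?case
    using reduced_tl[OF Cons.prems] by (simp add: rc_reduced)
qed simp

lemma rc_Cons: "\<exists>s. rc x p = x # s"
  by (cases "(x, p)" rule: rc.cases) auto

lemma red_Cons: obtains s where "red (x # p) = x # s"
  using rc_Cons by (metis red.simps(2))

lemma red_eq_Nil [simp]: "red p = [] \<longleftrightarrow> p = []"
  by (cases p) (auto, metis list.distinct(1) rc_Cons)

lemma hd_red: "p \<noteq> [] \<Longrightarrow> hd (red p) = hd p"
  by (cases p) (auto, metis list.sel(1) rc_Cons)

lemma last_rc: "last (rc x p) = (if p = [] then x else last p)"
  by (cases "(x, p)" rule: rc.cases) auto

lemma last_red: "last (red p) = last p"
  by (induction p) (auto simp: last_rc)

text \<open>If the reduced tail continues with \<open>y\<close>, the inner step cancels first and is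
  then restored by the outer one; otherwise the two new steps cancel each other. With congruence
  under prefixes, this makes \<open>red\<close> invariant under inserting a step and its reverse
  anywhere.\<close>

lemma red_cancel: "red (x # y # x # p) = red (x # p)"
proof -
  obtain s where s: "red (x # p) = x # s" by (rule red_Cons)
  have rs: "reduced (x # s)"
    using reduced_red[of "x # p"] s by simp
  show ?thesis
  proof (cases "\<exists>s'. s = y # s'")
    case True
    then obtain s' where s': "s = y # s'" by auto
    have "rc x (y # s') = x # y # s'"
      using rs s' by (metis rc_reduced)
    then show ?thesis
      using s s' by simp
  next
    case False
    then have "rc y (x # s) = y # x # s"
      by (cases s) auto
    then show ?thesis
      using s by simp
  qed
qed

lemma red_append_cong: "red p = red p' \<Longrightarrow> red (a @ p) = red (a @ p')"
  by (induction a) auto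

lemma red_Cons_cong: "red p = red p' \<Longrightarrow> red (x # p) = red (x # p')"
  by simp

text \<open>The first step is invertible: prefixing \<open>y\<close> undoes it on both
  sides.\<close>

lemma red_left_cancel:
  assumes "red (x # y # p) = red (x # y # q)"
  shows "red (y # p) = red (y # q)"
  using red_Cons_cong[OF assms, of y] by (simp only: red_cancel)

text \<open>
  A finite simplicial complex, with a set \<open>V\<close> of simplices and the vertex sets \<open>vt\<close>, together with
  a pairing \<open>pr\<close> of simplices of adjacent dimensions.
\<close>

locale paired_complex =
  fixes V :: "'c set" and vt :: "'c \<Rightarrow> 'v set" and pr :: "'c \<Rightarrow> 'c \<Rightarrow> bool"
  assumes finite_V: "finite V"
    and inj_vt: "inj_on vt V"
    and finite_vt: "x \<in> V \<Longrightarrow> finite (vt x)"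
    and vt_closed: "x \<in> V \<Longrightarrow> S \<subseteq> vt x \<Longrightarrow> S \<noteq> {} \<Longrightarrow> S \<in> vt ` V"
    and vt_nonempty: "x \<in> V \<Longrightarrow> vt x \<noteq> {}"
    and pr: "pr x y \<Longrightarrow> x \<in> V \<and> y \<in> V \<and> vt x \<subset> vt y \<and> card (vt y) = Suc (card (vt x))"
    and pr_pr: "pr x y \<Longrightarrow> \<not> pr y z"
begin

definition dn :: "'c \<Rightarrow> 'c \<Rightarrow> bool"
  where "dn x y \<longleftrightarrow> x \<in> V \<and> y \<in> V \<and> vt y \<subset> vt x"

definition step :: "'c \<Rightarrow> 'c \<Rightarrow> bool"
  where "step x y \<longleftrightarrow> dn x y \<or> pr x y"

definition path :: "'c list \<Rightarrow> bool"
  where "path p \<longleftrightarrow> p \<noteq> [] \<and> set p \<subseteq> V \<and> successively step p"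

lemma dn_V: "dn x y \<Longrightarrow> x \<in> V" "dn x y \<Longrightarrow> y \<in> V"
  by (auto simp: dn_def)

lemma dn_trans: "dn x y \<Longrightarrow> dn y z \<Longrightarrow> dn x z"
  by (auto simp: dn_def)

lemma dn_irrefl: "\<not> dn x x"
  by (auto simp: dn_def)

lemma dn_not_pr: "dn x y \<Longrightarrow> \<not> pr x y"
  using pr[of x y] by (auto simp: dn_def)

lemma pr_dn: "pr x y \<Longrightarrow> dn y x"
  using pr[of x y] by (auto simp: dn_def)

lemma pr_no_between: "pr x y \<Longrightarrow> dn y c \<Longrightarrow> dn c x \<Longrightarrow> False"
  using pr[of x y] finite_vt[of c] finite_vt[of y]
    psubset_card_mono[of "vt c" "vt x"] psubset_card_mono[of "vt y" "vt c"]
  by (auto simp: dn_def)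

lemma path_Cons: "path (x # y # p) \<longleftrightarrow> step x y \<and> path (y # p)"
  using dn_V pr by (auto simp: path_def step_def)

lemma path_single: "path [x] \<longleftrightarrow> x \<in> V"
  by (simp add: path_def)

lemma path_red: "path p \<Longrightarrow> path (red p)"
proof (induction p)
  case (Cons x p)
  show ?case
  proof (cases p)
    case Nil
    then show ?thesis using Cons.prems by simp
  next
    case (Cons y p')
    then have IH: "path (red p)" and st: "step x y"
      using Cons.IH Cons.prems path_Cons by auto
    obtain s where s: "red p = y # s"
      using Cons red_Cons by metis
    show ?thesis
    proof (cases s)
      case Nil
      then show ?thesis
        using IH s st by (simp add: path_Cons)
    next
      case (Cons z s')
      then show ?thesis
        using IH s st by (auto simp: path_Cons)
    qed
  qed
qed (simp add: path_def)

section \<open>Refinement of paths and its compatibility with free reduction\<close>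

definition mid :: "'c \<Rightarrow> 'c list \<Rightarrow> 'c \<Rightarrow> bool"
  where "mid x m y \<longleftrightarrow> sorted_wrt dn (x # m @ [y]) \<or> m = [] \<and> pr x y"

lemma mid_Nil: "mid x [] y \<longleftrightarrow> step x y"
  by (auto simp: mid_def step_def)

lemma mid_step: "mid x m y \<Longrightarrow> step x y"
  by (auto simp: mid_def step_def)

lemma mid_dn: "mid x m y \<Longrightarrow> dn x y \<Longrightarrow> sorted_wrt dn (x # m @ [y])"
  using dn_not_pr by (auto simp: mid_def)

lemma mid_append: "mid x m a \<Longrightarrow> dn x a \<Longrightarrow> mid a m' y \<Longrightarrow> dn a y \<Longrightarrow> mid x (m @ a # m') y"
  using mid_dn[of x m a] mid_dn[of a m' y] unfolding mid_def
  by (auto simp: sorted_wrt_append intro: dn_trans)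

text \<open>This is what the order of the entrance path category does to words before reduction:
  down steps may be subdivided, while up steps and the given cells are kept.\<close>

inductive ref :: "'c list \<Rightarrow> 'c list \<Rightarrow> bool"
  where
    single: "x \<in> V \<Longrightarrow> ref [x] [x]"
  | Cons: "mid x m y \<Longrightarrow> ref (y # p) (y # q) \<Longrightarrow> ref (x # y # p) (x # m @ y # q)"

lemma ref_single_iff: "ref [x] q \<longleftrightarrow> x \<in> V \<and> q = [x]"
  by (auto elim: ref.cases intro: ref.intros)

lemma ref_Cons_iff:
  "ref (x # y # p) q \<longleftrightarrow> (\<exists>m r. q = x # m @ y # r \<and> mid x m y \<and> ref (y # p) (y # r))"
proof
  assume "ref (x # y # p) q"
  then show "\<exists>m r. q = x # m @ y # r \<and> mid x m y \<and> ref (y # p) (y # r)"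
    by cases auto
qed (auto intro: ref.Cons)

lemma ref_ConsE:
  assumes "ref (x # y # p) q"
  obtains m r where "q = x # m @ y # r" "mid x m y" "ref (y # p) (y # r)"
  using assms ref_Cons_iff by auto

lemma ref_hd: "ref p q \<Longrightarrow> p \<noteq> [] \<and> q \<noteq> [] \<and> hd q = hd p"
  by (induction rule: ref.induct) auto

lemma ref_Cons_hd: "ref (x # p) q \<Longrightarrow> \<exists>r. q = x # r"
  using ref_hd[of "x # p" q] by (cases q) auto

lemma ref_last: "ref p q \<Longrightarrow> last q = last p"
  by (induction rule: ref.induct) auto

lemma ref_refl: "path p \<Longrightarrow> ref p p"
proof (induction p rule: induct_list012)
  case (3 x y p)
  then show ?case
    using ref.Cons[of x "[]" y p p] by (simp add: path_Cons mid_Nil)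
qed (simp_all add: path_def ref.single)

lemma mid_path: "mid x m y \<Longrightarrow> path (y # q) \<Longrightarrow> path (x # m @ y # q)"
proof (induction m arbitrary: x)
  case Nil
  then show ?case by (simp add: mid_Nil path_Cons)
next
  case (Cons a m)
  then have "mid a m y" "dn x a" by (auto simp: mid_def)
  then show ?case using Cons by (simp add: path_Cons step_def)
qed

lemma ref_path2: "ref p q \<Longrightarrow> path q"
  by (induction rule: ref.induct) (auto simp: path_single mid_path)

text \<open>Refining a subdivided step subdivides the original step further. The inclusion of the
  inserted cells is recorded because it later recovers the inclusion of chains from
  \<open>ref\<close>.\<close>

lemma ref_mid:
  assumes "mid x m y" "ref (x # m @ y # q) r"
  obtains m' r' where "r = x # m' @ y # r'" "mid x m' y" "set m \<subseteq> set m'" "ref (y # q) (y # r')"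
  using assms
proof (induction m arbitrary: x r thesis)
  case Nil
  then show ?case
    by (auto elim!: ref_ConsE)
next
  case (Cons a m)
  obtain m0 r0 where r0: "r = x # m0 @ a # r0" "mid x m0 a" "ref (a # m @ y # q) (a # r0)"
    using Cons.prems(3) ref_ConsE by (metis append_Cons)
  have a: "mid a m y" "dn x a" "dn a y"
    using Cons.prems(2) by (auto simp: mid_def)
  obtain m1 r1 where r1: "a # r0 = a # m1 @ y # r1" "mid a m1 y" "set m \<subseteq> set m1" "ref (y # q) (y # r1)"
    by (rule Cons.IH[OF _ a(1) r0(3)])
  show ?case
    by (rule Cons.prems(1)[of "m0 @ a # m1" r1])
      (use r0 r1 a mid_append in auto)
qed

lemma ref_trans: "ref p q \<Longrightarrow> ref q r \<Longrightarrow> ref p r"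
proof (induction arbitrary: r rule: ref.induct)
  case (Cons x m y p q)
  obtain m' r' where "r = x # m' @ y # r'" "mid x m' y" "ref (y # q) (y # r')"
    using ref_mid[OF Cons.hyps(1) Cons.prems] by metis
  then show ?case
    using Cons.IH by (auto intro: ref.Cons)
qed

text \<open>An up step is rigid by definition, and a down step along a regular pair has codimension
  one, hence nothing in between.\<close>

lemma mid_pr: "mid x m y \<Longrightarrow> pr x y \<or> pr y x \<Longrightarrow> m = []"
proof (cases m)
  case (Cons a m')
  assume "mid x m y" and p: "pr x y \<or> pr y x"
  then have a: "dn x a" "dn a y" "dn x y"
    using Cons by (auto simp: mid_def)
  then show ?thesis
    using p dn_not_pr pr_no_between[of y x a] by auto
qed simp

text \<open>Two opposite down steps would make a vertex set a proper subset of itself, so one of the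
  two steps goes up along a regular pair.\<close>

lemma step_back: "step x y \<Longrightarrow> step y x \<Longrightarrow> pr x y \<or> pr y x"
  by (auto simp: step_def dn_def)

text \<open>Whenever reduction cancels \<open>x\<close>, \<open>y\<close>, \<open>x\<close>, both
  steps run along a regular pair and cannot be subdivided. The refined path therefore contains the
  same detour, and it cancels there too.\<close>

lemma ref_red:
  assumes "ref p q"
  shows "\<exists>q'. ref (red p) q' \<and> red q' = red q"
  using assms
proof (induction rule: ref.induct)
  case (single x)
  then show ?case by (auto intro: ref.single)
next
  case (Cons x m y p q)
  obtain q' where q': "ref (red (y # p)) q'" "red q' = red (y # q)"
    using Cons.IH by auto
  obtain s where s: "red (y # p) = y # s" by (rule red_Cons)
  obtain s' where s': "q' = y # s'"
    using ref_Cons_hd q'(1) s by metis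
  have eq: "red (x # m @ y # s') = red (x # m @ y # q)"
    using red_append_cong[OF q'(2), of "x # m"] s' by simp
  show ?case
  proof (cases "\<exists>t. s = x # t")
    case True
    then obtain t where t: "s = x # t" by auto
    have "ref (y # x # t) (y # s')"
      using q'(1) s s' t by simp
    then obtain m1 r where r: "s' = m1 @ x # r" "mid y m1 x" "ref (x # t) (x # r)"
      by (auto elim!: ref_ConsE)
    have "pr x y \<or> pr y x"
      using mid_step[OF r(2)] mid_step[OF Cons.hyps(1)] step_back by blast
    then have "m = []" "m1 = []"
      using mid_pr Cons.hyps(1) r(2) by auto
    then have "red (x # r) = red (x # m @ y # q)"
      using eq r(1) by (simp only: append_Nil red_cancel)
    moreover have "red (x # y # p) = x # t"
      using s t by simp
    ultimately show ?thesis
      using r(3) by auto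
  next
    case False
    then have "red (x # y # p) = x # y # s"
      using s by (cases s) auto
    moreover have "ref (x # y # s) (x # m @ y # s')"
      using q'(1) s s' Cons.hyps(1) by (auto intro: ref.Cons)
    ultimately show ?thesis
      using eq by auto
  qed
qed

text \<open>The detours removed by reduction are put back, unsubdivided, into the refinement of the
  reduced word, where they cancel again.\<close>

lemma ref_lift:
  assumes "path p" "ref (red p) q'"
  shows "\<exists>q. ref p q \<and> red q = red q'"
  using assms
proof (induction p arbitrary: q' rule: induct_list012)
  case (2 x)
  then show ?case by auto
next
  case (3 x y p)
  have st: "step x y" and pp: "path (y # p)"
    using 3(3) by (auto simp: path_Cons)
  obtain s where s: "red (y # p) = y # s" by (rule red_Cons)
  show ?case
  proof (cases "\<exists>t. s = x # t")
    case True
    then obtain t where t: "s = x # t" by auto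
    have rt: "ref (x # t) q'"
      using 3(4) s t by simp
    then obtain r where r: "q' = x # r" using ref_Cons_hd by blast
    have "step y x"
      using path_red[OF pp] s t by (simp add: path_Cons)
    then have "ref (y # x # t) (y # x # r)"
      using ref.Cons[of y "[]" x t r] rt r by (simp add: mid_Nil)
    then obtain q where q: "ref (y # p) q" "red q = red (y # x # r)"
      using 3(2)[OF pp] s t by metis
    obtain q0 where q0: "q = y # q0" using ref_Cons_hd q(1) by blast
    have "ref (x # y # p) (x # q)"
      using ref.Cons[of x "[]" y p q0] q(1) q0 st by (simp add: mid_Nil)
    moreover have "red (x # q) = red (x # r)"
      using red_Cons_cong[OF q(2), of x] by (simp only: red_cancel)
    ultimately show ?thesis using r by blast
  next
    case False
    then have "red (x # y # p) = x # y # s"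
      using s by (cases s) auto
    then obtain m r where r: "q' = x # m @ y # r" "mid x m y" "ref (y # s) (y # r)"
      using 3(4) ref_ConsE by metis
    obtain q where q: "ref (y # p) q" "red q = red (y # r)"
      using 3(2)[OF pp] s r(3) by metis
    obtain q0 where q0: "q = y # q0" using ref_Cons_hd q(1) by blast
    have "ref (x # y # p) (x # m @ q)"
      using ref.Cons[OF r(2)] q(1) q0 by simp
    moreover have "red (x # m @ q) = red q'"
      using red_append_cong[OF q(2), of "x # m"] r(1) by simp
    ultimately show ?thesis by blast
  qed
qed (simp add: path_def)

text \<open>
  Two consecutive up steps are impossible, so free reduction cannot reach the first step of a
  descending chain of length at least two.
\<close>

lemma red_dn_dn:
  assumes "dn x a" "dn a e" "path (e # p)"
  obtains s where "red (x # a # e # p) = x # a # s"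
proof -
  obtain t where t: "red (e # p) = e # t" by (rule red_Cons)
  have pt: "path (e # t)"
    using path_red[OF assms(3)] t by simp
  have "\<exists>u. red (a # e # p) = a # u \<and> (\<forall>u'. u \<noteq> x # u')"
  proof (cases "\<exists>u. t = a # u")
    case True
    then obtain u where u: "t = a # u" by auto
    have "u \<noteq> x # u'" for u'
    proof
      assume "u = x # u'"
      then have "step e a" "step a x"
        using pt u by (auto simp: path_Cons)
      then have "pr e a" "pr a x"
        using assms(1,2) by (auto simp: step_def dn_def)
      then show False using pr_pr by blast
    qed
    then show ?thesis using t u by auto
  next
    case False
    have "e \<noteq> x"
      using assms dn_irrefl dn_trans by blast
    moreover have "red (a # e # p) = a # e # t"
      using False t by (cases t) auto
    ultimately show ?thesis by auto
  qed
  then obtain u where u: "red (a # e # p) = a # u" "\<forall>u'. u \<noteq> x # u'" by auto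
  then have "red (x # a # e # p) = x # a # u"
    by (cases u) auto
  then show ?thesis by (rule that)
qed

text \<open>The first cell after \<open>x\<close> can be read off from the reduced word. Only an
  unsubdivided step down along a regular pair could be cancelled by what follows, and this is
  excluded.\<close>

lemma red_mid_first:
  assumes "sorted_wrt dn (x # m @ [y])" "path (y # p)" "m \<noteq> [] \<or> \<not> pr y x"
  obtains s where "red (x # m @ y # p) = x # hd (m @ [y]) # s"
proof (cases m)
  case Nil
  obtain t where t: "red (y # p) = y # t" by (rule red_Cons)
  have "t \<noteq> x # t'" for t'
  proof
    assume "t = x # t'"
    then have "step y x"
      using path_red[OF assms(2)] t by (simp add: path_Cons)
    then show False
      using assms(1,3) Nil by (auto simp: step_def dn_def)
  qed
  then have "red (x # y # p) = x # y # t"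
    using t by (cases t) auto
  then show ?thesis
    using that Nil by simp
next
  case (Cons a m')
  show ?thesis
  proof (cases m')
    case Nil
    then show ?thesis
      using red_dn_dn[of x a y p] assms Cons that by auto
  next
    case m': (Cons e m'')
    have "mid e m'' y"
      using assms(1) Cons m' by (auto simp: mid_def)
    then have "path (e # m'' @ y # p)"
      using mid_path assms(2) by blast
    then show ?thesis
      using red_dn_dn[of x a e "m'' @ y # p"] assms Cons m' that by auto
  qed
qed

text \<open>Reads the inserted chain off the reduced word cell by cell: the first cells agree, the
  common first step is cancelled on the left, and the rest follows by induction.\<close>

lemma red_mid_inj:
  assumes "sorted_wrt dn (x # m @ [y])" "sorted_wrt dn (x # m' @ [y])" "path (y # p)" "path (y # p')"
    "red (x # m @ y # p) = red (x # m' @ y # p')"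
  shows "m = m' \<and> red (y # p) = red (y # p')"
  using assms
proof (induction m arbitrary: x m')
  case Nil
  show ?case
  proof (cases m')
    case Nil
    then show ?thesis
      using Nil.prems red_left_cancel by auto
  next
    case (Cons a m1)
    have "dn x a" "dn a y"
      using Nil.prems(2) Cons by auto
    \<comment> \<open>A cell strictly between rules out a regular pair, so the unsubdivided side
      keeps its first step as well and the two first cells can be compared.\<close>
    then have npr: "\<not> pr y x"
      using pr_no_between by blast
    obtain s where s: "red (x # [] @ y # p) = x # y # s"
      using red_mid_first[OF Nil.prems(1,3)] npr by auto
    obtain s' where s': "red (x # m' @ y # p') = x # a # s'"
      using red_mid_first[OF Nil.prems(2,4)] Cons by auto
    have "a = y"
      using s s' Nil.prems(5) by simp
    then show ?thesis
      using \<open>dn a y\<close> dn_irrefl by blast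
  qed
next
  case (Cons a m)
  have a: "dn x a" "dn a y"
    using Cons.prems(1) by auto
  then have npr: "\<not> pr y x"
    using pr_no_between by blast
  obtain s where s: "red (x # (a # m) @ y # p) = x # a # s"
    using red_mid_first[OF Cons.prems(1,3)] by auto
  obtain s' where s': "red (x # m' @ y # p') = x # hd (m' @ [y]) # s'"
    using red_mid_first[OF Cons.prems(2,4)] npr by auto
  have ha: "hd (m' @ [y]) = a"
    using s s' Cons.prems(5) by simp
  show ?case
  proof (cases m')
    case Nil
    then show ?thesis
      using ha a dn_irrefl by auto
  next
    case m': (Cons b m1)
    then have b: "b = a" using ha by simp
    have "red (a # m @ y # p) = red (a # m1 @ y # p')"
      using Cons.prems(5) m' b red_left_cancel by (metis append_Cons)
    then have "m = m1 \<and> red (y # p) = red (y # p')"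
      using Cons.IH[of a m1] Cons.prems m' b by auto
    then show ?thesis using m' b by simp
  qed
qed

lemma ref_inj:
  assumes "ref p q" "ref p q'" "red q = red q'"
  shows "q = q'"
  using assms
proof (induction arbitrary: q' rule: ref.induct)
  case (single x)
  then show ?case by (simp add: ref_single_iff)
next
  case (Cons x m y p q)
  obtain m' r where r: "q' = x # m' @ y # r" "mid x m' y" "ref (y # p) (y # r)"
    using Cons.prems(1) ref_ConsE by metis
  have paths: "path (y # q)" "path (y # r)"
    using ref_path2 Cons.hyps(2) r(3) by auto
  have "m = m' \<and> red (y # q) = red (y # r)"
  proof (cases "dn x y")
    case True
    then show ?thesis
      using red_mid_inj[of x m y m' q r] mid_dn Cons.hyps(1) r paths Cons.prems(2) by metis
  next
    case False
    then have "m = []" "m' = []"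
      using Cons.hyps(1) r(2) by (auto simp: mid_def)
    then show ?thesis
      using Cons.prems(2) r(1) red_left_cancel[of x y q r] by simp
  qed
  then show ?case
    using Cons.IH[of "y # r"] r by auto
qed

text \<open>The order of the opposite poset: refined words are smaller, so \<open>b\<close> is the
  greatest element of the set of words obtained from it.\<close>

definition leq :: "'c list \<Rightarrow> 'c list \<Rightarrow> bool"
  where "leq a b \<longleftrightarrow> (\<exists>q. ref b q \<and> red q = a)"

text \<open>A refinement of \<open>red q'\<close> lifts to one of \<open>q'\<close>, hence of
  \<open>b\<close>; having the same reduction as \<open>q\<close>, it equals \<open>q\<close> by
  injectivity over \<open>b\<close>.\<close>

lemma leq_red_iff:
  assumes "ref b q" "ref b q'"
  shows "leq (red q) (red q') \<longleftrightarrow> ref q' q"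
proof
  assume "leq (red q) (red q')"
  then obtain r where "ref (red q') r" "red r = red q"
    by (auto simp: leq_def)
  then obtain r' where r': "ref q' r'" "red r' = red q"
    using ref_lift ref_path2[OF assms(2)] by metis
  then have "r' = q"
    using ref_inj ref_trans[OF assms(2)] assms(1) by blast
  then show "ref q' q" using r' by simp
next
  assume "ref q' q"
  then show "leq (red q) (red q')"
    using ref_red[of q' q] by (auto simp: leq_def)
qed

lemma leq_refl: "path a \<Longrightarrow> reduced a \<Longrightarrow> leq a a"
  using ref_refl red_reduced by (auto simp: leq_def)

lemma leq_trans:
  assumes "leq a b" "leq b c"
  shows "leq a c"
proof -
  obtain q where q: "ref c q" "red q = b"
    using assms(2) by (auto simp: leq_def)
  obtain r where r: "ref b r" "red r = a"
    using assms(1) by (auto simp: leq_def)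
  obtain r' where "ref q r'" "red r' = a"
    using ref_lift[of q r] ref_path2[OF q(1)] q(2) r by auto
  then show ?thesis
    using ref_trans[OF q(1)] by (auto simp: leq_def)
qed

end

section \<open>Chains inserted into a path\<close>

lemma all_nat_0_Suc: "(\<forall>j. P j) \<longleftrightarrow> P 0 \<and> (\<forall>j. P (Suc j))"
  by (metis not0_implies_Suc)

text \<open>Cells to be inserted are indexed by the position of their step; dropping the first step
  lowers the positions by one, so that such families follow induction on the path.\<close>

definition shift :: "(nat \<times> 'k) set \<Rightarrow> (nat \<times> 'k) set"
  where "shift Q = {(j, c). (Suc j, c) \<in> Q}"

definition unshift :: "'k set \<Rightarrow> (nat \<times> 'k) set \<Rightarrow> (nat \<times> 'k) set"
  where "unshift S Q = Pair 0 ` S \<union> map_prod Suc id ` Q"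

lemma unshift: "(0, c) \<in> unshift S Q \<longleftrightarrow> c \<in> S" "(Suc j, c) \<in> unshift S Q \<longleftrightarrow> (j, c) \<in> Q"
  "shift (unshift S Q) = Q"
  by (force simp: unshift_def shift_def)+

lemma subset_shift:
  "Q \<subseteq> Q' \<longleftrightarrow> {c. (0, c) \<in> Q} \<subseteq> {c. (0, c) \<in> Q'} \<and> shift Q \<subseteq> shift Q'"
proof
  assume *: "{c. (0, c) \<in> Q} \<subseteq> {c. (0, c) \<in> Q'} \<and> shift Q \<subseteq> shift Q'"
  have "(j, c) \<in> Q'" if "(j, c) \<in> Q" for j c
    using * that by (cases j) (auto simp: shift_def)
  then show "Q \<subseteq> Q'" by auto
qed (auto simp: shift_def)

lemma unshift_shift:
  fixes Q :: "(nat \<times> 'k) set"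
  shows "unshift {c. (0, c) \<in> Q} (shift Q) = Q"
proof (rule set_eqI)
  fix u :: "nat \<times> 'k"
  obtain j c where u: "u = (j, c)" by (cases u)
  show "u \<in> unshift {c. (0, c) \<in> Q} (shift Q) \<longleftrightarrow> u \<in> Q"
    unfolding u by (cases j) (auto simp: unshift shift_def)
qed

context paired_complex
begin

definition chain_set :: "'c set \<Rightarrow> bool"
  where "chain_set S \<longleftrightarrow> S \<subseteq> V \<and> (\<forall>c\<in>S. \<forall>c'\<in>S. c = c' \<or> dn c c' \<or> dn c' c)"

lemma chain_set_vt: "chain_set S \<Longrightarrow> c \<in> S \<Longrightarrow> c' \<in> S \<Longrightarrow> vt c \<subseteq> vt c' \<or> vt c' \<subseteq> vt c"
proof -
  assume "chain_set S" "c \<in> S" "c' \<in> S"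
  then have "c = c' \<or> dn c c' \<or> dn c' c" by (simp add: chain_set_def)
  then show ?thesis by (auto simp: dn_def)
qed

lemma chain_set_mono: "chain_set S \<Longrightarrow> T \<subseteq> S \<Longrightarrow> chain_set T"
  unfolding chain_set_def by (simp add: subset_iff)

lemma chain_set_list: "chain_set S \<Longrightarrow> \<exists>l. sorted_wrt dn l \<and> set l = S"
proof (induction "card S" arbitrary: S rule: less_induct)
  case less
  have fin: "finite S"
    using less.prems finite_V finite_subset by (auto simp: chain_set_def)
  show ?case
  proof (cases "S = {}")
    case False
    obtain m where m: "m \<in> S" "\<And>c. c \<in> S \<Longrightarrow> vt c \<subseteq> vt m"
      by (rule finite_chain_has_top[OF fin False chain_set_vt[OF less.prems]]) auto
    have "card (S - {m}) < card S"
      using fin m(1) by (meson card_Diff1_less)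
    moreover have "chain_set (S - {m})"
      using less.prems by (auto simp: chain_set_def)
    ultimately obtain l where l: "sorted_wrt dn l" "set l = S - {m}"
      using less.hyps by metis
    have "dn m c" if "c \<in> S - {m}" for c
    proof -
      have "m = c \<or> dn m c \<or> dn c m"
        using that m(1) less.prems by (simp add: chain_set_def)
      then show ?thesis
        using that m(2)[of c] by (auto simp: dn_def)
    qed
    then have "sorted_wrt dn (m # l)" "set (m # l) = S"
      using l m(1) by auto
    then show ?thesis by blast
  qed auto
qed

definition desc :: "'c set \<Rightarrow> 'c list"
  where "desc S = (SOME l. sorted_wrt dn l \<and> set l = S)"

lemma desc: "chain_set S \<Longrightarrow> sorted_wrt dn (desc S) \<and> set (desc S) = S"
  unfolding desc_def by (rule someI_ex) (rule chain_set_list)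

lemma desc_empty: "desc {} = []"
  using desc[of "{}"] by (simp add: chain_set_def)

lemma sorted_dn_unique:
  "sorted_wrt dn l \<Longrightarrow> sorted_wrt dn l' \<Longrightarrow> set l = set l' \<Longrightarrow> l = l'"
proof (induction l arbitrary: l')
  case (Cons x l)
  obtain x' l1 where l': "l' = x' # l1"
    using Cons.prems(3) by (cases l') auto
  have "x = x'"
  proof (rule ccontr)
    assume "x \<noteq> x'"
    then have "x' \<in> set l" "x \<in> set l1"
      using Cons.prems(3) l' by auto
    then have "dn x x'" "dn x' x"
      using Cons.prems l' by auto
    then show False
      using dn_irrefl dn_trans by blast
  qed
  moreover have "x \<notin> set l" "x' \<notin> set l1"
    using Cons.prems l' dn_irrefl by auto
  ultimately have "set l = set l1"
    using Cons.prems(3) l' by auto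
  then show ?case
    using Cons.IH[of l1] Cons.prems l' \<open>x = x'\<close> by simp
qed simp

text \<open>The rays of the product fan. The tag \<open>j\<close> turns a family of sets, one for
  each step, into a single set.\<close>

definition gaps :: "'c list \<Rightarrow> (nat \<times> 'c) set"
  where "gaps p = {(j, c). Suc j < length p \<and> dn (p ! j) c \<and> dn c (p ! Suc j)}"

text \<open>The cones of the product fan. Up steps have empty gaps and so contribute
  nothing.\<close>

definition gap_chains :: "'c list \<Rightarrow> (nat \<times> 'c) set set"
  where "gap_chains p = {Q. Q \<subseteq> gaps p \<and> (\<forall>j. chain_set {c. (j, c) \<in> Q})}"

lemma gaps_Cons:
  "(0, c) \<in> gaps (x # y # p) \<longleftrightarrow> dn x c \<and> dn c y"
  "(Suc j, c) \<in> gaps (x # y # p) \<longleftrightarrow> (j, c) \<in> gaps (y # p)"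
  by (auto simp: gaps_def)

lemma gap_chains_single: "gap_chains [x] = {{}}"
  by (auto simp: gap_chains_def gaps_def chain_set_def)

lemma gap_chains_Cons:
  "Q \<in> gap_chains (x # y # p) \<longleftrightarrow>
    chain_set {c. (0, c) \<in> Q} \<and> (\<forall>c. (0, c) \<in> Q \<longrightarrow> dn x c \<and> dn c y) \<and> shift Q \<in> gap_chains (y # p)"
proof -
  have "Q \<subseteq> gaps (x # y # p) \<longleftrightarrow> (\<forall>c. (0, c) \<in> Q \<longrightarrow> dn x c \<and> dn c y) \<and> shift Q \<subseteq> gaps (y # p)"
    unfolding subset_shift[of Q] by (auto simp: shift_def gaps_Cons subset_iff)
  moreover have "(\<forall>j. chain_set {c. (j, c) \<in> Q}) \<longleftrightarrow>
      chain_set {c. (0, c) \<in> Q} \<and> (\<forall>j. chain_set {c. (j, c) \<in> shift Q})"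
    using all_nat_0_Suc[of "\<lambda>j. chain_set {c. (j, c) \<in> Q}"] by (simp add: shift_def)
  ultimately show ?thesis
    unfolding gap_chains_def by auto
qed

fun fill :: "'c list \<Rightarrow> (nat \<times> 'c) set \<Rightarrow> 'c list"
  where
    "fill (x # y # p) Q = x # desc {c. (0, c) \<in> Q} @ fill (y # p) (shift Q)"
  | "fill p Q = p"

lemma fill_hd: "\<exists>r. fill (x # p) Q = x # r"
  by (cases p) auto

lemma mid_desc:
  assumes "step x y" "chain_set S" "\<And>c. c \<in> S \<Longrightarrow> dn x c \<and> dn c y"
  shows "mid x (desc S) y"
proof (cases "S = {}")
  case True
  then show ?thesis using assms(1) by (simp add: desc_empty mid_Nil)
next
  case False
  then have "dn x y"
    using assms(3) dn_trans by blast
  then show ?thesis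
    using desc[OF assms(2)] assms(3) by (auto simp: mid_def sorted_wrt_append)
qed

lemma ref_fill: "path p \<Longrightarrow> Q \<in> gap_chains p \<Longrightarrow> ref p (fill p Q)"
proof (induction p arbitrary: Q rule: induct_list012)
  case (3 x y p)
  obtain r where r: "fill (y # p) (shift Q) = y # r"
    using fill_hd by blast
  have "ref (y # p) (y # r)"
    using 3(2)[of "shift Q"] 3(3,4) r by (simp add: path_Cons gap_chains_Cons)
  moreover have "mid x (desc {c. (0, c) \<in> Q}) y"
    using 3 by (intro mid_desc) (auto simp: path_Cons gap_chains_Cons)
  ultimately show ?case
    using r ref.Cons by simp
qed (simp_all add: path_def ref.single)

lemma chain_set_sorted: "sorted_wrt dn l \<Longrightarrow> set l \<subseteq> V \<Longrightarrow> chain_set (set l)"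
proof (induction l)
  case (Cons x l)
  then show ?case by (auto simp: chain_set_def)
qed (simp add: chain_set_def)

lemma mid_chain: "mid x m y \<Longrightarrow> chain_set (set m)"
  "mid x m y \<Longrightarrow> c \<in> set m \<Longrightarrow> dn x c \<and> dn c y"
proof -
  show *: "c \<in> set m \<Longrightarrow> dn x c \<and> dn c y" if "mid x m y" for c
    using that by (auto simp: mid_def sorted_wrt_append)
  show "chain_set (set m)" if "mid x m y"
  proof (rule chain_set_sorted)
    show "sorted_wrt dn m"
      using that by (auto simp: mid_def sorted_wrt_append)
    show "set m \<subseteq> V"
      using *[OF that] dn_V by blast
  qed
qed

lemma desc_mid: "mid x m y \<Longrightarrow> desc (set m) = m"
  using desc[OF mid_chain(1), of x m y]
  by (intro sorted_dn_unique) (auto simp: mid_def sorted_wrt_append)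

lemma fill_surj: "ref p q \<Longrightarrow> \<exists>Q\<in>gap_chains p. fill p Q = q"
proof (induction rule: ref.induct)
  case (single x)
  then show ?case by (simp add: gap_chains_single)
next
  case (Cons x m y p q)
  then obtain Q where Q: "Q \<in> gap_chains (y # p)" "fill (y # p) Q = y # q" by auto
  then show ?case
    using Cons.hyps(1) mid_chain[OF Cons.hyps(1)] desc_mid[OF Cons.hyps(1)]
    by (intro bexI[of _ "unshift (set m) Q"]) (auto simp: gap_chains_Cons unshift)
qed

lemma mid_split:
  assumes "mid x m y" "mid x m' y" "m @ y # r = m' @ y # r'"
  shows "m = m' \<and> r = r'"
proof -
  have "y \<notin> set m" "y \<notin> set m'"
    using mid_chain(2) assms(1,2) dn_irrefl by blast+
  then show ?thesis
    using assms(3)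
  proof (induction m arbitrary: m')
    case Nil
    then show ?case by (cases m') auto
  next
    case (Cons a m)
    then show ?case by (cases m') auto
  qed
qed

text \<open>The cells of \<open>m'\<close> before the first cell \<open>a\<close> of
  \<open>m\<close> subdivide the step from \<open>x\<close> to \<open>a\<close>; those after it
  contain the rest of \<open>m\<close>, and induction applies.\<close>

lemma ref_chain:
  assumes "sorted_wrt dn (x # m @ [y])" "sorted_wrt dn (x # m' @ [y])" "set m \<subseteq> set m'"
    "ref (y # q) (y # q')"
  shows "ref (x # m @ y # q) (x # m' @ y # q')"
  using assms
proof (induction m arbitrary: x m')
  case Nil
  then show ?case
    by (auto simp: mid_def intro: ref.Cons)
next
  case (Cons a m)
  then obtain u v where uv: "m' = u @ a # v"
    by (meson list.set_intros(1) split_list subsetD)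
  have "c \<in> set v" if "c \<in> set m" for c
  proof -
    have "dn a c" using that Cons.prems(1) by auto
    moreover have "dn c a" if "c \<in> set u"
      using that Cons.prems(2) uv by (auto simp: sorted_wrt_append)
    ultimately show ?thesis
      using that Cons.prems(3) uv dn_irrefl dn_trans by auto blast
  qed
  then have "ref (a # m @ y # q) (a # v @ y # q')"
    using Cons.prems uv by (intro Cons.IH) (auto simp: sorted_wrt_append)
  moreover have "mid x u a"
    using Cons.prems(2) uv by (auto simp: mid_def sorted_wrt_append)
  ultimately show ?case
    using uv ref.Cons[of x u a "m @ y # q" "v @ y # q'"] by simp
qed

text \<open>Works step by step: \<open>ref_mid\<close> extracts the inclusion of the inserted chains
  from a refinement, and \<open>ref_chain\<close> gives the converse for down steps. On up steps
  both chains are empty.\<close>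

lemma ref_fill_iff:
  assumes "path p" "Q \<in> gap_chains p" "Q' \<in> gap_chains p"
  shows "ref (fill p Q) (fill p Q') \<longleftrightarrow> Q \<subseteq> Q'"
  using assms
proof (induction p arbitrary: Q Q' rule: induct_list012)
  case (2 x)
  then show ?case by (auto simp: gap_chains_single ref_single_iff path_single)
next
  case (3 x y p)
  let ?S = "{c. (0, c) \<in> Q}" and ?S' = "{c. (0, c) \<in> Q'}"
  obtain r where r: "fill (y # p) (shift Q) = y # r"
    using fill_hd by blast
  obtain r' where r': "fill (y # p) (shift Q') = y # r'"
    using fill_hd by blast
  have m: "mid x (desc ?S) y" "mid x (desc ?S') y"
    using 3 by (auto simp: path_Cons gap_chains_Cons intro!: mid_desc)
  have d: "set (desc ?S) = ?S" "set (desc ?S') = ?S'"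
    using 3 desc by (auto simp: gap_chains_Cons)
  have IH: "ref (y # r) (y # r') \<longleftrightarrow> shift Q \<subseteq> shift Q'"
    using 3 r r' by (metis gap_chains_Cons path_Cons)
  have "ref (x # desc ?S @ y # r) (x # desc ?S' @ y # r') \<longleftrightarrow> ?S \<subseteq> ?S' \<and> ref (y # r) (y # r')"
  proof
    assume "ref (x # desc ?S @ y # r) (x # desc ?S' @ y # r')"
    then obtain m1 r1 where "x # desc ?S' @ y # r' = x # m1 @ y # r1" "mid x m1 y"
      "set (desc ?S) \<subseteq> set m1" "ref (y # r) (y # r1)"
      by (rule ref_mid[OF m(1)])
    then show "?S \<subseteq> ?S' \<and> ref (y # r) (y # r')"
      using mid_split[OF m(2), of m1 r' r1] d by auto
  next
    assume a: "?S \<subseteq> ?S' \<and> ref (y # r) (y # r')"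
    show "ref (x # desc ?S @ y # r) (x # desc ?S' @ y # r')"
    proof (cases "dn x y")
      case True
      show ?thesis
        by (rule ref_chain[OF mid_dn[OF m(1) True] mid_dn[OF m(2) True]]) (use a d in simp_all)
    next
      case False
      then have "desc ?S = []" "desc ?S' = []"
        using m by (auto simp: mid_def)
      then show ?thesis
        using a m ref.Cons by fastforce
    qed
  qed
  then show ?case
    using r r' IH subset_shift[of Q Q'] by simp
qed (simp add: path_def)

text \<open>
  The dimension of the cell of a path: a down step of codimension \<open>n\<close> contributes \<open>n - 1\<close>, and an
  up step contributes 0 by truncated subtraction.
\<close>

fun exc :: "'c list \<Rightarrow> nat"
  where
    "exc (x # y # p) = (card (vt x - vt y) - 1) + exc (y # p)"
  | "exc _ = 0"

lemma card_step_back: "pr x y \<or> pr y x \<Longrightarrow> card (vt x - vt y) - 1 = 0"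
proof (elim disjE)
  assume "pr y x"
  then have "card (vt x - vt y) = 1"
    using pr[of y x] finite_vt by (simp add: card_Diff_subset psubset_imp_subset)
  then show ?thesis by simp
next
  assume "pr x y"
  then have "vt x - vt y = {}" using pr[of x y] by auto
  then show ?thesis by (simp only: card.empty diff_0_eq_0)
qed

text \<open>Cancelled steps run along regular pairs, and these contribute 0 in both
  directions.\<close>

lemma exc_red: "path p \<Longrightarrow> exc (red p) = exc p"
proof (induction p rule: induct_list012)
  case (3 x y p)
  have st: "step x y" and pp: "path (y # p)"
    using 3(3) by (auto simp: path_Cons)
  obtain s where s: "red (y # p) = y # s" by (rule red_Cons)
  have IH: "exc (y # s) = exc (y # p)"
    using 3(2)[OF pp] s by simp
  show ?case
  proof (cases "\<exists>t. s = x # t")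
    case True
    then obtain t where t: "s = x # t" by auto
    have "step y x"
      using path_red[OF pp] s t by (simp add: path_Cons)
    then have p: "pr x y \<or> pr y x"
      using st step_back by blast
    have "red (x # y # p) = x # t"
      using s t by simp
    then show ?thesis
      using IH t card_step_back[OF p] card_step_back[of y x] p by auto
  next
    case False
    then have "red (x # y # p) = x # y # s"
      using s by (cases s) auto
    then show ?thesis using IH by simp
  qed
qed simp_all

text \<open>Codimension is additive along the chain, but each of the \<open>length m + 1\<close>
  pieces gives up one instead of the whole step giving up one, so the dimension drops by exactly the
  number of inserted cells.\<close>

lemma exc_chain:
  "sorted_wrt dn (x # m @ [y]) \<Longrightarrow>
    exc (x # m @ y # r) + length m = (card (vt x - vt y) - 1) + exc (y # r)"
proof (induction m arbitrary: x)
  case (Cons a m)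
  then have d: "dn x a" "dn a y" by auto
  have fin: "finite (vt x)" using d finite_vt dn_V by blast
  have "vt x - vt y = (vt x - vt a) \<union> (vt a - vt y)" "(vt x - vt a) \<inter> (vt a - vt y) = {}"
    using d by (auto simp: dn_def)
  then have "card (vt x - vt y) = card (vt x - vt a) + card (vt a - vt y)"
    using fin d by (metis card_Un_disjoint finite_Diff finite_vt dn_V(1))
  moreover have "card (vt x - vt a) > 0" "card (vt a - vt y) > 0"
    using d fin finite_vt by (auto simp: card_gt_0_iff dn_def)
  moreover have "exc (a # m @ y # r) + length m = (card (vt a - vt y) - 1) + exc (y # r)"
    using Cons.prems by (intro Cons.IH) simp
  ultimately show ?case by simp
qed simp

lemma exc_mid: "mid x m y \<Longrightarrow> exc (x # m @ y # r) + length m = (card (vt x - vt y) - 1) + exc (y # r)"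
  using exc_chain[of x m y r] by (auto simp: mid_def)

lemma exc_ref: "ref p q \<Longrightarrow> exc q \<le> exc p \<and> (exc q = exc p \<longrightarrow> q = p)"
proof (induction rule: ref.induct)
  case (Cons x m y p q)
  have "exc (x # m @ y # q) + length m = (card (vt x - vt y) - 1) + exc (y # q)"
    using Cons.hyps(1) by (rule exc_mid)
  then show ?case
    using Cons.IH by auto
qed simp

lemma exc_less:
  assumes "leq a b" "reduced b" "a \<noteq> b"
  shows "exc a < exc b"
proof -
  obtain q where q: "ref b q" "red q = a"
    using assms(1) by (auto simp: leq_def)
  have "q \<noteq> b"
    using q assms by (auto simp: red_reduced)
  then have "exc q < exc b"
    using exc_ref[OF q(1)] by auto
  then show ?thesis
    using exc_red[OF ref_path2[OF q(1)]] q(2) by simp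
qed

section \<open>Coordinates and braid fans of a path\<close>

definition base :: "'c list \<Rightarrow> nat \<Rightarrow> 'v"
  where "base p j = (SOME v. v \<in> vt (p ! j) - vt (p ! Suc j))"

text \<open>Functions on the vertices lost in a step, modulo constants, are normalized to vanish at
  the base vertex. Omitting that vertex leaves as many coordinates as the step contributes to
  \<open>exc\<close>.\<close>

definition coords :: "'c list \<Rightarrow> (nat \<times> 'v) set"
  where "coords p =
    {(j, v). Suc j < length p \<and> v \<in> vt (p ! j) - vt (p ! Suc j) \<and> v \<noteq> base p j}"

lemma base: "vt (p ! j) - vt (p ! Suc j) \<noteq> {} \<Longrightarrow> base p j \<in> vt (p ! j) - vt (p ! Suc j)"
  unfolding base_def by (rule someI_ex) blast

lemma card_coords: "path p \<Longrightarrow> finite (coords p) \<and> card (coords p) = exc p"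
proof (induction p rule: induct_list012)
  case (3 x y p)
  have V: "x \<in> V" and pp: "path (y # p)"
    using 3(3) by (auto simp: path_def successively_Cons)
  let ?U = "vt x - vt y - {base (x # y # p) 0}"
  have "{v. (0, v) \<in> coords (x # y # p)} = ?U" "shift (coords (x # y # p)) = coords (y # p)"
    by (auto simp: coords_def base_def shift_def)
  then have "coords (x # y # p) = Pair 0 ` ?U \<union> map_prod Suc id ` coords (y # p)"
    using unshift_shift[of "coords (x # y # p)"] by (simp add: unshift_def)
  moreover have "finite ?U" using finite_vt V by simp
  moreover have "card ?U = card (vt x - vt y) - 1"
  proof (cases "vt x - vt y = {}")
    case True
    then have "?U = {}" by blast
    then show ?thesis using True by (simp only: card.empty diff_0_eq_0)
  next
    case False
    then have "base (x # y # p) 0 \<in> vt x - vt y"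
      using base[of "x # y # p" 0] by simp
    then show ?thesis using finite_vt[OF V] by (simp only: card_Diff_singleton)
  qed
  moreover have "card (Pair (0::nat) ` ?U) = card ?U"
    by (rule card_image) (auto simp: inj_on_def)
  moreover have "card (map_prod Suc id ` coords (y # p)) = card (coords (y # p))"
    by (rule card_image) (auto simp: inj_on_def)
  moreover have "Pair 0 ` ?U \<inter> map_prod Suc id ` coords (y # p) = {}"
    by auto
  ultimately show ?case
    using 3(2)[OF pp] by (simp add: card_Un_disjoint)
qed (auto simp: coords_def)

definition between :: "'c \<Rightarrow> 'c \<Rightarrow> 'c set"
  where "between x y = {c. dn x c \<and> dn c y}"

lemma finite_between: "finite (between x y)"
  using finite_V by (rule finite_subset[rotated]) (auto simp: between_def dn_def)

text \<open>
  The braid fan of the Boolean interval between \<open>y\<close> and \<open>x\<close>: modulo constants, every function on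
  \<open>vt x - vt y\<close> is uniquely a nonnegative combination of the indicators of a chain.
\<close>

lemma braid_fan_exists:
  fixes g :: "'v \<Rightarrow> real"
  assumes "dn x y" "b \<in> vt x - vt y"
  obtains a where "\<And>c. 0 \<le> a c" "\<And>c. c \<notin> between x y \<Longrightarrow> a c = 0" "chain_set {c. a c \<noteq> 0}"
    "\<And>v. v \<in> vt x - vt y \<Longrightarrow>
      g v - g b = (\<Sum>c\<in>between x y. a c * (of_bool (v \<in> vt c) - of_bool (b \<in> vt c)))"
proof -
  let ?U = "vt x - vt y"
  have fin: "finite ?U" using assms finite_vt dn_V by blast
  \<comment> \<open>The free constant is used to make the minimum 0. Every layer then misses
    \<open>v0\<close>, so together with \<open>vt y\<close> it is the vertex set of a cell strictly
    between \<open>y\<close> and \<open>x\<close>.\<close>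
  define mn where "mn = Min (g ` ?U)"
  have mn: "mn \<le> g v" if "v \<in> ?U" for v
    using fin that by (simp add: mn_def)
  have "mn \<in> g ` ?U"
    unfolding mn_def using fin assms(2) by (intro Min_in) auto
  then obtain v0 where v0: "v0 \<in> ?U" "g v0 = mn" by auto
  define h where "h = (\<lambda>v. if v \<in> ?U then g v - mn else 0)"
  define N where "N = between x y"
  have img: "T \<in> (\<lambda>c. vt c - vt y) ` N" if T: "T \<subseteq> {v. h v \<noteq> 0}" "T \<noteq> {}" for T
  proof -
    have TU: "T \<subseteq> ?U" "v0 \<notin> T"
      using T(1) v0 by (auto simp: h_def split: if_splits)
    have "T \<union> vt y \<subseteq> vt x"
      using TU assms(1) by (auto simp: dn_def)
    then obtain c where c: "c \<in> V" "vt c = T \<union> vt y"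
      using vt_closed[of x "T \<union> vt y"] T(2) dn_V(1)[OF assms(1)] by auto
    then have "c \<in> N"
      using TU T(2) v0 assms(1) by (auto simp: N_def between_def dn_def)
    moreover have "T = vt c - vt y"
      using c TU by auto
    ultimately show ?thesis by blast
  qed
  have supp: "finite {v. h v \<noteq> 0}"
    using fin by (rule finite_subset[rotated]) (auto simp: h_def)
  have h0: "0 \<le> h v" for v
    using mn by (auto simp: h_def)
  have "finite N"
    by (simp add: N_def finite_between)
  from img obtain a where a: "\<And>k. 0 \<le> a k" "\<And>k. k \<notin> N \<Longrightarrow> a k = 0"
    "\<And>k. a k \<noteq> 0 \<Longrightarrow> vt k - vt y \<subseteq> {v. h v \<noteq> 0}"
    "\<And>k k'. a k \<noteq> 0 \<Longrightarrow> a k' \<noteq> 0 \<Longrightarrow> vt k - vt y \<subseteq> vt k' - vt y \<or> vt k' - vt y \<subseteq> vt k - vt y"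
    "\<And>v. h v = sum a {k \<in> N. v \<in> vt k - vt y}"
    by (rule layer_exists[OF \<open>finite N\<close> supp h0, of "\<lambda>c. vt c - vt y"]) (assumption | rule that)+
  have hv: "h v = (\<Sum>c\<in>N. a c * of_bool (v \<in> vt c))" if "v \<in> ?U" for v
  proof -
    have "{k \<in> N. v \<in> vt k - vt y} = {k \<in> N. v \<in> vt k}"
      using that by auto
    then show ?thesis
      using \<open>finite N\<close> by (simp add: a(5) sum.inter_filter of_bool_def if_distrib[of "(*) _"] cong: if_cong)
  qed
  have aN: "a c \<noteq> 0 \<Longrightarrow> c \<in> N" for c
    using a(2) by blast
  show ?thesis
  proof (rule that[of a])
    show "chain_set {c. a c \<noteq> 0}"
      unfolding chain_set_def
    proof (intro conjI ballI)
      show "{c. a c \<noteq> 0} \<subseteq> V"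
        using aN by (auto simp: N_def between_def dn_def)
      fix c c' assume "c \<in> {c. a c \<noteq> 0}" "c' \<in> {c. a c \<noteq> 0}"
      then have "vt c - vt y \<subseteq> vt c' - vt y \<or> vt c' - vt y \<subseteq> vt c - vt y" "c \<in> N" "c' \<in> N"
        using a(4) aN by auto
      then have "vt c \<subseteq> vt c' \<or> vt c' \<subseteq> vt c" "c \<in> V" "c' \<in> V"
        by (auto simp: N_def between_def dn_def)
      then show "c = c' \<or> dn c c' \<or> dn c' c"
        using inj_vt by (auto simp: dn_def psubset_eq dest: inj_onD)
    qed
    fix v assume v: "v \<in> ?U"
    have "g v - g b = h v - h b"
      using v assms(2) by (simp add: h_def)
    also have "\<dots> = (\<Sum>c\<in>N. a c * (of_bool (v \<in> vt c) - of_bool (b \<in> vt c)))"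
      using hv[OF v] hv[OF assms(2)] by (simp add: sum_subtractf right_diff_distrib)
    finally show "g v - g b = (\<Sum>c\<in>between x y. a c * (of_bool (v \<in> vt c) - of_bool (b \<in> vt c)))"
      by (simp add: N_def)
  qed (use a(1,2) in \<open>auto simp: N_def\<close>)
qed

text \<open>A chain of cells strictly below \<open>x\<close> misses some vertex of the difference,
  so each of the two combinations of indicators has minimum 0. This fixes the additive constant, and
  uniqueness of layers finishes.\<close>

lemma braid_fan_unique:
  fixes a a' :: "'c \<Rightarrow> real"
  assumes d: "dn x y" "b \<in> vt x - vt y"
    and a: "\<And>c. 0 \<le> a c" "chain_set {c \<in> between x y. a c \<noteq> 0}"
    and a': "\<And>c. 0 \<le> a' c" "chain_set {c \<in> between x y. a' c \<noteq> 0}"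
    and eq: "\<And>v. v \<in> vt x - vt y \<Longrightarrow>
      (\<Sum>c\<in>between x y. a c * (of_bool (v \<in> vt c) - of_bool (b \<in> vt c))) =
      (\<Sum>c\<in>between x y. a' c * (of_bool (v \<in> vt c) - of_bool (b \<in> vt c)))"
    and c: "c \<in> between x y"
  shows "a c = a' c"
proof -
  let ?U = "vt x - vt y"
  define N where "N = between x y"
  have finN: "finite N" by (simp add: N_def finite_between)
  define h where "h a v = sum a {k \<in> N. v \<in> vt k - vt y}" for a :: "'c \<Rightarrow> real" and v
  have hv: "h a v = (\<Sum>c\<in>N. a c * of_bool (v \<in> vt c))" if "v \<in> ?U" for v a
  proof -
    have "{k \<in> N. v \<in> vt k - vt y} = {k \<in> N. v \<in> vt k}"
      using that by auto
    then show ?thesis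
      using finN by (simp add: h_def sum.inter_filter of_bool_def if_distrib[of "(*) _"] cong: if_cong)
  qed
  have diff: "h a v - h a b = h a' v - h a' b" if "v \<in> ?U" for v
    using eq[OF that] hv[OF that] hv[OF d(2)] by (simp add: N_def sum_subtractf right_diff_distrib)
  have zero: "\<exists>v\<in>?U. h a v = 0" if ch: "chain_set {c \<in> between x y. a c \<noteq> 0}" for a :: "'c \<Rightarrow> real"
  proof (cases "{c \<in> N. a c \<noteq> 0} = {}")
    case True
    then have "h a b = 0"
      unfolding h_def by (intro sum.neutral) auto
    then show ?thesis using d(2) by blast
  next
    case False
    have fin: "finite {c \<in> N. a c \<noteq> 0}" using finN by simp
    obtain m where m: "m \<in> {c \<in> N. a c \<noteq> 0}" "\<And>c. c \<in> {c \<in> N. a c \<noteq> 0} \<Longrightarrow> vt c \<subseteq> vt m"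
      by (rule finite_chain_has_top[OF fin False chain_set_vt[OF ch[folded N_def]]]) auto
    then have "dn x m" "dn m y" by (auto simp: N_def between_def)
    then obtain v where v: "v \<in> vt x" "v \<notin> vt m" "v \<notin> vt y"
      by (auto simp: dn_def)
    have "h a v = 0"
      unfolding h_def using m(2) v by (intro sum.neutral) auto
    then show ?thesis using v by blast
  qed
  have nonneg: "0 \<le> h a v" if "\<And>c. 0 \<le> a c" for v a
    unfolding h_def using that by (intro sum_nonneg)
  obtain v1 where v1: "v1 \<in> ?U" "h a v1 = 0" using zero[OF a(2)] by blast
  obtain v2 where v2: "v2 \<in> ?U" "h a' v2 = 0" using zero[OF a'(2)] by blast
  have "h a b = h a' b"
    using diff[OF v1(1)] diff[OF v2(1)] v1(2) v2(2) nonneg[of a v2] nonneg[of a' v1] a(1) a'(1)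
    by simp
  then have heq: "h a v = h a' v" for v
  proof (cases "v \<in> ?U")
    case True
    then show ?thesis using diff \<open>h a b = h a' b\<close> by force
  next
    case False
    then have "{k \<in> N. v \<in> vt k - vt y} = {}"
      by (auto simp: N_def between_def dn_def)
    then show ?thesis unfolding h_def by (simp only: sum.empty)
  qed
  show ?thesis
  proof (rule layer_unique[of N "\<lambda>c. vt c - vt y"])
    show "inj_on (\<lambda>c. vt c - vt y) N"
    proof (rule inj_onI)
      fix k k' assume k: "k \<in> N" "k' \<in> N" "vt k - vt y = vt k' - vt y"
      then have "vt y \<subseteq> vt k" "vt y \<subseteq> vt k'" "k \<in> V" "k' \<in> V"
        by (auto simp: N_def between_def dn_def)
      then have "vt k = vt k'" using k(3) by auto
      then show "k = k'"
        using \<open>k \<in> V\<close> \<open>k' \<in> V\<close> inj_vt by (auto dest: inj_onD)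
    qed
    show "vt k - vt y \<noteq> {}" if "k \<in> N" for k
      using that by (auto simp: N_def between_def dn_def)
    show "vt k - vt y \<subseteq> vt k' - vt y \<or> vt k' - vt y \<subseteq> vt k - vt y"
      if "k \<in> N" "k' \<in> N" "a k \<noteq> 0" "a k' \<noteq> 0" for k k'
      using that chain_set_vt[OF a(2), of k k'] by (auto simp: N_def)
    show "vt k - vt y \<subseteq> vt k' - vt y \<or> vt k' - vt y \<subseteq> vt k - vt y"
      if "k \<in> N" "k' \<in> N" "a' k \<noteq> 0" "a' k' \<noteq> 0" for k k'
      using that chain_set_vt[OF a'(2), of k k'] by (auto simp: N_def)
    show "sum a {k \<in> N. v \<in> vt k - vt y} = sum a' {k \<in> N. v \<in> vt k - vt y}" for v
      using heq[of v] by (simp add: h_def)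
  qed (use finN a(1) a'(1) c in \<open>auto simp: N_def\<close>)
qed

text \<open>The indicator of the cell modulo constants, as a vector that is 0 outside the block of
  coordinates of its own step.\<close>

definition ray :: "'c list \<Rightarrow> nat \<times> 'c \<Rightarrow> nat \<times> 'v \<Rightarrow> real"
  where "ray p = (\<lambda>(i, c) (j, v).
    if i = j then of_bool (v \<in> vt c) - of_bool (base p j \<in> vt c) else 0)"

lemma finite_gaps: "finite (gaps p)"
proof (rule finite_subset)
  show "gaps p \<subseteq> {..<length p} \<times> V"
    by (auto simp: gaps_def dn_def)
qed (use finite_V in simp)

lemma sum_ray:
  assumes "Suc j < length p"
  shows "(\<Sum>u\<in>gaps p. a u * ray p u (j, v)) =
    (\<Sum>c\<in>between (p ! j) (p ! Suc j). a (j, c) * (of_bool (v \<in> vt c) - of_bool (base p j \<in> vt c)))"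
proof -
  let ?N = "between (p ! j) (p ! Suc j)"
  have "(\<Sum>u\<in>gaps p. a u * ray p u (j, v)) = (\<Sum>u\<in>Pair j ` ?N. a u * ray p u (j, v))"
  proof (rule sum.mono_neutral_right)
    show "Pair j ` ?N \<subseteq> gaps p"
      using assms by (auto simp: gaps_def between_def)
    show "\<forall>u\<in>gaps p - Pair j ` ?N. a u * ray p u (j, v) = 0"
    proof
      fix u assume u: "u \<in> gaps p - Pair j ` ?N"
      obtain i c where uc: "u = (i, c)" by (cases u)
      have "i \<noteq> j"
        using u unfolding uc by (auto simp: gaps_def between_def)
      then show "a u * ray p u (j, v) = 0"
        by (simp add: uc ray_def)
    qed
  qed (rule finite_gaps)
  also have "\<dots> = (\<Sum>c\<in>?N. a (j, c) * ray p (j, c) (j, v))"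
    by (subst sum.reindex) (auto simp: inj_on_def)
  finally show ?thesis by (simp add: ray_def)
qed

lemma gap_chains_down: "Q \<in> gap_chains p \<Longrightarrow> Q' \<subseteq> Q \<Longrightarrow> Q' \<in> gap_chains p"
proof -
  assume Q: "Q \<in> gap_chains p" "Q' \<subseteq> Q"
  have "chain_set {c. (j, c) \<in> Q'}" for j
  proof (rule chain_set_mono)
    show "chain_set {c. (j, c) \<in> Q}" using Q(1) by (simp add: gap_chains_def)
    show "{c. (j, c) \<in> Q'} \<subseteq> {c. (j, c) \<in> Q}" using Q(2) by auto
  qed
  moreover have "Q' \<subseteq> gaps p"
    using Q by (auto simp: gap_chains_def)
  ultimately show ?thesis by (simp add: gap_chains_def)
qed

lemma path_nth: "path p \<Longrightarrow> Suc j < length p \<Longrightarrow> step (p ! j) (p ! Suc j)"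
  by (auto simp: path_def successively_conv_nth)

text \<open>A product of fans: existence and uniqueness are settled separately in each block of
  coordinates by the braid fan of that down step.\<close>

lemma complete_fan_path:
  assumes "path p"
  shows "complete_fan (gaps p) (gap_chains p) (coords p) (ray p)"
  unfolding complete_fan_def
proof (intro conjI allI impI ballI)
  show "finite (gaps p)" by (rule finite_gaps)
  show "finite (coords p)" using card_coords[OF assms] by simp
  show "gap_chains p \<subseteq> Pow (gaps p)" by (auto simp: gap_chains_def)
  show "{} \<in> gap_chains p" by (auto simp: gap_chains_def chain_set_def)
  show "T \<in> gap_chains p" if "S \<in> gap_chains p" "T \<subseteq> S" for S T
    using that gap_chains_down by blast
next
  fix x :: "nat \<times> 'v \<Rightarrow> real"
  let ?U = "\<lambda>j. vt (p ! j) - vt (p ! Suc j)"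
  let ?I = "{j. Suc j < length p \<and> dn (p ! j) (p ! Suc j)}"
  \<comment> \<open>Extends the prescribed coordinates by 0 at the omitted base vertex.\<close>
  define g where "g j = (\<lambda>v. if v = base p j then 0 else x (j, v))" for j
  let ?Q = "\<lambda>j a. (\<forall>c. 0 \<le> a c) \<and> (\<forall>c. c \<notin> between (p ! j) (p ! Suc j) \<longrightarrow> a c = 0) \<and>
      chain_set {c. a c \<noteq> 0} \<and> (\<forall>v\<in>?U j. g j v - g j (base p j) =
        (\<Sum>c\<in>between (p ! j) (p ! Suc j). a c * (of_bool (v \<in> vt c) - of_bool (base p j \<in> vt c))))"
  have "\<exists>a. ?Q j a" if j: "j \<in> ?I" for j
  proof -
    have dj: "dn (p ! j) (p ! Suc j)" using j by simp
    then have "base p j \<in> ?U j"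
      by (intro base) (auto simp: dn_def)
    then show ?thesis
      by (rule braid_fan_exists[OF dj, of _ "g j"]) blast
  qed
  then have "\<forall>j\<in>?I. \<exists>a. ?Q j a"
    by (rule ballI)
  from bchoice[OF this] obtain A where A: "\<And>j. j \<in> ?I \<Longrightarrow> ?Q j (A j)"
    by blast
  define a where "a = (\<lambda>(j, c). if j \<in> ?I then A j c else 0)"
  have "0 \<le> a u" for u
    using A by (auto simp: a_def split: prod.split)
  moreover have "{u. a u \<noteq> 0} \<in> gap_chains p"
    unfolding gap_chains_def
  proof (intro CollectI conjI allI)
    show "{u. a u \<noteq> 0} \<subseteq> gaps p"
    proof clarify
      fix j c assume "a (j, c) \<noteq> 0"
      then have j: "j \<in> ?I" and "A j c \<noteq> 0"
        by (auto simp: a_def split: if_splits)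
      then have "c \<in> between (p ! j) (p ! Suc j)"
        using A[OF j] by metis
      then show "(j, c) \<in> gaps p"
        using j by (simp add: between_def gaps_def)
    qed
    show "chain_set {c. (j, c) \<in> {u. a u \<noteq> 0}}" for j
      using A[of j] by (cases "j \<in> ?I") (auto simp: a_def chain_set_def)
  qed
  moreover have "x e = (\<Sum>u\<in>gaps p. a u * ray p u e)" if "e \<in> coords p" for e
  proof -
    obtain j v where e: "e = (j, v)" by (cases e)
    have j: "Suc j < length p" "v \<in> ?U j" "v \<noteq> base p j"
      using that e by (auto simp: coords_def)
    have "\<not> pr (p ! j) (p ! Suc j)"
      using j(2) pr by blast
    then have jI: "j \<in> ?I"
      using j(1) path_nth[OF assms j(1)] by (auto simp: step_def)
    have "x e = g j v - g j (base p j)"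
      using j(3) e by (simp add: g_def)
    also have "\<dots> = (\<Sum>c\<in>between (p ! j) (p ! Suc j).
        A j c * (of_bool (v \<in> vt c) - of_bool (base p j \<in> vt c)))"
      using A[OF jI] j(2) by blast
    also have "\<dots> = (\<Sum>u\<in>gaps p. a u * ray p u (j, v))"
      using jI unfolding sum_ray[OF j(1)] by (simp add: a_def)
    finally show ?thesis using e by simp
  qed
  ultimately show "\<exists>a. (\<forall>v. 0 \<le> a v) \<and> {v. a v \<noteq> 0} \<in> gap_chains p \<and>
      (\<forall>e\<in>coords p. x e = (\<Sum>v\<in>gaps p. a v * ray p v e))"
    by blast
next
  fix a a' :: "nat \<times> 'c \<Rightarrow> real"
  assume a: "\<forall>v. 0 \<le> a v" "{v. a v \<noteq> 0} \<in> gap_chains p"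
    and a': "\<forall>v. 0 \<le> a' v" "{v. a' v \<noteq> 0} \<in> gap_chains p"
    and eq: "\<forall>e\<in>coords p. (\<Sum>v\<in>gaps p. a v * ray p v e) = (\<Sum>v\<in>gaps p. a' v * ray p v e)"
  have "a (j, c) = a' (j, c)" for j c
  proof (cases "(j, c) \<in> gaps p")
    case True
    then have j: "Suc j < length p" and c: "c \<in> between (p ! j) (p ! Suc j)"
      by (auto simp: gaps_def between_def)
    then have d: "dn (p ! j) (p ! Suc j)"
      using dn_trans by (auto simp: between_def)
    have b: "base p j \<in> vt (p ! j) - vt (p ! Suc j)"
      using d by (intro base) (auto simp: dn_def)
    have ch: "chain_set {c \<in> between (p ! j) (p ! Suc j). a (j, c) \<noteq> 0}"
      if "{v. a v \<noteq> 0} \<in> gap_chains p" for a :: "nat \<times> 'c \<Rightarrow> real"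
    proof -
      have "chain_set {c. (j, c) \<in> {v. a v \<noteq> 0}}"
        using that unfolding gap_chains_def by blast
      then show ?thesis by (rule chain_set_mono) auto
    qed
    show ?thesis
    proof (rule braid_fan_unique[OF d b, of "\<lambda>c. a (j, c)" "\<lambda>c. a' (j, c)"])
      fix v assume v: "v \<in> vt (p ! j) - vt (p ! Suc j)"
      show "(\<Sum>c\<in>between (p ! j) (p ! Suc j). a (j, c) * (of_bool (v \<in> vt c) - of_bool (base p j \<in> vt c))) =
        (\<Sum>c\<in>between (p ! j) (p ! Suc j). a' (j, c) * (of_bool (v \<in> vt c) - of_bool (base p j \<in> vt c)))"
      proof (cases "v = base p j")
        case False
        then have "(j, v) \<in> coords p"
          using v j by (simp add: coords_def)
        then show ?thesis
          using eq unfolding sum_ray[OF j, symmetric] by blast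
      qed simp
    qed (use a a' ch c in auto)
  next
    case False
    moreover have "{v. a v \<noteq> 0} \<subseteq> gaps p" "{v. a' v \<noteq> 0} \<subseteq> gaps p"
      using a(2) a'(2) by (simp_all add: gap_chains_def)
    ultimately have "a (j, c) = 0" "a' (j, c) = 0"
      by blast+
    then show ?thesis by simp
  qed
  then show "a = a'" by auto
qed

definition reduced_paths :: "'c \<Rightarrow> 'c \<Rightarrow> 'c list set"
  where "reduced_paths w z = {p. path p \<and> reduced p \<and> hd p = w \<and> last p = z}"

text \<open>\<open>\<sigma>\<close> is the inverse of inserting a family of chains and reducing.
  This map is onto by the definition of \<open>leq\<close>, injective because distinct refinements
  have distinct reductions, and it reverses the order.\<close>

lemma lower_set_fan:
  assumes b: "b \<in> reduced_paths w z"
  shows "\<exists>\<sigma>. bij_betw \<sigma> {a \<in> reduced_paths w z. leq a b} (gap_chains b) \<and>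
    (\<forall>a a'. leq a b \<longrightarrow> leq a' b \<longrightarrow> (leq a a' \<longleftrightarrow> \<sigma> a' \<subseteq> \<sigma> a))"
proof -
  have pb: "path b" using b by (simp add: reduced_paths_def)
  define \<theta> where "\<theta> = (\<lambda>Q. red (fill b Q))"
  have leq_\<theta>: "leq (\<theta> Q) (\<theta> Q') \<longleftrightarrow> Q' \<subseteq> Q" if "Q \<in> gap_chains b" "Q' \<in> gap_chains b" for Q Q'
    unfolding \<theta>_def leq_red_iff[OF ref_fill[OF pb that(1)] ref_fill[OF pb that(2)]]
    by (rule ref_fill_iff[OF pb that(2,1)])
  have "inj_on \<theta> (gap_chains b)"
  proof (rule inj_onI)
    fix Q Q' assume Q: "Q \<in> gap_chains b" "Q' \<in> gap_chains b" "\<theta> Q = \<theta> Q'"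
    have "fill b Q = fill b Q'"
      using ref_inj[OF ref_fill[OF pb Q(1)] ref_fill[OF pb Q(2)]] Q(3) by (simp add: \<theta>_def)
    then show "Q = Q'"
      using ref_fill_iff[OF pb Q(1,2)] ref_fill_iff[OF pb Q(2,1)] ref_fill_iff[OF pb Q(1,1)]
      by auto
  qed
  moreover have im: "\<theta> ` gap_chains b = {a. leq a b}"
  proof
    show "\<theta> ` gap_chains b \<subseteq> {a. leq a b}"
      using ref_fill[OF pb] by (auto simp: leq_def \<theta>_def)
    show "{a. leq a b} \<subseteq> \<theta> ` gap_chains b"
    proof clarify
      fix a assume "leq a b"
      then obtain q where "ref b q" "red q = a" by (auto simp: leq_def)
      then show "a \<in> \<theta> ` gap_chains b"
        using fill_surj[of b q] by (auto simp: \<theta>_def)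
    qed
  qed
  moreover have "{a. leq a b} = {a \<in> reduced_paths w z. leq a b}"
  proof -
    have "a \<in> reduced_paths w z" if ab: "leq a b" for a
    proof -
      obtain q where q: "ref b q" "a = red q" using ab by (auto simp: leq_def)
      show ?thesis
        using b path_red[OF ref_path2[OF q(1)]] reduced_red[of q] ref_hd[OF q(1)] ref_last[OF q(1)]
        by (simp add: q(2) reduced_paths_def hd_red last_red)
    qed
    then show ?thesis by auto
  qed
  ultimately have bij: "bij_betw \<theta> (gap_chains b) {a \<in> reduced_paths w z. leq a b}"
    by (metis bij_betw_imageI)
  let ?\<sigma> = "the_inv_into (gap_chains b) \<theta>"
  have "leq a a' \<longleftrightarrow> ?\<sigma> a' \<subseteq> ?\<sigma> a" if "leq a b" "leq a' b" for a a'
  proof -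
    have "a \<in> \<theta> ` gap_chains b" "a' \<in> \<theta> ` gap_chains b"
      using that by (simp_all add: im)
    then obtain Q Q' where Q: "Q \<in> gap_chains b" "a = \<theta> Q" "Q' \<in> gap_chains b" "a' = \<theta> Q'"
      by (elim imageE)
    then show ?thesis
      using leq_\<theta> \<open>inj_on \<theta> (gap_chains b)\<close> by (simp add: the_inv_into_f_f)
  qed
  then show ?thesis
    using bij_betw_the_inv_into[OF bij] by blast
qed

end

section \<open>Zigzags and words\<close>

text \<open>Splits off the first right-pointing and the first left-pointing arrow, which gives
  zigzags an induction principle despite their encoding as four parallel lists.\<close>

definition zcons :: "'o \<Rightarrow> 'o \<Rightarrow> 'm \<Rightarrow> 'm \<Rightarrow> ('o, 'm) zigzag \<Rightarrow> ('o, 'm) zigzag"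
  where "zcons x y g f Z = Zigzag (x # zx Z) (y # zy Z) (g # zg Z) (f # zf Z)"

lemma zigzags_single:
  "Zigzag [x] [y] [g] [] \<in> zigzags C S w z \<longleftrightarrow> x = w \<and> y = z \<and> g \<in> Hom C w z"
  by (auto simp: zigzags_def)

lemma zigzags_zx: "Z \<in> zigzags C S w z \<Longrightarrow> zx Z \<noteq> [] \<and> zy Z \<noteq> [] \<and> hd (zx Z) = w \<and> last (zy Z) = z"
  by (cases Z) (auto simp: zigzags_def)

lemma zigzags_zcons:
  "zcons x y g f Z \<in> zigzags C S w z \<longleftrightarrow>
    x = w \<and> g \<in> Hom C w y \<and> (\<exists>x'. f \<in> sys_plus C S x' y \<and> Z \<in> zigzags C S x' z)"
proof -
  have "zcons x y g f Z \<in> zigzags C S w z \<longleftrightarrow>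
      x = w \<and> g \<in> Hom C w y \<and> f \<in> sys_plus C S (hd (zx Z)) y \<and> Z \<in> zigzags C S (hd (zx Z)) z"
    by (cases Z; cases "zx Z") (auto simp: zcons_def zigzags_def All_less_Suc2)
  then show ?thesis
    using zigzags_zx by metis
qed

lemma zigzag_cases:
  assumes "Z \<in> zigzags C S w z"
  obtains (single) g where "Z = Zigzag [w] [z] [g] []" "g \<in> Hom C w z"
  | (zcons) y x' g f Z' where "Z = zcons w y g f Z'" "g \<in> Hom C w y" "f \<in> sys_plus C S x' y"
      "Z' \<in> zigzags C S x' z"
proof -
  obtain xs ys gs fs where Z: "Z = Zigzag xs ys gs fs" by (cases Z)
  have len: "length gs = Suc (length fs)" "length xs = length gs" "length ys = length gs"
    using assms by (auto simp: Z zigzags_def)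
  show ?thesis
  proof (cases fs)
    case Nil
    then obtain x y g where "xs = [x]" "ys = [y]" "gs = [g]"
      using len by (auto simp: length_Suc_conv)
    then show ?thesis
      using assms single Nil by (auto simp: Z zigzags_single)
  next
    case (Cons f fs')
    then obtain x xs' y ys' g gs' where "xs = x # xs'" "ys = y # ys'" "gs = g # gs'"
      using len by (auto simp: length_Suc_conv)
    then have "Z = zcons x y g f (Zigzag xs' ys' gs' fs')"
      using Cons by (simp add: Z zcons_def)
    then show ?thesis
      using assms zcons by (auto simp: zigzags_zcons)
  qed
qed

lemma zigzag_induct [consumes 1, case_names single zcons]:
  assumes "Z \<in> zigzags C S w z"
    and "\<And>w g. g \<in> Hom C w z \<Longrightarrow> P w (Zigzag [w] [z] [g] [])"
    and "\<And>w y x' g f Z'. g \<in> Hom C w y \<Longrightarrow> f \<in> sys_plus C S x' y \<Longrightarrow> Z' \<in> zigzags C S x' z \<Longrightarrow>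
      P x' Z' \<Longrightarrow> P w (zcons w y g f Z')"
  shows "P w Z"
  using assms(1)
proof (induction "length (zf Z)" arbitrary: w Z)
  case 0
  from 0(2) show ?case
  proof (cases rule: zigzag_cases)
    case single
    then show ?thesis using assms(2) by simp
  next
    case zcons
    then show ?thesis using 0(1) by (simp add: zcons_def)
  qed
next
  case (Suc n)
  from Suc(3) show ?case
  proof (cases rule: zigzag_cases)
    case single
    then show ?thesis using assms(2) by simp
  next
    case (zcons y x' g f Z')
    then have "n = length (zf Z')" using Suc(2) by (simp add: zcons_def)
    then show ?thesis using assms(3) Suc(1) zcons by simp
  qed
qed

text \<open>
  Prescribing the first component \<open>v\<^sub>0\<close>, instead of requiring it to be an identity, makes maps
  of zigzags accessible to induction.
\<close>

definition zz_map_from :: "('o, 'm) pcat \<Rightarrow> 'm set \<Rightarrow> ('m \<Rightarrow> 'm \<Rightarrow> bool) \<Rightarrow> 'm \<Rightarrow>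
    ('o, 'm) zigzag \<Rightarrow> ('o, 'm) zigzag \<Rightarrow> bool"
  where "zz_map_from C S R v0 Z Z' \<longleftrightarrow>
    length (zf Z) = length (zf Z') \<and>
    (\<exists>u v. (\<forall>i \<le> length (zf Z).
              u i \<in> sys_plus C S (zy Z ! i) (zy Z' ! i) \<and>
              v i \<in> sys_plus C S (zx Z ! i) (zx Z' ! i) \<and>
              R (Comp C (zg Z' ! i) (v i)) (Comp C (u i) (zg Z ! i))) \<and>
           (\<forall>i < length (zf Z).
              R (Comp C (zf Z' ! i) (v (Suc i))) (Comp C (u i) (zf Z ! i))) \<and>
           v 0 = v0 \<and>
           u (length (zf Z)) = Ident C (last (zy Z)))"

lemma zz_map_iff_from: "zz_map C S R Z Z' \<longleftrightarrow> zz_map_from C S R (Ident C (hd (zx Z))) Z Z'"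
  by (simp add: zz_map_def zz_map_from_def)

lemma zz_map_from_single:
  "zz_map_from C S R v0 (Zigzag [x] [y] [g] []) (Zigzag [x'] [y'] [g'] []) \<longleftrightarrow>
    Ident C y \<in> sys_plus C S y y' \<and> v0 \<in> sys_plus C S x x' \<and> R (Comp C g' v0) (Comp C (Ident C y) g)"
proof
  assume "Ident C y \<in> sys_plus C S y y' \<and> v0 \<in> sys_plus C S x x' \<and> R (Comp C g' v0) (Comp C (Ident C y) g)"
  then show "zz_map_from C S R v0 (Zigzag [x] [y] [g] []) (Zigzag [x'] [y'] [g'] [])"
    unfolding zz_map_from_def by (intro conjI exI[of _ "\<lambda>_. Ident C y"] exI[of _ "\<lambda>_. v0"]) auto
qed (auto simp: zz_map_from_def)

lemma all_le_Suc2: "(\<forall>i\<le>Suc n. P i) \<longleftrightarrow> P 0 \<and> (\<forall>i\<le>n. P (Suc i))"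
  by (metis Suc_le_mono le0 not0_implies_Suc)

lemma zz_map_from_zcons:
  assumes "zy Z \<noteq> []"
  shows "zz_map_from C S R v0 (zcons x y g f Z) (zcons x' y' g' f' Z') \<longleftrightarrow>
    v0 \<in> sys_plus C S x x' \<and> (\<exists>u0 v1. u0 \<in> sys_plus C S y y' \<and> R (Comp C g' v0) (Comp C u0 g) \<and>
      R (Comp C f' v1) (Comp C u0 f) \<and> zz_map_from C S R v1 Z Z')" (is "?L \<longleftrightarrow> ?R")
proof
  assume ?L
  then obtain u v where uv: "length (zf Z) = length (zf Z')"
    "\<forall>i\<le>Suc (length (zf Z)). u i \<in> sys_plus C S ((y # zy Z) ! i) ((y' # zy Z') ! i) \<and>
       v i \<in> sys_plus C S ((x # zx Z) ! i) ((x' # zx Z') ! i) \<and>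
       R (Comp C ((g' # zg Z') ! i) (v i)) (Comp C (u i) ((g # zg Z) ! i))"
    "\<forall>i<Suc (length (zf Z)). R (Comp C ((f' # zf Z') ! i) (v (Suc i))) (Comp C (u i) ((f # zf Z) ! i))"
    "v 0 = v0" "u (Suc (length (zf Z))) = Ident C (last (zy Z))"
    unfolding zz_map_from_def zcons_def using assms by auto
  show ?R
    using uv(1,3,4,5) uv(2)[unfolded all_le_Suc2] unfolding All_less_Suc2 zz_map_from_def
    by (intro conjI exI[of _ "u 0"] exI[of _ "v 1"] exI[of _ "\<lambda>i. u (Suc i)"] exI[of _ "\<lambda>i. v (Suc i)"]) auto
next
  assume ?R
  then obtain u0 v1 u v where uv: "v0 \<in> sys_plus C S x x'" "u0 \<in> sys_plus C S y y'"
    "R (Comp C g' v0) (Comp C u0 g)" "R (Comp C f' v1) (Comp C u0 f)"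
    "length (zf Z) = length (zf Z')"
    "\<forall>i\<le>length (zf Z). u i \<in> sys_plus C S (zy Z ! i) (zy Z' ! i) \<and>
              v i \<in> sys_plus C S (zx Z ! i) (zx Z' ! i) \<and>
              R (Comp C (zg Z' ! i) (v i)) (Comp C (u i) (zg Z ! i))"
    "\<forall>i<length (zf Z). R (Comp C (zf Z' ! i) (v (Suc i))) (Comp C (u i) (zf Z ! i))"
    "v 0 = v1" "u (length (zf Z)) = Ident C (last (zy Z))"
    unfolding zz_map_from_def by blast
  show ?L
    unfolding zz_map_from_def zcons_def zigzag.sel list.size add_Suc_right add_0_right all_le_Suc2 All_less_Suc2
    by (intro conjI exI[of _ "case_nat u0 u"] exI[of _ "case_nat v0 v"]) (use uv assms in auto)
qed

text \<open>Composition in the entrance path category with the arguments in the order of traversal;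
  the shared cell is kept once.\<close>

definition cat :: "'c list \<Rightarrow> 'c list \<Rightarrow> 'c list"
  where "cat p q = p @ tl q"

lemma cat_assoc: "q \<noteq> [] \<Longrightarrow> cat (cat p q) r = cat p (cat q r)"
  by (simp add: cat_def)

lemma cat_ne: "p \<noteq> [] \<Longrightarrow> cat p q \<noteq> [] \<and> hd (cat p q) = hd p"
  by (simp add: cat_def)

lemma cat_last: "q \<noteq> [] \<Longrightarrow> last p = hd q \<Longrightarrow> last (cat p q) = last q"
  by (cases q) (auto simp: cat_def)

lemma cat_single: "q \<noteq> [] \<Longrightarrow> hd q = x \<Longrightarrow> cat [x] q = q" "cat p [x] = p"
  by (cases q) (auto simp: cat_def)

lemma cat_Cons: "cat (x # p) q = x # cat p q"
  by (simp add: cat_def)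

lemma red_cat_cong:
  assumes "red q = red q'" "p \<noteq> []" "q \<noteq> []" "hd q = last p"
  shows "red (cat p q) = red (cat p q')"
proof -
  have "q' \<noteq> []" "hd q' = hd q"
    using assms(1,3) hd_red by (metis red_eq_Nil)+
  moreover have "cat p q = butlast p @ q" if "q \<noteq> []" "hd q = last p" for q
    using that assms(2) append_butlast_last_id[of p] by (cases q) (auto simp: cat_def simp flip: append_assoc)
  ultimately show ?thesis
    using assms red_append_cong by metis
qed

text \<open>A left-pointing arrow is formally inverted, hence its cells are read backwards.\<close>

fun word :: "'c list list \<Rightarrow> 'c list list \<Rightarrow> 'c list"
  where
    "word (g # gs) (f # fs) = cat g (cat (rev f) (word gs fs))"
  | "word (g # gs) [] = g"
  | "word [] _ = []"

definition zword :: "('c, 'c list) zigzag \<Rightarrow> 'c list"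
  where "zword Z = word (zg Z) (zf Z)"

lemma zword_single: "zword (Zigzag xs ys [g] []) = g"
  by (simp add: zword_def)

lemma zword_zcons: "zword (zcons x y g f Z) = cat g (cat (rev f) (zword Z))"
  by (simp add: zword_def zcons_def)

lemma word_horizontal:
  "length fs = length gs \<Longrightarrow> g' \<noteq> [] \<Longrightarrow>
    word (gs @ [g, g'] @ gs') (fs @ [[y]] @ fs') = word (gs @ [cat g g'] @ gs') (fs @ fs')"
proof (induction gs arbitrary: fs)
  case Nil
  then show ?case
    by (cases fs') (auto simp: cat_def)
next
  case (Cons a gs)
  then show ?case by (cases fs) auto
qed

section \<open>Words of zigzags in the entrance path category\<close>

locale morse_complex = paired_complex "cells X" vt "regular_pair X f"
  for X :: "'a cw" and f :: "'a set \<Rightarrow> real" and vt :: "'a set \<Rightarrow> 'v set" +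
  assumes cell_less_iff: "x \<in> cells X \<Longrightarrow> y \<in> cells X \<Longrightarrow> cell_less X y x \<longleftrightarrow> vt y \<subset> vt x"
begin

abbreviation "pr \<equiv> regular_pair X f"
abbreviation "C \<equiv> Ent X"
abbreviation "S \<equiv> morse_system X f"
abbreviation "homs \<equiv> Hom C"
abbreviation "arrs \<equiv> sys_plus C S"
abbreviation "zigs \<equiv> zigzags C S"

lemma Ent_simps: "Comp C h g = cat g h" "Ident C x = [x]" "Le C = subseq"
  by (simp_all add: Ent_def cat_def)

lemma homs: "g \<in> homs x y \<longleftrightarrow> g \<noteq> [] \<and> set g \<subseteq> cells X \<and> hd g = x \<and> last g = y \<and> sorted_wrt dn g"
proof -
  have "successively (\<lambda>a b. cell_less X b a) g \<longleftrightarrow> sorted_wrt dn g" if "set g \<subseteq> cells X"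
  proof -
    have "successively (\<lambda>a b. cell_less X b a) g \<longleftrightarrow> successively dn g"
      using that cell_less_iff by (intro successively_cong) (simp_all add: dn_def subset_iff)
    also have "\<dots> \<longleftrightarrow> sorted_wrt dn g"
      using dn_trans by (intro successively_conv_sorted_wrt) (auto simp: transp_def)
    finally show ?thesis .
  qed
  then show ?thesis
    by (auto simp: Ent_def)
qed

lemma homs_single: "[x] \<in> homs y z \<longleftrightarrow> x = y \<and> x = z \<and> x \<in> cells X"
  by (auto simp: homs)

lemma homs_pair: "[x, y] \<in> homs x y \<longleftrightarrow> dn x y"
  using dn_V by (auto simp: homs)

lemma homs_Cons: "x # y # g \<in> homs w z \<longleftrightarrow> x = w \<and> dn x y \<and> y # g \<in> homs y z"
proof -
  have "transp dn" using dn_trans by (auto simp: transp_def)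
  then show ?thesis
    using dn_V by (auto simp: homs sorted_wrt2 simp del: sorted_wrt.simps)
qed

lemma arrs: "g \<in> arrs x y \<longleftrightarrow> (x = y \<and> x \<in> cells X \<and> g = [x]) \<or> (pr y x \<and> g = [x, y])"
proof -
  have "[x, y] \<in> homs x y" if "pr y x"
    using pr_dn[OF that] by (simp add: homs_pair)
  then show ?thesis
    by (auto simp: sys_plus_def morse_system_def Ent_simps homs_single homs)
qed

lemma arrs_id: "x \<in> cells X \<Longrightarrow> [x] \<in> arrs x x"
  by (simp add: arrs)

lemma arrs_pr: "pr y x \<Longrightarrow> [x, y] \<in> arrs x y"
  by (simp add: arrs)

text \<open>Together with \<open>arrs_cat\<close> this makes the two composites in a square of
  left-pointing arrows equal, even where a map of zigzags only asks for a refinement. Only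
  right-pointing arrows can be refined.\<close>

lemma arrs_unique: "g \<in> arrs x y \<Longrightarrow> g' \<in> arrs x y \<Longrightarrow> g = g'"
  using pr_dn dn_irrefl by (auto simp: arrs)

text \<open>Regular pairs never follow one another, so one of the factors is an identity.\<close>

lemma arrs_cat: "g \<in> arrs x y \<Longrightarrow> h \<in> arrs y z \<Longrightarrow> cat g h \<in> arrs x z"
  using pr_pr by (auto simp: arrs cat_def)

lemma arrs_homs: "g \<in> arrs x y \<Longrightarrow> g \<in> homs x y"
  by (simp add: sys_plus_def)

lemma homs_cat:
  assumes "g \<in> homs x y" "h \<in> homs y z"
  shows "cat g h \<in> homs x z"
  using assms
proof (induction g arbitrary: x rule: induct_list012)
  case (2 a)
  then show ?case by (auto simp: homs cat_single)
next
  case (3 a b g)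
  then show ?case by (auto simp: homs_Cons cat_Cons)
qed (simp add: homs)

lemma homs_path: "g \<in> homs x y \<Longrightarrow> path g \<and> g \<noteq> [] \<and> hd g = x \<and> last g = y"
proof -
  assume g: "g \<in> homs x y"
  have "successively dn g"
    using g dn_trans by (subst successively_conv_sorted_wrt) (auto simp: transp_def homs)
  then have "successively step g"
    by (rule successively_mono) (auto simp: step_def)
  then show ?thesis using g by (auto simp: homs path_def)
qed

lemma arrs_rev: "g \<in> arrs x y \<Longrightarrow> path (rev g) \<and> rev g \<noteq> [] \<and> hd (rev g) = y \<and> last (rev g) = x"
  using pr by (auto simp: arrs path_def step_def)

lemma path_cat: "path p \<Longrightarrow> path q \<Longrightarrow> last p = hd q \<Longrightarrow> path (cat p q)"
proof (induction p rule: induct_list012)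
  case (2 x)
  then show ?case by (simp add: cat_single path_def)
next
  case (3 x y p)
  then show ?case by (simp add: cat_Cons path_Cons)
qed (simp add: path_def)

lemma zword:
  assumes "Z \<in> zigs w z"
  shows "path (zword Z) \<and> zword Z \<noteq> [] \<and> hd (zword Z) = w \<and> last (zword Z) = z"
  using assms
proof (induction rule: zigzag_induct)
  case (single w g)
  then show ?case by (simp add: zword_single homs_path)
next
  case (zcons w y x' g f Z')
  have f: "path (rev f)" "rev f \<noteq> []" "hd (rev f) = y" "last (rev f) = x'"
    using arrs_rev zcons(2) by auto
  have g: "path g" "g \<noteq> []" "hd g = w" "last g = y"
    using homs_path zcons(1) by auto
  have "path (cat (rev f) (zword Z'))" "cat (rev f) (zword Z') \<noteq> []"
    "hd (cat (rev f) (zword Z')) = y" "last (cat (rev f) (zword Z')) = z"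
    using f zcons(4) path_cat cat_ne cat_last by metis+
  then show ?case
    unfolding zword_zcons using g path_cat cat_ne cat_last by metis
qed

lemma red_arr_cancel:
  assumes "l \<in> arrs x y" "b \<noteq> []" "hd b = x"
  shows "red (cat l (cat (rev l) b)) = red b"
proof -
  obtain b' where b: "b = x # b'" using assms by (cases b) auto
  show ?thesis
    using assms(1) red_cancel[of x y b'] unfolding arrs b by (auto simp: cat_def simp del: red.simps)
qed

text \<open>
  A map of zigzags changes the spelled word only by the relation induced on each of the
  right-pointing arrows: each \<open>g\<^sub>i\<close> becomes \<open>u\<^sub>i\<^sup>-\<^sup>1 g\<^sub>i' v\<^sub>i\<close>, and the inner factors cancel.
\<close>

lemma zz_map_from_word:
  fixes rel :: "'a set list \<Rightarrow> 'a set list \<Rightarrow> bool"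
  assumes rel_hom: "\<And>p q x y. R p q \<Longrightarrow> p \<in> homs x y \<Longrightarrow> q \<in> homs x y \<Longrightarrow> rel p q"
    and rel_refl: "\<And>p. path p \<Longrightarrow> rel p p"
    and rel_cat: "\<And>p q p' q'. rel p q \<Longrightarrow> rel p' q' \<Longrightarrow> path p \<Longrightarrow> path q \<Longrightarrow> path p' \<Longrightarrow> path q' \<Longrightarrow>
      last p = hd p' \<Longrightarrow> last q = hd q' \<Longrightarrow> rel (cat p p') (cat q q')"
    and "Z \<in> zigs w z" "Z' \<in> zigs w' z" "zz_map_from C S R v0 Z Z'"
  shows "\<exists>q' q. rel q' q \<and> red q' = red (cat v0 (zword Z')) \<and> red q = red (zword Z) \<and>
    path q' \<and> path q \<and> hd q' = w \<and> hd q = w"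
  using assms(4-6)
proof (induction arbitrary: Z' w' v0 rule: zigzag_induct)
  case (single w g)
  from single.prems(1) show ?case
  proof (cases rule: zigzag_cases)
    case g': (single g')
    have h: "v0 \<in> arrs w w'" "R (cat v0 g') (cat g [z])"
      using single.prems(2) by (auto simp: g'(1) zz_map_from_single Ent_simps)
    have v: "cat v0 g' \<in> homs w z"
      using homs_cat arrs_homs h(1) g'(2) by blast
    show ?thesis
      using rel_hom[OF _ v single.hyps] h(2) homs_path[OF v] homs_path[OF single.hyps]
      by (intro exI[of _ "cat v0 g'"] exI[of _ g]) (auto simp: g'(1) zword_single cat_single)
  next
    case (zcons y x' g' f' Z'')
    then show ?thesis
      using single.prems(2) by (simp add: zz_map_from_def zcons_def)
  qed
next
  case (zcons w y x1 g f Z)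
  from zcons.prems(1) show ?case
  proof (cases rule: zigzag_cases)
    case (single g')
    then show ?thesis
      using zcons.prems(2) by (simp add: zz_map_from_def zcons_def)
  next
    case Z': (zcons y' x1' g' f' Z1')
    have "zy Z \<noteq> []" using zigzags_zx[OF zcons.hyps(3)] by simp
    then obtain u0 v1 where h: "v0 \<in> arrs w w'" "u0 \<in> arrs y y'" "R (cat v0 g') (cat g u0)"
      "zz_map_from C S R v1 Z Z1'"
      using zcons.prems(2) unfolding Z'(1) by (auto simp: zz_map_from_zcons Ent_simps)
    have v1: "v1 \<in> arrs x1 x1'"
    proof -
      have "v1 \<in> arrs (zx Z ! 0) (zx Z1' ! 0)"
        using h(4) unfolding zz_map_from_def by blast
      moreover have "zx Z ! 0 = x1" "zx Z1' ! 0 = x1'"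
        using zigzags_zx[OF zcons.hyps(3)] zigzags_zx[OF Z'(4)] hd_conv_nth by metis+
      ultimately show ?thesis by simp
    qed
    obtain q' q where q: "rel q' q" "red q' = red (cat v1 (zword Z1'))" "red q = red (zword Z)"
      "path q'" "path q" "hd q' = x1" "hd q = x1"
      using zcons.IH[OF Z'(4) h(4)] by blast
    have fu: "cat f u0 \<in> arrs x1 y'" "cat v1 f' = cat f u0"
      using arrs_cat[OF zcons.hyps(2) h(2)] arrs_cat[OF v1 Z'(3)] arrs_unique by blast+
    have ne: "q \<noteq> []" "q' \<noteq> []" "u0 \<noteq> []" "f \<noteq> []" "g \<noteq> []" "g' \<noteq> []" "f' \<noteq> []" "v0 \<noteq> []" "v1 \<noteq> []"
      using q path_def homs_path[OF arrs_homs[OF h(2)]] homs_path[OF arrs_homs[OF zcons.hyps(2)]]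
        homs_path[OF zcons.hyps(1)] homs_path[OF Z'(2)] homs_path[OF arrs_homs[OF Z'(3)]]
        homs_path[OF arrs_homs[OF h(1)]] homs_path[OF arrs_homs[OF v1]] by auto
    note zw' = zword[OF Z'(4)]
    have r: "path (rev (cat f u0))" "rev (cat f u0) \<noteq> []" "hd (rev (cat f u0)) = y'"
      "last (rev (cat f u0)) = x1"
      using arrs_rev[OF fu(1)] by auto
    have rev_cat: "rev (cat a b) = cat (rev b) (rev a)" if "a \<noteq> []" "b \<noteq> []" "last a = hd b"
      for a b :: "'a set list"
      using that by (cases b; cases a rule: rev_cases) (auto simp: cat_def)
    let ?r = "rev (cat f u0)"
    \<comment> \<open>Both words are rerouted through \<open>y'\<close>, with the inverse
      \<open>?r\<close> of the common composite of left-pointing arrows in the middle, so that they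
      differ only by the relation on the first arrows and by the induction hypothesis.\<close>
    let ?q = "cat (cat g u0) (cat ?r q)" and ?q' = "cat (cat v0 g') (cat ?r q')"
    have gu: "cat g u0 \<in> homs w y'" and vg: "cat v0 g' \<in> homs w y'"
      using homs_cat arrs_homs zcons.hyps(1) h(1,2) Z'(2) by blast+
    have rq: "rel (cat ?r q') (cat ?r q)" "path (cat ?r q')" "path (cat ?r q)"
      using rel_cat[OF rel_refl[OF r(1)] q(1) r(1) r(1)] path_cat r(1,4) q by auto
    have hr: "hd (cat ?r q') = y'" "hd (cat ?r q) = y'"
      using cat_ne[OF r(2)] r(3) by metis+
    have pq: "path (cat g u0)" "path (cat v0 g')" "last (cat g u0) = y'" "last (cat v0 g') = y'"
      using homs_path[OF gu] homs_path[OF vg] by metis+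
    have 1: "rel ?q' ?q" "path ?q'" "path ?q"
      by (rule rel_cat[OF rel_hom[OF h(3) vg gu] rq(1) pq(2,1) rq(2,3)]; simp only: pq hr)
        (rule path_cat[OF pq(2) rq(2)] path_cat[OF pq(1) rq(3)]; simp only: pq hr)+
    have eq: "?q = cat g (cat u0 (cat (rev u0) (cat (rev f) q)))"
      using ne homs_path[OF arrs_homs[OF h(2)]] homs_path[OF arrs_homs[OF zcons.hyps(2)]]
      by (simp add: rev_cat cat_assoc)
    have fq: "cat (rev f) q \<noteq> []" "hd (cat (rev f) q) = y" "last (rev f) = x1" "rev f \<noteq> []"
      using cat_ne arrs_rev[OF zcons.hyps(2)] by auto
    have "red (cat u0 (cat (rev u0) (cat (rev f) q))) = red (cat (rev f) q)"
      using red_arr_cancel[OF h(2) fq(1,2)] .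
    also have "\<dots> = red (cat (rev f) (zword Z))"
      using red_cat_cong[OF q(3) fq(4) ne(1)] q(7) fq(3) by simp
    finally have "red ?q = red (cat g (cat (rev f) (zword Z)))"
      unfolding eq using cat_ne[of u0] ne homs_path[OF arrs_homs[OF h(2)]] homs_path[OF zcons.hyps(1)]
      by (intro red_cat_cong) auto
    then have 2: "red ?q = red (zword (zcons w y g f Z))"
      by (simp add: zword_zcons)
    have f'1: "last v1 = hd f'" "hd f' = x1'" "last f' = y'" "hd v1 = x1" "last v1 = x1'"
      using homs_path[OF arrs_homs[OF v1]] homs_path[OF arrs_homs[OF Z'(3)]] by auto
    have r': "?r = cat (rev f') (rev v1)"
      using fu(2) rev_cat[OF ne(9,7) f'1(1)] by simp
    have v1': "rev v1 \<noteq> []" "hd (rev v1) = x1'" "last (rev v1) = x1"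
      using arrs_rev[OF v1] by auto
    have eq': "?q' = cat v0 (cat g' (cat (rev f') (cat (rev v1) q')))"
      using ne by (simp add: r' cat_assoc)
    have "red (cat (rev v1) q') = red (cat (rev v1) (cat v1 (zword Z1')))"
      using red_cat_cong[OF q(2) v1'(1) ne(2)] q(6) v1'(3) by simp
    also have "\<dots> = red (zword Z1')"
    proof -
      obtain b where b: "zword Z1' = x1' # b" using zw' by (cases "zword Z1'") auto
      show ?thesis
        using v1 red_cancel[of x1' x1 b] unfolding arrs b by (auto simp: cat_def simp del: red.simps)
    qed
    finally have e1: "red (cat (rev v1) q') = red (zword Z1')" .
    have e2: "red (cat (rev f') (cat (rev v1) q')) = red (cat (rev f') (zword Z1'))"
      using red_cat_cong[OF e1] ne v1' cat_ne[OF v1'(1), of q'] arrs_rev[OF Z'(3)] by simp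
    have e3: "red (cat g' (cat (rev f') (cat (rev v1) q'))) = red (cat g' (cat (rev f') (zword Z1')))"
      using red_cat_cong[OF e2 ne(6)] cat_ne[of "rev f'"] ne(7) arrs_rev[OF Z'(3)] homs_path[OF Z'(2)]
      by simp
    have "red ?q' = red (cat v0 (cat g' (cat (rev f') (zword Z1'))))"
      unfolding eq' using red_cat_cong[OF e3 ne(8)] cat_ne[OF ne(6)] homs_path[OF Z'(2)]
        homs_path[OF arrs_homs[OF h(1)]] by simp
    then have 3: "red ?q' = red (cat v0 (zword Z'))"
      by (simp add: Z'(1) zword_zcons)
    have "hd ?q' = w" "hd ?q = w"
      using cat_ne homs_path[OF gu] homs_path[OF vg] by auto
    then show ?thesis
      using 1 2 3 by blast
  qed
qed

lemma homs_V: "g \<in> homs x y \<Longrightarrow> x \<in> cells X \<and> y \<in> cells X"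
  unfolding homs by (metis hd_in_set last_in_set subsetD)

lemma ref_cat:
  "ref p q \<Longrightarrow> ref p' q' \<Longrightarrow> last p = hd p' \<Longrightarrow> ref (cat p p') (cat q q')"
proof (induction rule: ref.induct)
  case (single x)
  then show ?case
    using ref_hd[of p' q'] by (simp add: cat_single)
next
  case (Cons x m y p q)
  then have "ref (y # cat p p') (y # cat q q')" by (simp add: cat_Cons)
  then show ?case
    using ref.Cons[OF Cons.hyps(1)] by (simp add: cat_def)
qed

text \<open>With common ends, inclusion of cells means inclusion of the inner chains, and
  \<open>ref_chain\<close> applies. The case \<open>x = y\<close> is separate, since its only
  morphism is the identity, which lacks two end entries.\<close>

lemma homs_subset_ref:
  assumes "p \<in> homs x y" "q \<in> homs x y" "set p \<subseteq> set q"
  shows "ref p q"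
proof (cases "x = y")
  case True
  have "g = [x]" if g: "g \<in> homs x y" for g
  proof -
    obtain l where l: "g = x # l" using g by (cases g) (auto simp: homs)
    have "l = []"
    proof (rule ccontr)
      assume "l \<noteq> []"
      then have "x \<in> set l"
        using g True l by (metis homs last_ConsR last_in_set)
      then show False
        using g l dn_irrefl by (auto simp: homs)
    qed
    then show ?thesis using l by simp
  qed
  then show ?thesis
    using assms by (metis homs_path ref_refl)
next
  case False
  have "\<exists>m. g = x # m @ [y]" if g: "g \<in> homs x y" for g
  proof -
    obtain g' where "g = x # g'" using g by (cases g) (auto simp: homs)
    moreover then have "g' \<noteq> []" "last g' = y" using g False by (auto simp: homs split: if_splits)
    ultimately show ?thesis by (metis append_butlast_last_id)
  qed
  then obtain m m' where m: "p = x # m @ [y]" "q = x # m' @ [y]"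
    using assms by meson
  have s: "sorted_wrt dn (x # m @ [y])" "sorted_wrt dn (x # m' @ [y])"
    using assms(1,2) m by (auto simp: homs)
  have "x \<notin> set m" "y \<notin> set m"
    using s(1) dn_irrefl by (auto simp: sorted_wrt_append)
  then have "set m \<subseteq> set m'"
    using assms(3) m by auto
  moreover have "y \<in> cells X"
    using assms(1) m by (auto simp: homs)
  ultimately show ?thesis
    using ref_chain[OF s _ ref.single] m by simp
qed

definition eqv :: "('a set, 'a set list) zigzag \<Rightarrow> ('a set, 'a set list) zigzag \<Rightarrow> bool"
  where "eqv = equivclp (zz_step C S)"

lemma eqv_refl: "eqv Z Z"
  by (simp add: eqv_def)

lemma eqv_sym: "eqv Z Z' \<Longrightarrow> eqv Z' Z"
  unfolding eqv_def by (rule equivclp_sym)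

lemma eqv_trans: "eqv Z Z' \<Longrightarrow> eqv Z' Z'' \<Longrightarrow> eqv Z Z''"
  unfolding eqv_def by (rule equivclp_trans)

lemma eqv_step: "zz_step C S Z Z' \<Longrightarrow> eqv Z Z'"
  unfolding eqv_def by (rule r_into_equivclp)

lemma zz_step_zigs: "zz_step C S Z Z' \<Longrightarrow> Z \<in> zigs w z \<longleftrightarrow> Z' \<in> zigs w z"
  unfolding zz_step_def using zigzags_zx by metis

lemma eqv_zigs: "eqv Z Z' \<Longrightarrow> Z \<in> zigs w z \<longleftrightarrow> Z' \<in> zigs w z"
  unfolding eqv_def by (induction rule: equivclp_induct) (use zz_step_zigs in blast)+

lemma zigs_nth_homs: "Z \<in> zigs w z \<Longrightarrow> g \<in> set (zg Z) \<Longrightarrow> g \<noteq> []"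
  by (auto simp: zigzags_def in_set_conv_nth Ent_def)

text \<open>An identity spells nothing, so a horizontal move leaves even the unreduced word
  unchanged. A vertical move only inserts or cancels regular pairs with their reverses.\<close>

lemma zz_step_word: "zz_step C S Z Z' \<Longrightarrow> red (zword Z) = red (zword Z')"
proof -
  assume st: "zz_step C S Z Z'"
  then obtain w z where Z: "Z \<in> zigs w z" "Z' \<in> zigs w z"
    by (auto simp: zz_step_def)
  from st consider "zz_horizontal C Z Z'" | "zz_map C S (=) Z Z'"
    by (auto simp: zz_step_def)
  then show ?thesis
  proof cases
    case 1
    then show ?thesis
    proof cases
      case (1 xs gs ys fs x y xs' y' ys' g g' gs' fs')
      have "g' \<noteq> []"
        using zigs_nth_homs[OF Z(1)] unfolding 1(1) by simp
      then have "zword Z = zword Z'"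
        unfolding 1(1,2) zword_def zigzag.sel Ent_simps by (rule word_horizontal[OF 1(5)])
      then show ?thesis by simp
    qed
  next
    case 2
    have "zz_map_from C S (=) [w] Z Z'"
      using 2 zigzags_zx[OF Z(1)] by (simp add: zz_map_iff_from Ent_simps)
    then obtain q' q where "q' = q" "red q' = red (cat [w] (zword Z'))" "red q = red (zword Z)"
      using zz_map_from_word[of "(=)" "(=)", OF _ _ _ Z] by blast
    then show ?thesis
      using zword[OF Z(2)] by (simp add: cat_single)
  qed
qed

lemma eqv_word: "eqv Z Z' \<Longrightarrow> red (zword Z) = red (zword Z')"
  unfolding eqv_def by (induction rule: equivclp_induct) (use zz_step_word in \<open>auto; metis\<close>)+

lemma zcons_zigs:
  "g \<in> homs w y \<Longrightarrow> h \<in> arrs x y \<Longrightarrow> Z \<in> zigs x z \<Longrightarrow> zcons w y g h Z \<in> zigs w z"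
  by (auto simp: zigzags_zcons)

lemma zz_map_from_zconsI:
  assumes "Z \<in> zigs a b" "zz_map_from C S R v1 Z Z'" "v0 \<in> arrs x x'" "u0 \<in> arrs y y'"
    and "R (cat v0 g') (cat g u0)" "R (cat v1 h') (cat h u0)"
  shows "zz_map_from C S R v0 (zcons x y g h Z) (zcons x' y' g' h' Z')"
proof -
  have "zy Z \<noteq> []" using zigzags_zx[OF assms(1)] by simp
  then show ?thesis
    unfolding zz_map_from_zcons[OF \<open>zy Z \<noteq> []\<close>] Ent_simps using assms(2-6) by blast
qed

lemma zz_map_from_refl:
  assumes "Z \<in> zigs w z" "\<And>g. R g g"
  shows "zz_map_from C S R [w] Z Z"
  using assms(1)
proof (induction rule: zigzag_induct)
  case (single w g)
  then have "w \<in> cells X" "z \<in> cells X"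
    using homs_V by blast+
  then show ?case
    using homs_path[OF single] assms(2)
    by (simp add: zz_map_from_single arrs_id Ent_simps cat_single)
next
  case (zcons w y x' g f Z')
  have V: "w \<in> cells X" "y \<in> cells X" "x' \<in> cells X"
    using homs_V[OF zcons(1)] homs_V[OF arrs_homs[OF zcons(2)]] by auto
  show ?case
    using homs_path[OF zcons(1)] homs_path[OF arrs_homs[OF zcons(2)]] assms(2)
    by (intro zz_map_from_zconsI[OF zcons(3,4) arrs_id[OF V(1)] arrs_id[OF V(2)]])
      (simp_all add: cat_single)
qed

lemma zz_horizontal_zcons:
  assumes "zz_horizontal C Z Z'"
  shows "zz_horizontal C (zcons x y g h Z) (zcons x y g h Z')"
  using assms
proof cases
  case (1 xs gs ys fs x0 y0 xs' y' ys' g0 g' gs' fs')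
  show ?thesis
    using zz_horizontal.intros[of "x # xs" "g # gs" "y # ys" "h # fs" C x0 y0 xs' y' ys' g0 g' gs' fs'] 1
    by (simp add: zcons_def)
qed

lemma zz_step_zcons:
  assumes "zz_step C S Z Z'" "Z \<in> zigs x' z" "g \<in> homs w y" "h \<in> arrs x' y"
  shows "zz_step C S (zcons w y g h Z) (zcons w y g h Z')"
proof -
  have Z': "Z' \<in> zigs x' z" using assms(1,2) zz_step_zigs by blast
  have "zcons w y g h Z \<in> zigs w z" "zcons w y g h Z' \<in> zigs w z"
    using assms(2-4) Z' by (auto simp: zigzags_zcons)
  moreover have "zz_horizontal C (zcons w y g h Z) (zcons w y g h Z') \<or>
      zz_map C S (=) (zcons w y g h Z) (zcons w y g h Z')"
  proof (cases "zz_horizontal C Z Z'")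
    case True
    then show ?thesis using zz_horizontal_zcons by blast
  next
    case False
    then have "zz_map_from C S (=) [x'] Z Z'"
      using assms(1) zigzags_zx[OF assms(2)] by (auto simp: zz_step_def zz_map_iff_from Ent_simps)
    moreover have V: "w \<in> cells X" "y \<in> cells X"
      using homs_V[OF assms(3)] by auto
    ultimately have "zz_map_from C S (=) [w] (zcons w y g h Z) (zcons w y g h Z')"
      by (intro zz_map_from_zconsI[OF assms(2) _ arrs_id arrs_id, of _ "[x']"])
        (simp_all add: cat_single homs_path[OF assms(3)] homs_path[OF arrs_homs[OF assms(4)]])
    then show ?thesis
      by (simp add: zz_map_iff_from Ent_simps zcons_def)
  qed
  ultimately show ?thesis
    unfolding zz_step_def by blast
qed

lemma eqv_zcons:
  assumes "eqv Z Z'" "Z \<in> zigs x' z" "g \<in> homs w y" "h \<in> arrs x' y"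
  shows "eqv (zcons w y g h Z) (zcons w y g h Z')"
  using assms(1) unfolding eqv_def
proof (induction rule: equivclp_induct)
  case (step Z1 Z2)
  have "Z1 \<in> zigs x' z" "Z2 \<in> zigs x' z"
    using step(1,2) eqv_zigs[of Z Z1] zz_step_zigs assms(2) unfolding eqv_def by blast+
  then have "zz_step C S (zcons w y g h Z1) (zcons w y g h Z2) \<or>
      zz_step C S (zcons w y g h Z2) (zcons w y g h Z1)"
    using step(2) zz_step_zcons assms(3,4) by blast
  then show ?case
    using step(3) equivclp_into_equivclp by metis
qed simp

text \<open>The horizontal relation read backwards, stated for the first arrow because all
  inductions peel zigzags from the front.\<close>

lemma eqv_split_first:
  assumes "Zigzag (x # xs) (b # ys) (cat g h # gs) fs \<in> zigs x z" "g \<in> homs x y" "h \<in> homs y b"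
  shows "eqv (zcons x y g [y] (Zigzag (y # xs) (b # ys) (h # gs) fs))
    (Zigzag (x # xs) (b # ys) (cat g h # gs) fs)"
    and "Zigzag (y # xs) (b # ys) (h # gs) fs \<in> zigs y z"
proof -
  have "y \<in> cells X"
    using homs_V[OF assms(3)] by simp
  have *: "Zigzag (y # xs) (b # ys) (h # gs) fs \<in> zigs y z"
  proof (cases fs)
    case Nil
    then have "xs = []" "ys = []" "gs = []" "b = z"
      using assms(1) by (auto simp: zigzags_def)
    then show ?thesis using Nil assms(3) by (simp add: zigzags_single)
  next
    case (Cons f fs')
    have "Zigzag (x # xs) (b # ys) (cat g h # gs) fs = zcons x b (cat g h) f (Zigzag xs ys gs fs')"
      using Cons by (simp add: zcons_def)
    moreover have "Zigzag (y # xs) (b # ys) (h # gs) fs = zcons y b h f (Zigzag xs ys gs fs')"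
      using Cons by (simp add: zcons_def)
    ultimately show ?thesis
      using assms by (simp add: zigzags_zcons)
  qed
  then show "Zigzag (y # xs) (b # ys) (h # gs) fs \<in> zigs y z" .
  then have "zcons x y g [y] (Zigzag (y # xs) (b # ys) (h # gs) fs) \<in> zigs x z"
    using assms(2) arrs_id[OF \<open>y \<in> cells X\<close>] by (auto simp: zigzags_zcons)
  moreover have "zz_horizontal C (zcons x y g [y] (Zigzag (y # xs) (b # ys) (h # gs) fs))
    (Zigzag (x # xs) (b # ys) (cat g h # gs) fs)"
    using zz_horizontal.intros[of "[]" "[]" "[]" "[]" C x y xs b ys g h gs fs]
    by (simp add: zcons_def Ent_simps)
  ultimately show "eqv (zcons x y g [y] (Zigzag (y # xs) (b # ys) (h # gs) fs))
    (Zigzag (x # xs) (b # ys) (cat g h # gs) fs)"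
    using assms(1) by (intro eqv_step) (auto simp: zz_step_def)
qed

lemma eqv_drop_id:
  assumes "Z \<in> zigs x z"
  shows "eqv (zcons x x [x] [x] Z) Z"
proof -
  have "\<exists>xs b ys g gs fs. Z = Zigzag (x # xs) (b # ys) (g # gs) fs \<and> g \<in> homs x b"
    using assms by (cases rule: zigzag_cases) (auto simp: zcons_def)
  then obtain xs b ys g gs fs where Z: "Z = Zigzag (x # xs) (b # ys) (g # gs) fs" "g \<in> homs x b"
    by blast
  have g: "cat [x] g = g" using homs_path[OF Z(2)] by (simp add: cat_single)
  have "x \<in> cells X" using homs_V[OF Z(2)] by simp
  then show ?thesis
    using eqv_split_first(1)[of x xs b ys "[x]" g gs fs z x] Z assms g by (simp add: homs_single)
qed

section \<open>Canonical zigzags and completeness of the reduced word\<close>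

fun canon :: "'a set list \<Rightarrow> ('a set, 'a set list) zigzag"
  where
    "canon (x # y # p) = (if dn x y then zcons x y [x, y] [y] (canon (y # p))
      else zcons x x [x] [y, x] (canon (y # p)))"
  | "canon [x] = Zigzag [x] [x] [[x]] []"
  | "canon [] = Zigzag [] [] [] []"

lemma canon: "path p \<Longrightarrow> canon p \<in> zigs (hd p) (last p) \<and> zword (canon p) = p"
proof (induction p rule: induct_list012)
  case (2 x)
  then show ?case by (auto simp: zigzags_single zword_single path_def homs_single)
next
  case (3 x y p)
  have IH: "canon (y # p) \<in> zigs y (last (y # p))" "zword (canon (y # p)) = y # p"
    using 3 by (auto simp: path_Cons)
  have V: "x \<in> cells X" "y \<in> cells X" using 3(3) by (auto simp: path_def)
  show ?case
  proof (cases "dn x y")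
    case True
    then show ?thesis
      using IH arrs_id[OF V(2)] by (auto simp: zigzags_zcons zword_zcons homs_pair cat_def)
  next
    case False
    then have "pr x y" using 3(3) by (auto simp: path_Cons step_def)
    then show ?thesis
      using IH arrs_pr[of x y] V False by (auto simp: zigzags_zcons zword_zcons homs_single cat_def)
  qed
qed (simp add: path_def)

lemma eqv_canon_cons:
  assumes "path (x # p)" "path (x # p')" "eqv (canon (x # p)) (canon (x # p'))" "step y x"
  shows "eqv (canon (y # x # p)) (canon (y # x # p'))"
proof -
  have Z: "canon (x # p) \<in> zigs x (last (x # p))" using canon[OF assms(1)] by simp
  have V: "x \<in> cells X" "y \<in> cells X"
    using assms dn_V pr by (auto simp: step_def path_def)
  show ?thesis
  proof (cases "dn y x")
    case True
    then show ?thesis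
      using eqv_zcons[OF assms(3) Z _ arrs_id[OF V(1)], of "[y, x]" y] by (simp add: homs_pair)
  next
    case False
    then have "pr y x" using assms(4) by (simp add: step_def)
    then show ?thesis
      using eqv_zcons[OF assms(3) Z _ arrs_pr, of "[y]" y] False V by (simp add: homs_single)
  qed
qed

text \<open>Cuts the first right-pointing arrow into single down steps, peeling them off one at a
  time until only an identity remains; that case is the assumption \<open>id\<close>.\<close>

lemma eqv_canon_first:
  assumes "Zigzag (x # xs) (b # ys) (g # gs) fs \<in> zigs x z"
    and id: "eqv (Zigzag (b # xs) (b # ys) ([b] # gs) fs) (canon (word ([b] # gs) fs))"
  shows "eqv (Zigzag (x # xs) (b # ys) (g # gs) fs) (canon (word (g # gs) fs))"
proof -
  have "g \<in> homs x b" using assms(1) by (auto simp: zigzags_def)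
  then show ?thesis
    using assms(1)
  proof (induction g arbitrary: x rule: induct_list012)
    case (2 a)
    then show ?case using id by (auto simp: homs_single)
  next
    case (3 a c g)
    have ax: "a = x" "dn x c" and cg: "c # g \<in> homs c b"
      using 3(3) by (auto simp: homs_Cons)
    have acg: "cat [x, c] (c # g) = a # c # g" using ax by (simp add: cat_def)
    let ?Z1 = "Zigzag (c # xs) (b # ys) ((c # g) # gs) fs"
    have xc: "[x, c] \<in> homs x c" using ax by (simp add: homs_pair)
    have split: "eqv (zcons x c [x, c] [c] ?Z1) (Zigzag (x # xs) (b # ys) ((a # c # g) # gs) fs)"
      "?Z1 \<in> zigs c z"
      using eqv_split_first[OF _ xc cg, of xs ys gs fs z] 3(4) acg by simp_all
    have "eqv ?Z1 (canon (word ((c # g) # gs) fs))"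
      by (rule 3(2)[OF cg split(2)])
    then have e: "eqv (zcons x c [x, c] [c] ?Z1) (zcons x c [x, c] [c] (canon (word ((c # g) # gs) fs)))"
      using eqv_zcons[OF _ split(2) xc arrs_id] homs_V[OF cg] by simp
    have w: "word ((a # c # g) # gs) fs = a # word ((c # g) # gs) fs"
      by (cases fs) (auto simp: cat_def)
    obtain r where r: "word ((c # g) # gs) fs = c # r"
      by (cases fs) (auto simp: cat_def)
    have "canon (word ((a # c # g) # gs) fs) = zcons x c [x, c] [c] (canon (word ((c # g) # gs) fs))"
      unfolding w r using ax by simp
    then show ?case
      using eqv_trans[OF eqv_sym[OF split(1)] e] by simp
  qed (simp add: homs)
qed

lemma eqv_canon_word: "Z \<in> zigs w z \<Longrightarrow> eqv Z (canon (zword Z))"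
proof (induction rule: zigzag_induct)
  case (single w g)
  have "eqv (Zigzag [w] [z] [g] []) (canon (word [g] []))"
  proof (rule eqv_canon_first)
    show "Zigzag [w] [z] [g] [] \<in> zigs w z"
      using single by (simp add: zigzags_single)
  qed (simp add: eqv_refl)
  then show ?case by (simp add: zword_def)
next
  case (zcons w y x' g f Z)
  have Z: "zword Z \<noteq> []" "hd (zword Z) = x'" using zword[OF zcons(3)] by auto
  have y: "y \<in> cells X" using homs_V[OF zcons(1)] by simp
  have "eqv (zcons y y [y] f Z) (canon (word ([y] # zg Z) (f # zf Z)))"
  proof (cases "f = [y]")
    case True
    then have "[y] \<in> arrs x' y" using zcons(2) by simp
    then have "x' = y" unfolding arrs by (elim disjE conjE) (assumption, simp)
    then have "eqv (zcons y y [y] f Z) (canon (zword Z))"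
      using eqv_trans[OF eqv_drop_id[of Z y z] zcons(4)] zcons(3) True by simp
    then show ?thesis
      using True Z \<open>x' = y\<close> by (simp add: cat_single flip: zword_def)
  next
    case False
    then have f: "pr y x'" "f = [x', y]" using zcons(2) unfolding arrs by (elim disjE; simp)+
    have "eqv (zcons y y [y] f Z) (zcons y y [y] f (canon (zword Z)))"
      using eqv_zcons[OF zcons(4,3) _ zcons(2), of "[y]" y] y by (simp add: homs_single)
    moreover obtain r where r: "zword Z = x' # r" using Z by (cases "zword Z") auto
    moreover have "\<not> dn y x'" using f(1) dn_not_pr by blast
    ultimately show ?thesis
      using f by (simp add: cat_def flip: zword_def)
  qed
  then have id: "eqv (Zigzag (y # zx Z) (y # zy Z) ([y] # zg Z) (f # zf Z)) (canon (word ([y] # zg Z) (f # zf Z)))"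
    by (simp add: zcons_def)
  have "zcons w y g f Z \<in> zigs w z"
    using zcons by (auto simp: zigzags_zcons)
  then have "eqv (zcons w y g f Z) (canon (word (g # zg Z) (f # zf Z)))"
    unfolding zcons_def using id by (rule eqv_canon_first)
  then show ?case by (simp add: zword_def zcons_def)
qed

text \<open>Cancellation comes from the vertical relation. For a step down and back up, the regular
  arrow serves as component \<open>u\<close> on the first middle object; for a step up and back
  down, as component \<open>v\<close> on the second source. All other components are
  identities.\<close>

lemma eqv_canon_back:
  assumes "path (x # p)" "pr x y \<or> pr y x"
  shows "eqv (canon (x # y # x # p)) (canon (x # p))"
proof -
  let ?W = "canon (x # p)" and ?z = "last (x # p)"
  have W: "?W \<in> zigs x ?z" using canon[OF assms(1)] by simp
  have V: "x \<in> cells X" "y \<in> cells X" using assms(2) pr by blast+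
  have refl: "zz_map_from C S (=) [x] ?W ?W" using zz_map_from_refl[OF W] by simp
  note drop = eqv_drop_id[OF W]
  show ?thesis
    using assms(2)
  proof
    assume p: "pr y x"
    then have d: "dn x y" "\<not> dn y x" using pr_dn dn_trans dn_irrefl by blast+
    let ?Z = "zcons x y [x, y] [x, y] ?W"
    have Z: "?Z \<in> zigs x ?z"
      using d by (intro zcons_zigs[OF _ arrs_pr[OF p] W]) (simp add: homs_pair)
    have "?Z = Zigzag (x # zx ?W) (y # zy ?W) (cat [x, y] [y] # zg ?W) ([x, y] # zf ?W)"
      by (simp add: zcons_def cat_def)
    then have "eqv (zcons x y [x, y] [y] (zcons y y [y] [x, y] ?W)) ?Z"
      using eqv_split_first(1)[of x "zx ?W" y "zy ?W" "[x, y]" "[y]" "zg ?W" "[x, y] # zf ?W" ?z y] Z d V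
      by (simp add: homs_pair homs_single zcons_def)
    then have 1: "eqv (canon (x # y # x # p)) ?Z"
      using d by simp
    have "zz_map C S (=) (zcons x x [x] [x] ?W) ?Z"
    proof -
      have "zz_map_from C S (=) [x] (zcons x x [x] [x] ?W) ?Z"
        by (rule zz_map_from_zconsI[OF W refl arrs_id[OF V(1)] arrs_pr[OF p]])
          (simp_all add: cat_def)
      then show ?thesis
        by (simp add: zz_map_iff_from zcons_def Ent_simps)
    qed
    moreover have "zcons x x [x] [x] ?W \<in> zigs x ?z"
      using V by (intro zcons_zigs[OF _ arrs_id[OF V(1)] W]) (simp add: homs_single)
    ultimately have "eqv (zcons x x [x] [x] ?W) ?Z"
      using Z by (intro eqv_step) (auto simp: zz_step_def)
    then show ?thesis
      using 1 drop eqv_trans eqv_sym by blast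
  next
    assume p: "pr x y"
    then have d: "dn y x" "\<not> dn x y" using pr_dn dn_trans dn_irrefl by blast+
    let ?W1 = "zcons y x [y, x] [x] ?W" and ?W2 = "zcons x x [x] [x] ?W"
    have h: "[x] \<in> homs x x" "[y, x] \<in> homs y x"
      using V d by (simp_all add: homs_single homs_pair)
    have W1: "?W1 \<in> zigs y ?z" and W2: "?W2 \<in> zigs x ?z"
      by (rule zcons_zigs[OF h(2) arrs_id[OF V(1)] W], rule zcons_zigs[OF h(1) arrs_id[OF V(1)] W])
    have Z1: "zcons x x [x] [y, x] ?W1 \<in> zigs x ?z" and Z2: "zcons x x [x] [x] ?W2 \<in> zigs x ?z"
      by (rule zcons_zigs[OF h(1) arrs_pr[OF p] W1], rule zcons_zigs[OF h(1) arrs_id[OF V(1)] W2])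
    have "zz_map_from C S (=) [y, x] ?W1 ?W2"
      by (rule zz_map_from_zconsI[OF W refl arrs_pr[OF p] arrs_id[OF V(1)]])
        (simp_all add: cat_def)
    then have "zz_map_from C S (=) [x] (zcons x x [x] [y, x] ?W1) (zcons x x [x] [x] ?W2)"
      by (rule zz_map_from_zconsI[OF W1 _ arrs_id[OF V(1)] arrs_id[OF V(1)]])
        (simp_all add: cat_def)
    then have "zz_map C S (=) (zcons x x [x] [y, x] ?W1) (zcons x x [x] [x] ?W2)"
      unfolding zz_map_iff_from by (simp add: zcons_def Ent_simps)
    then have "eqv (zcons x x [x] [y, x] ?W1) (zcons x x [x] [x] ?W2)"
      using Z1 Z2 by (intro eqv_step) (auto simp: zz_step_def)
    moreover have "eqv (zcons x x [x] [x] ?W2) ?W2"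
      by (rule eqv_drop_id[OF W2])
    ultimately have "eqv (zcons x x [x] [y, x] ?W1) ?W"
      using drop eqv_trans by blast
    then show ?thesis using d by simp
  qed
qed

lemma eqv_canon_red: "path p \<Longrightarrow> eqv (canon p) (canon (red p))"
proof (induction p rule: induct_list012)
  case (3 x y p)
  have st: "step x y" and pp: "path (y # p)"
    using 3(3) by (auto simp: path_Cons)
  obtain s where s: "red (y # p) = y # s" by (rule red_Cons)
  have ps: "path (y # s)" using path_red[OF pp] s by simp
  have "eqv (canon (y # p)) (canon (y # s))" using 3(2)[OF pp] s by simp
  then have 1: "eqv (canon (x # y # p)) (canon (x # y # s))"
    by (rule eqv_canon_cons[OF pp ps _ st])
  show ?case
  proof (cases "\<exists>t. s = x # t")
    case True
    then obtain t where t: "s = x # t" by auto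
    have "pr x y \<or> pr y x"
      using step_back[OF st] ps t by (simp add: path_Cons)
    moreover have "path (x # t)" using ps t by (simp add: path_Cons)
    ultimately have "eqv (canon (x # y # s)) (canon (x # t))"
      using eqv_canon_back t by blast
    moreover have "red (x # y # p) = x # t" using s t by simp
    ultimately show ?thesis using 1 eqv_trans by metis
  next
    case False
    then have "red (x # y # p) = x # y # s"
      using s by (cases s) auto
    then show ?thesis using 1 by metis
  qed
qed (simp_all add: eqv_refl)

text \<open>Each zigzag is equivalent to the canonical zigzag of its reduced word, and that word is
  invariant under both relations.\<close>

lemma eqv_iff:
  assumes "Z \<in> zigs w z" "Z' \<in> zigs w z"
  shows "eqv Z Z' \<longleftrightarrow> red (zword Z) = red (zword Z')"
proof
  assume "red (zword Z) = red (zword Z')"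
  moreover have "eqv Z (canon (red (zword Z)))" if "Z \<in> zigs w z" for Z
    using that eqv_canon_word eqv_canon_red zword eqv_trans by blast
  ultimately show "eqv Z Z'"
    using assms eqv_sym eqv_trans by metis
qed (rule eqv_word)

text \<open>Each step of \<open>p\<close> becomes one piece of both zigzags. Subdivision takes place
  inside a right-pointing arrow, so the lengths agree and identities serve as vertical
  components.\<close>

lemma ref_zz_map:
  assumes "ref p q"
  shows "\<exists>Z\<in>zigs (hd p) (last p). \<exists>Z'\<in>zigs (hd p) (last p). zword Z = q \<and> zword Z' = p \<and>
    zz_map_from C S subseq [hd p] Z Z'"
  using assms
proof (induction rule: ref.induct)
  case (single x)
  then have "Zigzag [x] [x] [[x]] [] \<in> zigs x x"
    by (simp add: zigzags_single homs_single)
  moreover from this have "zz_map_from C S subseq [x] (Zigzag [x] [x] [[x]] []) (Zigzag [x] [x] [[x]] [])"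
    by (rule zz_map_from_refl) simp
  moreover have "zword (Zigzag [x] [x] [[x]] []) = [x]"
    by (simp add: zword_single)
  ultimately show ?case
    by (simp only: list.sel last.simps simp_thms if_True) blast
next
  case (Cons x m y p q)
  then obtain Z Z' where Z: "Z \<in> zigs y (last (y # p))" "Z' \<in> zigs y (last (y # p))" "zword Z = y # q"
    "zword Z' = y # p" "zz_map_from C S subseq [y] Z Z'" by auto
  have V: "x \<in> cells X" "y \<in> cells X" using mid_step[OF Cons.hyps(1)] dn_V pr by (auto simp: step_def)
  have lst: "last (x # y # p) = last (y # p)" by simp
  show ?case
  proof (cases "dn x y")
    case True
    have "sorted_wrt dn (x # m @ [y])" using mid_dn[OF Cons.hyps(1) True] .
    then have g: "x # m @ [y] \<in> homs x y"
      using V dn_V by (auto simp: homs sorted_wrt_append)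
    let ?Z = "zcons x y (x # m @ [y]) [y] Z" and ?Z' = "zcons x y [x, y] [y] Z'"
    have "?Z \<in> zigs x (last (y # p))" "?Z' \<in> zigs x (last (y # p))"
      using Z g True arrs_id[OF V(2)] by (auto simp: zigzags_zcons homs_pair)
    moreover have "zword ?Z = x # m @ y # q" "zword ?Z' = x # y # p"
      using Z by (simp_all add: zword_zcons cat_def)
    moreover have "zz_map_from C S subseq [x] ?Z ?Z'"
      by (rule zz_map_from_zconsI[OF Z(1,5) arrs_id[OF V(1)] arrs_id[OF V(2)]])
        (simp_all add: cat_def list_emb_append2)
    ultimately show ?thesis unfolding lst list.sel by blast
  next
    case False
    then have p: "pr x y" "m = []" using Cons.hyps(1) dn_trans by (auto simp: mid_def)
    let ?Z = "zcons x x [x] [y, x] Z" and ?Z' = "zcons x x [x] [y, x] Z'"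
    have "?Z \<in> zigs x (last (y # p))" "?Z' \<in> zigs x (last (y # p))"
      using Z arrs_pr[OF p(1)] V by (auto simp: zigzags_zcons homs_single)
    moreover have "zword ?Z = x # m @ y # q" "zword ?Z' = x # y # p"
      using Z p(2) by (simp_all add: zword_zcons cat_def)
    moreover have "zz_map_from C S subseq [x] ?Z ?Z'"
      by (rule zz_map_from_zconsI[OF Z(1,5) arrs_id[OF V(1)] arrs_id[OF V(1)]])
        (simp_all add: cat_def)
    ultimately show ?thesis unfolding lst list.sel by blast
  qed
qed

lemma subseq_set: "subseq p q \<Longrightarrow> set p \<subseteq> set q"
proof
  fix x assume "subseq p q" "x \<in> set p"
  then show "x \<in> set q" by (rule list_emb_set) simp
qed

section \<open>Hom posets of the localization as posets of reduced words\<close>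

definition key :: "('a set, 'a set list) zigzag set \<Rightarrow> 'a set list"
  where "key A = red (zword (SOME Z. Z \<in> A))"

abbreviation "LC \<equiv> Loc C S"

lemma Loc_hom: "A \<in> Hom LC w z \<longleftrightarrow> (\<exists>Z\<in>zigs w z. A = {Z'. eqv Z Z'})"
  by (auto simp: Loc_def quotient_def zz_equiv_def eqv_def)

lemma Loc_hom_class:
  assumes "A \<in> Hom LC w z"
  shows "A \<noteq> {}" "Z \<in> A \<Longrightarrow> Z \<in> zigs w z" "Z \<in> A \<Longrightarrow> key A = red (zword Z)"
    "Z \<in> zigs w z \<Longrightarrow> key A = red (zword Z) \<Longrightarrow> Z \<in> A"
proof -
  obtain Z0 where Z0: "Z0 \<in> zigs w z" "A = {Z'. eqv Z0 Z'}"
    using assms Loc_hom by blast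
  show "A \<noteq> {}" using Z0 eqv_refl by blast
  show zig: "Z \<in> zigs w z" if "Z \<in> A" for Z using that Z0 eqv_zigs by blast
  show key: "key A = red (zword Z)" if "Z \<in> A" for Z
  proof -
    have "(SOME Z. Z \<in> A) \<in> A" using that by (rule someI)
    then have "eqv Z0 (SOME Z. Z \<in> A)" "eqv Z0 Z" using that Z0 by auto
    then show ?thesis unfolding key_def using eqv_word by metis
  qed
  show "Z \<in> A" if "Z \<in> zigs w z" "key A = red (zword Z)"
    using that key[of Z0] Z0 eqv_iff[OF Z0(1) that(1)] eqv_refl by simp
qed

lemma key_bij: "bij_betw key (Hom LC w z) (reduced_paths w z)"
proof (rule bij_betwI')
  fix A B assume A: "A \<in> Hom LC w z" and B: "B \<in> Hom LC w z"
  show "key A = key B \<longleftrightarrow> A = B"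
    using Loc_hom_class[OF A] Loc_hom_class[OF B] by (metis subsetI subset_antisym)
next
  fix A assume A: "A \<in> Hom LC w z"
  then obtain Z where Z: "Z \<in> A" "Z \<in> zigs w z" using Loc_hom_class by blast
  show "key A \<in> reduced_paths w z"
    using zword[OF Z(2)] Loc_hom_class(3)[OF A Z(1)]
    by (simp add: reduced_paths_def path_red reduced_red hd_red last_red)
next
  fix p assume p: "p \<in> reduced_paths w z"
  then have c: "canon p \<in> zigs w z" "zword (canon p) = p"
    using canon[of p] by (auto simp: reduced_paths_def)
  then have "{Z'. eqv (canon p) Z'} \<in> Hom LC w z" using Loc_hom by blast
  then show "\<exists>A\<in>Hom LC w z. p = key A"
    using Loc_hom_class(3)[of _ w z "canon p"] eqv_refl[of "canon p"] c p red_reduced[of p]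
    by (intro bexI[of _ "{Z'. eqv (canon p) Z'}"]) (simp_all add: reduced_paths_def)
qed

text \<open>A map of zigzags spells a refinement up to reduction, which \<open>ref_red\<close> moves
  to the reduced words. Conversely \<open>ref_zz_map\<close> realizes a refinement of
  \<open>key B\<close>, and its two zigzags lie in the classes \<open>A\<close> and \<open>B\<close>
  because their words reduce to the keys.\<close>

lemma Loc_le_iff:
  assumes A: "A \<in> Hom LC w z" and B: "B \<in> Hom LC w z"
  shows "Le LC B A \<longleftrightarrow> leq (key A) (key B)"
proof
  assume "Le LC B A"
  then obtain Z' Z where Z: "Z' \<in> B" "Z \<in> A" "zz_map C S subseq Z Z'"
    by (auto simp: Loc_def Ent_simps)
  have zz: "Z \<in> zigs w z" "Z' \<in> zigs w z"
    using Z Loc_hom_class(2) A B by blast+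
  have "zz_map_from C S subseq [w] Z Z'"
    using Z(3) zigzags_zx[OF zz(1)] by (simp add: zz_map_iff_from Ent_simps)
  then have "\<exists>q' q. ref q' q \<and> red q' = red (cat [w] (zword Z')) \<and> red q = red (zword Z) \<and>
      path q' \<and> path q \<and> hd q' = w \<and> hd q = w"
    using zz_map_from_word[of subseq ref, OF _ ref_refl ref_cat zz]
      homs_subset_ref subseq_set by blast
  then obtain q' q where q: "ref q' q" "red q' = red (zword Z')" "red q = red (zword Z)"
    using zword[OF zz(2)] by (auto simp: cat_single)
  obtain r where "ref (red q') r" "red r = red q"
    using ref_red[OF q(1)] by blast
  then show "leq (key A) (key B)"
    using q Loc_hom_class(3)[OF A Z(2)] Loc_hom_class(3)[OF B Z(1)] by (auto simp: leq_def)
next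
  assume "leq (key A) (key B)"
  then obtain q where q: "ref (key B) q" "red q = key A" by (auto simp: leq_def)
  have kB: "key B \<in> reduced_paths w z" using key_bij B by (auto simp: bij_betw_def)
  obtain Z Z' where Z: "Z \<in> zigs w z" "Z' \<in> zigs w z" "zword Z = q" "zword Z' = key B"
    "zz_map_from C S subseq [w] Z Z'"
    using ref_zz_map[OF q(1)] kB by (auto simp: reduced_paths_def)
  have "Z \<in> A" "Z' \<in> B"
    using Loc_hom_class(4)[OF A Z(1)] Loc_hom_class(4)[OF B Z(2)] Z q kB
    by (auto simp: reduced_paths_def red_reduced)
  moreover have "zz_map C S subseq Z Z'"
    using Z(5) zigzags_zx[OF Z(1)] by (simp add: zz_map_iff_from Ent_simps)
  ultimately show "Le LC B A"
    by (auto simp: Loc_def Ent_simps)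
qed

theorem Loc_face_poset:
  assumes fin: "finite (reduced_paths w z)"
  shows "is_face_poset (Hom LC w z) (\<lambda>A B. Le LC B A)"
proof (rule is_face_poset_if_fans[where dim = "\<lambda>A. exc (key A)"])
  let ?H = "Hom LC w z"
  have k: "key A \<in> reduced_paths w z" if "A \<in> ?H" for A
    using key_bij that by (auto simp: bij_betw_def)
  show "finite ?H"
    using fin key_bij bij_betw_finite by blast
  show "Le LC A A" if "A \<in> ?H" for A
    unfolding Loc_le_iff[OF that that] using k[OF that] leq_refl by (simp add: reduced_paths_def)
  show "Le LC D A" if "A \<in> ?H" "B \<in> ?H" "D \<in> ?H" "Le LC B A" "Le LC D B" for A B D
    using that leq_trans[of "key A" "key B" "key D"] by (simp add: Loc_le_iff)
  show "exc (key A) < exc (key B)" if "A \<in> ?H" "B \<in> ?H" "Le LC B A" "A \<noteq> B" for A B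
  proof -
    have "key A \<noteq> key B"
      using that key_bij by (metis bij_betw_imp_inj_on inj_onD)
    then show ?thesis
      using that k[OF that(2)] exc_less[of "key A" "key B"] by (simp add: Loc_le_iff reduced_paths_def)
  qed
  fix B assume B: "B \<in> ?H"
  obtain \<sigma> where \<sigma>: "bij_betw \<sigma> {a \<in> reduced_paths w z. leq a (key B)} (gap_chains (key B))"
    "\<forall>a a'. leq a (key B) \<longrightarrow> leq a' (key B) \<longrightarrow> (leq a a' \<longleftrightarrow> \<sigma> a' \<subseteq> \<sigma> a)"
    using lower_set_fan[OF k[OF B]] by (elim exE conjE) (rule that)
  have path: "path (key B)" using k[OF B] by (simp add: reduced_paths_def)
  have "bij_betw key {A \<in> ?H. Le LC B A} {a \<in> reduced_paths w z. leq a (key B)}"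
  proof -
    have "key ` {A \<in> ?H. Le LC B A} = {a \<in> reduced_paths w z. leq a (key B)}"
    proof (intro equalityI subsetI)
      fix a assume "a \<in> key ` {A \<in> ?H. Le LC B A}"
      then show "a \<in> {a \<in> reduced_paths w z. leq a (key B)}"
        using Loc_le_iff B k by auto
    next
      fix a assume a: "a \<in> {a \<in> reduced_paths w z. leq a (key B)}"
      then have "a \<in> key ` ?H"
        using key_bij[of w z] by (simp add: bij_betw_def)
      then obtain A where "A \<in> ?H" "a = key A" by auto
      then show "a \<in> key ` {A \<in> ?H. Le LC B A}"
        using a Loc_le_iff[OF \<open>A \<in> ?H\<close> B] by simp
    qed
    then show ?thesis
      using inj_on_subset[OF bij_betw_imp_inj_on[OF key_bij[of w z]]] by (simp add: bij_betw_def)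
  qed
  then have bij: "bij_betw (\<sigma> \<circ> key) {A \<in> ?H. Le LC B A} (gap_chains (key B))"
    using \<sigma>(1) by (rule bij_betw_trans)
  have iff: "Le LC A' A \<longleftrightarrow> (\<sigma> \<circ> key) A' \<subseteq> (\<sigma> \<circ> key) A"
    if "A \<in> ?H" "A' \<in> ?H" "Le LC B A" "Le LC B A'" for A A'
  proof -
    have "leq (key A) (key B)" "leq (key A') (key B)"
      using that B by (simp_all only: Loc_le_iff)
    then show ?thesis
      using \<sigma>(2) unfolding Loc_le_iff[OF that(1,2)] o_apply by (intro \<sigma>(2)[rule_format])
  qed
  show "\<exists>(D :: (nat \<times> 'a set) set) J (E :: (nat \<times> 'v) set) r \<sigma>. complete_fan D J E r \<and>
      card E = exc (key B) \<and> bij_betw \<sigma> {A \<in> ?H. Le LC B A} J \<and>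
      (\<forall>A A'. A \<in> ?H \<longrightarrow> A' \<in> ?H \<longrightarrow> Le LC B A \<longrightarrow> Le LC B A' \<longrightarrow> (Le LC A' A \<longleftrightarrow> \<sigma> A' \<subseteq> \<sigma> A))"
    by (intro exI conjI allI impI, rule complete_fan_path[OF path])
      (simp add: card_coords[OF path], rule bij, rule iff)
qed

end

section \<open>Discrete Morse functions on geometric simplicial complexes\<close>

locale discrete_morse_complex = morse_complex X f vt
  for X :: "'a cw" and f :: "'a set \<Rightarrow> real" and vt :: "'a set \<Rightarrow> 'v set" +
  assumes morse: "discrete_morse X f"
    and card_vt: "x \<in> cells X \<Longrightarrow> card (vt x) = Suc (cdim X x)"
begin

definition below :: "'a set \<Rightarrow> 'a set \<Rightarrow> bool"
  where "below y x \<longleftrightarrow> cdim X y < cdim X x \<or> cdim X y = cdim X x \<and> f y < f x"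

definition rank :: "'a set \<Rightarrow> nat"
  where "rank x = card {y \<in> cells X. below y x}"

lemma rank_less: "y \<in> cells X \<Longrightarrow> below y x \<Longrightarrow> rank y < rank x"
  unfolding rank_def
proof (rule psubset_card_mono)
  assume y: "y \<in> cells X" "below y x"
  have "{u \<in> cells X. below u y} \<subseteq> {u \<in> cells X. below u x}"
    using y(2) by (auto simp: below_def)
  moreover have "y \<in> {u \<in> cells X. below u x}" "y \<notin> {u \<in> cells X. below u y}"
    using y by (auto simp: below_def)
  ultimately show "{u \<in> cells X. below u y} \<subset> {u \<in> cells X. below u x}"
    by blast
qed (use finite_V in simp)

lemma dn_cdim: "dn x y \<Longrightarrow> cdim X y < cdim X x"
  using card_vt[of x] card_vt[of y] finite_vt[of x] psubset_card_mono[of "vt x" "vt y"]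
  by (auto simp: dn_def)

text \<open>If \<open>y\<close> has the dimension of \<open>x\<close>, it is a second facet of
  \<open>t\<close>. The Morse condition at \<open>t\<close> already admits \<open>x\<close>, so
  \<open>f y < f t\<close>, and \<open>f t\<close> is at most \<open>f x\<close>.\<close>

lemma pr_dn_below:
  assumes "pr x t" "dn t y" "y \<noteq> x"
  shows "below y x"
proof -
  have t: "x \<in> cells X" "t \<in> cells X" "y \<in> cells X" "cdim X t = cdim X x + 1" "cell_less X x t"
    "f x \<ge> f t" "cell_less X y t"
    using assms cell_less_iff by (auto simp: regular_pair_def dn_def)
  show ?thesis
  proof (cases "cdim X y = cdim X x")
    case True
    have "\<not> f y \<ge> f t"
      using morse t True assms(3) unfolding discrete_morse_def Uniq_def by metis
    then show ?thesis
      using True t(6) by (simp add: below_def)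
  next
    case False
    then show ?thesis
      using dn_cdim[OF assms(2)] t(4) by (simp add: below_def)
  qed
qed

text \<open>An up step is followed by a down step, which in a reduced path does not lead back, so
  the rank falls at least once in two steps. The summand 2 allows for a final up step.\<close>

lemma length_reduced_path: "path p \<Longrightarrow> reduced p \<Longrightarrow> length p \<le> 2 * rank (hd p) + 2"
proof (induction "length p" arbitrary: p rule: less_induct)
  case less
  consider "p = []" | x where "p = [x]" | x y q where "p = x # y # q"
    by (cases p rule: remdups_adj.cases) auto
  then show ?case
  proof cases
    case (3 x y q)
    have q: "path (y # q)" "reduced (y # q)" "step x y"
      using less.prems 3 reduced_tl by (auto simp: path_Cons)
    show ?thesis
    proof (cases "dn x y")
      case True
      then have "rank y < rank x"
        using dn_cdim dn_V by (intro rank_less) (auto simp: below_def)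
      moreover have "length (y # q) \<le> 2 * rank y + 2"
        using less.hyps[of "y # q"] q 3 by simp
      ultimately show ?thesis using 3 by simp
    next
      case False
      then have p: "pr x y" using q(3) by (simp add: step_def)
      show ?thesis
      proof (cases q)
        case Nil
        then show ?thesis using 3 by simp
      next
        case (Cons t r)
        have r: "path (t # r)" "reduced (t # r)" "step y t" "t \<noteq> x"
          using q less.prems(2) 3 Cons reduced_tl[of y "t # r"] by (auto simp: path_Cons)
        have "dn y t"
          using r(3) pr_pr[OF p] by (simp add: step_def)
        then have "rank t < rank x"
          using pr_dn_below[OF p] r(4) dn_V by (intro rank_less) auto
        moreover have "length (t # r) \<le> 2 * rank t + 2"
          using less.hyps[of "t # r"] r 3 Cons by simp
        ultimately show ?thesis using 3 Cons by simp
      qed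
    qed
  qed (use less.prems in \<open>simp_all add: path_def\<close>)
qed

lemma finite_reduced_paths: "finite (reduced_paths w z)"
proof (rule finite_subset)
  have "rank x \<le> card (cells X)" for x
    unfolding rank_def using finite_V by (intro card_mono) auto
  then have "length p \<le> 2 * card (cells X) + 2" if "path p" "reduced p" for p
    using length_reduced_path[OF that] by (meson add_le_mono1 le_trans mult_le_mono2)
  then show "reduced_paths w z \<subseteq> {p. set p \<subseteq> cells X \<and> length p \<le> 2 * card (cells X) + 2}"
    by (auto simp: reduced_paths_def path_def)
  show "finite {p. set p \<subseteq> cells X \<and> length p \<le> 2 * card (cells X) + 2}"
    using finite_V by (rule finite_lists_length_le)
qed

lemma Flo_hom_face_poset:
  assumes "w \<in> Ob (Flo X f)" "z \<in> Ob (Flo X f)"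
  shows "is_face_poset (Hom (Flo X f) w z) (\<lambda>a b. Le (Flo X f) b a)"
proof -
  have "Hom (Flo X f) w z = Hom (Loc (Ent X) (morse_system X f)) w z"
    using assms by (simp add: Flo_def full_sub_pcat_def)
  moreover have "Le (Flo X f) = Le (Loc (Ent X) (morse_system X f))"
    by (simp add: Flo_def full_sub_pcat_def)
  ultimately show ?thesis
    using Loc_face_poset[OF finite_reduced_paths] by simp
qed

end

text \<open>Cells are relative interiors of simplices; the closure restores the simplex, and its
  extreme points are its vertices.\<close>

definition vertices :: "'a::euclidean_space set \<Rightarrow> 'a set"
  where "vertices e = {v. v extreme_point_of closure e}"

lemma simplex_facts:
  assumes "n simplex S"
  shows "vertices (rel_interior S) = {v. v extreme_point_of S}"
    and "closed S" "convex S" "closure (rel_interior S) = S"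
    and "finite (vertices (rel_interior S))" "\<not> affine_dependent (vertices (rel_interior S))"
    and "S = convex hull vertices (rel_interior S)"
    and "int (card (vertices (rel_interior S))) = aff_dim S + 1"
proof -
  obtain C where C: "finite C" "\<not> affine_dependent C" "int (card C) = n + 1" "S = convex hull C"
    using assms simplex by blast
  show cl: "closed S" and cv: "convex S"
    using C by (simp_all add: finite_imp_compact_convex_hull compact_imp_closed)
  then show cri: "closure (rel_interior S) = S"
    by (simp add: convex_closure_rel_interior)
  then show 1: "vertices (rel_interior S) = {v. v extreme_point_of S}"
    by (simp add: vertices_def)
  have v: "vertices (rel_interior S) = C"
    using extreme_point_of_convex_hull_affine_independent[OF C(2)] C(4) 1 by auto
  show "finite (vertices (rel_interior S))" "\<not> affine_dependent (vertices (rel_interior S))"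
    "S = convex hull vertices (rel_interior S)"
    using C v by simp_all
  show "int (card (vertices (rel_interior S))) = aff_dim S + 1"
    using C v aff_dim_simplex[OF assms] by simp
qed

lemma vertices_hull:
  assumes "\<not> affine_dependent C"
  shows "vertices (rel_interior (convex hull C)) = C"
proof -
  have "(int (card C) - 1) simplex (convex hull C)"
    using assms by (intro simplex_convex_hull) simp
  then show ?thesis
    using simplex_facts(1) extreme_point_of_convex_hull_affine_independent[OF assms] by auto
qed

section \<open>Geometric simplicial complexes in terms of vertex sets\<close>

locale geometric_complex =
  fixes K :: "'a::euclidean_space set set"
  assumes K: "simplicial_complex K"
begin

abbreviation "X \<equiv> simplicial_cw K"

lemma K_simplex: "S \<in> K \<Longrightarrow> \<exists>n. n simplex S"
  and K_face: "S \<in> K \<Longrightarrow> F face_of S \<Longrightarrow> F \<in> K"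
  and K_Int: "S \<in> K \<Longrightarrow> T \<in> K \<Longrightarrow> (S \<inter> T) face_of S"
  and K_finite: "finite K"
  using K unfolding simplicial_complex_def by blast+

lemma cells: "x \<in> cells X \<longleftrightarrow> (\<exists>S. S \<in> K \<and> S \<noteq> {} \<and> x = rel_interior S)"
  by (auto simp: simplicial_cw_def)

text \<open>A simplex contained in \<open>T\<close> is its intersection with \<open>T\<close>, hence
  a face of \<open>T\<close>, hence spanned by some of the vertices of \<open>T\<close>.\<close>

lemma subset_iff_vertices:
  assumes "S \<in> K" "T \<in> K"
  shows "S \<subseteq> T \<longleftrightarrow> vertices (rel_interior S) \<subseteq> vertices (rel_interior T)"
proof
  obtain n m where s: "n simplex S" "m simplex T" using K_simplex assms by blast
  note S = simplex_facts[OF s(1)] and T = simplex_facts[OF s(2)]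
  {
    assume "S \<subseteq> T"
    then have "S face_of T"
      using K_Int[OF assms(2,1)] by (simp add: inf.absorb2)
    then have "S face_of convex hull vertices (rel_interior T)"
      using T(7) by simp
    then obtain c where c: "c \<subseteq> vertices (rel_interior T)" "S = convex hull c"
      using face_of_convex_hull_affine_independent[OF T(6)] by blast
    have "vertices (rel_interior S) = c"
      unfolding c(2) by (rule vertices_hull) (use affine_independent_subset T(6) c(1) in blast)
    then show "vertices (rel_interior S) \<subseteq> vertices (rel_interior T)"
      using c(1) by simp
  }
  assume "vertices (rel_interior S) \<subseteq> vertices (rel_interior T)"
  then have "convex hull vertices (rel_interior S) \<subseteq> convex hull vertices (rel_interior T)"
    by (rule hull_mono)
  then show "S \<subseteq> T"
    using S(7) T(7) by simp
qed

lemma cell_le_iff: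
  assumes "x \<in> cells X" "y \<in> cells X"
  shows "cell_le X y x \<longleftrightarrow> vertices y \<subseteq> vertices x"
proof -
  obtain S T where S: "S \<in> K" "x = rel_interior S" and T: "T \<in> K" "y = rel_interior T"
    using assms unfolding cells by metis
  obtain n m where s: "n simplex S" "m simplex T" using K_simplex S T by blast
  note SF = simplex_facts[OF s(1)] and TF = simplex_facts[OF s(2)]
  have "rel_interior S \<subseteq> \<Union>K" "S \<subseteq> \<Union>K"
    using S rel_interior_subset by blast+
  then have "cw_space X closure_of x = S"
    using SF(4) S by (simp add: simplicial_cw_def closure_of_subtopology inf.absorb2)
  then have "cell_le X y x \<longleftrightarrow> rel_interior T \<subseteq> S"
    by (simp add: cell_le_def T)
  also have "\<dots> \<longleftrightarrow> T \<subseteq> S"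
  proof
    assume "rel_interior T \<subseteq> S"
    then have "closure (rel_interior T) \<subseteq> S"
      using SF(2) by (rule closure_minimal)
    then show "T \<subseteq> S" using TF(4) by simp
  next
    assume "T \<subseteq> S"
    then show "rel_interior T \<subseteq> S" using rel_interior_subset by blast
  qed
  finally show ?thesis
    using subset_iff_vertices[OF T(1) S(1)] S T by simp
qed

lemma inj_vertices: "inj_on vertices (cells X)"
proof (rule inj_onI)
  fix x y assume xy: "x \<in> cells X" "y \<in> cells X" "vertices x = vertices y"
  obtain S T where S: "S \<in> K" "x = rel_interior S" and T: "T \<in> K" "y = rel_interior T"
    using xy(1,2) unfolding cells by metis
  then have "S = T"
    using subset_iff_vertices[OF S(1) T(1)] subset_iff_vertices[OF T(1) S(1)] xy(3) by auto
  then show "x = y" using S T by simp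
qed

lemma cell_less_iff_vertices:
  assumes "x \<in> cells X" "y \<in> cells X"
  shows "cell_less X y x \<longleftrightarrow> vertices y \<subset> vertices x"
proof -
  have "y = x \<longleftrightarrow> vertices y = vertices x"
    using inj_on_eq_iff[OF inj_vertices assms(2,1)] by simp
  then show ?thesis
    unfolding cell_less_def cell_le_iff[OF assms] by auto
qed

lemma cell_vertices:
  assumes "x \<in> cells X"
  shows "finite (vertices x)" "vertices x \<noteq> {}" "card (vertices x) = Suc (cdim X x)"
proof -
  obtain S where S: "S \<in> K" "S \<noteq> {}" "x = rel_interior S" using assms(1) unfolding cells by metis
  obtain n where s: "n simplex S" using K_simplex S by blast
  note F = simplex_facts[OF s]
  show "finite (vertices x)" using F(5) S by simp
  show ne: "vertices x \<noteq> {}"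
    using F(7) S by auto
  have "cdim X x = nat (aff_dim S)"
    using S F(3) by (simp add: simplicial_cw_def rel_interior_aff_dim)
  moreover have "aff_dim S \<ge> 0"
    using F(5,8) ne S(3) card_gt_0_iff[of "vertices x"] by simp
  ultimately show "card (vertices x) = Suc (cdim X x)"
    using F(8) S by simp
qed

lemma vertices_closed:
  assumes "x \<in> cells X" "A \<subseteq> vertices x" "A \<noteq> {}"
  shows "A \<in> vertices ` cells X"
proof -
  obtain S where S: "S \<in> K" "S \<noteq> {}" "x = rel_interior S" using assms(1) unfolding cells by metis
  obtain n where s: "n simplex S" using K_simplex S by blast
  note F = simplex_facts[OF s]
  have "convex hull A face_of convex hull vertices x"
    using face_of_convex_hull_affine_independent[of "vertices x"] F(6) S(3) assms(2) by blast
  then have "convex hull A \<in> K"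
    using K_face[OF S(1)] F(7) S(3) by simp
  moreover have "vertices (rel_interior (convex hull A)) = A"
    by (rule vertices_hull) (use affine_independent_subset F(6) S(3) assms(2) in blast)
  ultimately show ?thesis
    using assms(3) cells[of "rel_interior (convex hull A)"] by force
qed

lemma discrete_morse_complex:
  assumes m: "discrete_morse X f"
  shows "discrete_morse_complex X f vertices"
proof
  show "finite (cells X)" using K_finite by (simp add: simplicial_cw_def)
  show "inj_on vertices (cells X)" by (rule inj_vertices)
  show "x \<in> cells X \<Longrightarrow> finite (vertices x)" "x \<in> cells X \<Longrightarrow> vertices x \<noteq> {}"
    "x \<in> cells X \<Longrightarrow> card (vertices x) = Suc (cdim X x)" for x
    by (rule cell_vertices, assumption)+
  show "x \<in> cells X \<Longrightarrow> S \<subseteq> vertices x \<Longrightarrow> S \<noteq> {} \<Longrightarrow> S \<in> vertices ` cells X" for x S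
    by (rule vertices_closed)
  show "x \<in> cells X \<Longrightarrow> y \<in> cells X \<Longrightarrow> cell_less X y x \<longleftrightarrow> vertices y \<subset> vertices x" for x y
    by (rule cell_less_iff_vertices)
  show "discrete_morse X f" by (rule m)
  show rp: "x \<in> cells X \<and> y \<in> cells X \<and> vertices x \<subset> vertices y \<and> card (vertices y) = Suc (card (vertices x))"
    if "regular_pair X f x y" for x y
    using that cell_less_iff_vertices[of y x] cell_vertices(3)[of x] cell_vertices(3)[of y]
    by (auto simp: regular_pair_def)
  show "\<not> regular_pair X f y z" if xy: "regular_pair X f x y" for x y z
  proof
    assume yz: "regular_pair X f y z"
    note xy' = rp[OF xy] and yz' = rp[OF yz]
    have fin: "finite (vertices y)" "finite (vertices z)" using yz' cell_vertices(1) by blast+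
    \<comment> \<open>The facet \<open>u\<close> of \<open>z\<close> opposite to \<open>a\<close> is
      the other cell between \<open>x\<close> and \<open>z\<close>. The Morse condition at
      \<open>x\<close> gives \<open>f x < f u\<close> and at \<open>z\<close> gives
      \<open>f u < f z\<close>, against \<open>f z \<le> f y \<le> f x\<close>.\<close>
    obtain a where a: "a \<in> vertices y" "a \<notin> vertices x" using xy' by blast
    define A where "A = vertices z - {a}"
    have Ax: "vertices x \<subset> A"
    proof -
      have "card (vertices x) < card A"
        using xy' yz' a fin by (simp add: A_def card_Diff_singleton psubset_imp_subset subset_iff psubset_eq)
      moreover have "vertices x \<subseteq> A" using xy' yz' a by (auto simp: A_def)
      ultimately show ?thesis by auto
    qed
    have "A \<in> vertices ` cells X"
      using vertices_closed[of z A] yz' Ax by (auto simp: A_def)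
    then obtain u where u: "u \<in> cells X" "vertices u = A" by auto
    have cA: "card A = Suc (card (vertices x))"
      using xy' yz' a fin by (simp add: A_def card_Diff_singleton psubset_eq subset_iff)
    have "u \<noteq> y" using a u by (auto simp: A_def)
    have xu: "cell_less X x u" "cdim X u = cdim X x + 1"
      using Ax u xy' cell_less_iff_vertices cA cell_vertices(3)[of u] cell_vertices(3)[of x] by auto
    have "vertices u \<subset> vertices z" using u(2) a(1) yz' by (auto simp: A_def)
    then have uz: "cell_less X u z" "cdim X z = cdim X u + 1"
      using u yz' xy' cA cell_less_iff_vertices cell_vertices(3)[of u] cell_vertices(3)[of z] by auto
    have "\<not> f x \<ge> f u"
      using m xy xu u(1) \<open>u \<noteq> y\<close> unfolding discrete_morse_def Uniq_def regular_pair_def by metis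
    moreover have "\<not> f u \<ge> f z"
      using m yz uz u(1) \<open>u \<noteq> y\<close> unfolding discrete_morse_def Uniq_def regular_pair_def by metis
    ultimately show False
      using xy yz by (simp add: regular_pair_def)
  qed
qed

end

theorem theoremA:
  fixes K :: "'a::euclidean_space set set"
    and f :: "'a set \<Rightarrow> real"
    and w z :: "'a set"
  assumes "simplicial_complex K"
    and "discrete_morse (simplicial_cw K) f"
    and "C = Flo (simplicial_cw K) f"
    and "w \<in> Ob C" and "z \<in> Ob C"
  shows "is_face_poset (Hom C w z) (\<lambda>a b. Le C b a)"
proof -
  interpret geometric_complex K
    using assms(1) by unfold_locales
  interpret discrete_morse_complex "simplicial_cw K" f vertices
    using assms(2) by (rule discrete_morse_complex)
  show ?thesis
    using Flo_hom_face_poset assms(3-5) by simp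
qed

end
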